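(* Let $\mathcal{M}_r\subseteq\mathbb{R}^{l_1^r\times\dots\times l_D^r}$, $r=1,\dots,R$, be Tucker core structures. Assume that the tensor $\mathcal{A}\in\mathbb{R}^{n_1\times\dots\times n_D}$ has an orthogonal Tucker decomposition $\mathcal{A}=(Q_1,\dots,Q_D)\cdot\mathcal{G}$ with $\mathcal{G}\in\mathbb{R}^{m_1\times\dots\times m_D}$ and each $Q_d\in\mathbb{R}^{n_d\times m_d}$ having orthonormal columns. Let $\mathcal{A}=\mathcal{A}_1+\dots+\mathcal{A}_R$ with $\mathcal{A}_r\in\mathcal{M}_r^{n_1,\dots,n_D}$ and $\mathcal{G}=\mathcal{G}_1+\dots+\mathcal{G}_R$ with $\mathcal{G}_r\in\mathcal{M}_r^{m_1,\dots,m_D}$ be structured block term decompositions related by $\mathcal{A}_r=(Q_1,\dots,Q_D)\cdot\mathcal{G}_r$ for each $r=1,\dots,R$. Then $$\kappa^{\mathrm{SBTD}}(\mathcal{A}_1,\dots,\mathcal{A}_R)=\kappa^{\mathrm{SBTD}}(\mathcal{G}_1,\dots,\mathcal{G}_R).$$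
   Context: For matrices $A_d\in\mathbb{R}^{k_d\times l_d}$ and $\mathcal{C}=(c_{i_1\dots i_D})$, $(A_1,\dots,A_D)\cdot\mathcal{C}:=\sum c_{i_1\dots i_D}(A_1e_{i_1})\otimes\dots\otimes(A_De_{i_D})$. $\mathbb{R}^{n\times l}_\star$ denotes real $n\times l$ matrices of rank $l$. A Tucker core structure is a smooth submanifold $\mathcal{M}\subseteq\mathbb{R}^{l_1\times\dots\times l_D}$ such that every $\mathcal{C}\in\mathcal{M}$ has multilinear rank $(l_1,\dots,l_D)$ and $(A_1,\dots,A_D)\cdot\mathcal{C}\in\mathcal{M}$ for all $A_d\in\mathrm{GL}(l_d)$. For $k_d\ge l_d$, the structured Tucker manifold is $\mathcal{M}^{k_1,\dots,k_D}:=\{(U_1,\dots,U_D)\cdot\mathcal{C}:\mathcal{C}\in\mathcal{M},U_d\in\mathbb{R}^{k_d\times l_d}_\star\}$, a smooth embedded submanifold of $\mathbb{R}^{k_1\times\dots\times k_D}$. A structured block term decomposition (SBTD) of a tensor $\mathcal{B}$ is $\mathcal{B}=\mathcal{B}_1+\dots+\mathcal{B}_R$ with $\mathcal{B}_r\in\mathcal{M}_r^{k_1,\dots,k_D}$. Its condition number: let $T_r$ be a matrix whose columns form an orthonormal basis (Euclidean inner product) of the vectorized tangent space $T_{\mathcal{B}_r}\mathcal{M}_r^{k_1,\dots,k_D}$, let $T=[T_1\ \cdots\ T_R]$ (Terracini matrix) have $N$ columns, and set $\kappa^{\mathrm{SBTD}}(\mathcal{B}_1,\dots,\mathcal{B}_R):=1/\sigma_N(T)$,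 where $\sigma_N$ is the $N$-th largest singular value (taken $0$ if $N$ exceeds the number of rows) and $1/0=\infty$. This coincides with the condition number of the local inverse of the addition map $(\mathcal{B}_1,\dots,\mathcal{B}_R)\mapsto\sum_r\mathcal{B}_r$. *)

theory Defs
  imports "HOL-Analysis.Analysis" "HOL-Analysis.Finite_Function_Topology"
begin

text \<open>A tensor of any order is a finitely supported real function on multi-indices
(lists of naturals). The tensors of size n_1 x ... x n_D are those supported in the
index box of ns = [n_1,...,n_D]. Matrices are functions row => column => real.\<close>

type_synonym tensor = "nat list \<Rightarrow>\<^sub>0 real"
type_synonym mat = "nat \<Rightarrow> nat \<Rightarrow> real"

definition ibox :: "nat list \<Rightarrow> nat list set" where
  "ibox ns = {i. length i = length ns \<and> (\<forall>d<length ns. i ! d < ns ! d)}"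

definition tspace :: "nat list \<Rightarrow> tensor set" where
  "tspace ns = {A. Poly_Mapping.keys A \<subseteq> ibox ns}"

definition tinner :: "tensor \<Rightarrow> tensor \<Rightarrow> real" where
  "tinner A B = (\<Sum>i\<in>Poly_Mapping.keys A \<union> Poly_Mapping.keys B.
                   Poly_Mapping.lookup A i * Poly_Mapping.lookup B i)"

text \<open>Multilinear multiplication (A_1,...,A_D) . C for C of size ls and A_d of size ks!d x ls!d:
  the sum over i of c_i (A_1 e_{i_1}) (x) ... (x) (A_D e_{i_D}).\<close>
definition mlmult :: "nat list \<Rightarrow> nat list \<Rightarrow> mat list \<Rightarrow> tensor \<Rightarrow> tensor" where
  "mlmult ks ls As C = Abs_poly_mapping (\<lambda>j. if j \<in> ibox ks then
      (\<Sum>i\<in>ibox ls. Poly_Mapping.lookup C i * (\<Prod>d<length ls. (As ! d) (j ! d) (i ! d)))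
     else 0)"

definition full_col_rank :: "nat \<Rightarrow> nat \<Rightarrow> mat \<Rightarrow> bool" where
  "full_col_rank k l U \<longleftrightarrow>
     (\<forall>x::nat \<Rightarrow> real. (\<forall>j<k. (\<Sum>i<l. U j i * x i) = 0) \<longrightarrow> (\<forall>i<l. x i = 0))"

definition invertible_mat :: "nat \<Rightarrow> mat \<Rightarrow> bool" where
  "invertible_mat l U \<longleftrightarrow> full_col_rank l l U"

definition orthonormal_cols :: "nat \<Rightarrow> nat \<Rightarrow> mat \<Rightarrow> bool" where
  "orthonormal_cols k l Q \<longleftrightarrow>
     (\<forall>i<l. \<forall>i'<l. (\<Sum>j<k. Q j i * Q j i') = (if i = i' then 1 else 0))"

text \<open>Multilinear rank of C (of size ls) equals ls: every mode-d unfolding C_(d)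
  (an ls!d x (prod of the other ls) matrix) has rank ls!d, i.e. full row rank.\<close>
definition full_mlrank :: "nat list \<Rightarrow> tensor \<Rightarrow> bool" where
  "full_mlrank ls C \<longleftrightarrow> (\<forall>d<length ls. \<forall>y::nat \<Rightarrow> real.
     (\<forall>i\<in>ibox ls. (\<Sum>j<ls ! d. y j * Poly_Mapping.lookup C (i[d := j])) = 0)
       \<longrightarrow> (\<forall>j<ls ! d. y j = 0))"

definition dderiv :: "(tensor \<Rightarrow> 'b::real_normed_vector) \<Rightarrow> tensor \<Rightarrow> tensor \<Rightarrow> 'b" where
  "dderiv f x v = vector_derivative (\<lambda>t. f (x + t *\<^sub>R v)) (at 0)"

fun dd_cont :: "tensor set \<Rightarrow> (tensor \<Rightarrow> 'b::real_normed_vector) \<Rightarrow> tensor list \<Rightarrow> bool" where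
  "dd_cont W f [] = continuous_on W f"
| "dd_cont W f (v # vs) =
     ((\<forall>x\<in>W. (\<lambda>t. f (x + t *\<^sub>R v)) differentiable (at 0)) \<and> dd_cont W (\<lambda>x. dderiv f x v) vs)"

text \<open>C^infinity on a relatively open subset W of the finite-dimensional space V:
  all iterated directional derivatives (directions in V) exist and are continuous.\<close>
definition smooth_on :: "tensor set \<Rightarrow> tensor set \<Rightarrow> (tensor \<Rightarrow> 'b::real_normed_vector) \<Rightarrow> bool" where
  "smooth_on V W f \<longleftrightarrow> (\<forall>vs. set vs \<subseteq> V \<longrightarrow> dd_cont W f vs)"

definition embedded_submanifold :: "tensor set \<Rightarrow> tensor set \<Rightarrow> bool" where
  "embedded_submanifold V M \<longleftrightarrow> M \<subseteq> V \<and>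
     (\<forall>p\<in>M. \<exists>U (F :: tensor \<Rightarrow> tensor) S. open U \<and> p \<in> U \<and> subspace S \<and>
        smooth_on V (U \<inter> V) F \<and> F ` (U \<inter> V) \<subseteq> S \<and>
        (\<forall>x\<in>U \<inter> V. dderiv F x ` V = S) \<and>
        M \<inter> U = {x \<in> U \<inter> V. F x = 0})"

definition tangent_space :: "tensor set \<Rightarrow> tensor \<Rightarrow> tensor set" where
  "tangent_space M p = {v. \<exists>\<gamma> e. e > 0 \<and> \<gamma> 0 = p \<and> (\<forall>t. \<bar>t\<bar> < e \<longrightarrow> \<gamma> t \<in> M) \<and>
                         (\<gamma> has_vector_derivative v) (at 0)}"

definition tucker_core_structure :: "nat list \<Rightarrow> tensor set \<Rightarrow> bool" where
  "tucker_core_structure ls M \<longleftrightarrow>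
     embedded_submanifold (tspace ls) M \<and>
     (\<forall>C\<in>M. full_mlrank ls C) \<and>
     (\<forall>C\<in>M. \<forall>As. length As = length ls \<and> (\<forall>d<length ls. invertible_mat (ls ! d) (As ! d))
                   \<longrightarrow> mlmult ls ls As C \<in> M)"

definition structured_tucker :: "nat list \<Rightarrow> nat list \<Rightarrow> tensor set \<Rightarrow> tensor set" where
  "structured_tucker ks ls M = {mlmult ks ls Us C | C Us. C \<in> M \<and> length Us = length ls \<and>
       (\<forall>d<length ls. full_col_rank (ks ! d) (ls ! d) (Us ! d))}"

definition onb_list :: "tensor set \<Rightarrow> tensor list \<Rightarrow> bool" where
  "onb_list S bs \<longleftrightarrow> span (set bs) = S \<and>
     (\<forall>i<length bs. \<forall>j<length bs. tinner (bs ! i) (bs ! j) = (if i = j then 1 else 0))"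

definition terracini_cols :: "tensor set list \<Rightarrow> tensor list \<Rightarrow> tensor list" where
  "terracini_cols Ms Bs = concat (map (\<lambda>r. SOME bs. onb_list (tangent_space (Ms ! r) (Bs ! r)) bs)
                                      [0..<length Bs])"

text \<open>N-th largest singular value of the matrix with N columns cols and nrows rows
  (0 if N > nrows): the square root of the N-th largest, i.e. smallest, eigenvalue of the
  N x N Gram matrix T^T T.\<close>
definition sigma_last :: "nat \<Rightarrow> tensor list \<Rightarrow> real" where
  "sigma_last nrows cols = (let N = length cols; G = (\<lambda>i j. tinner (cols ! i) (cols ! j)) in
     if N > nrows then 0 else
     sqrt (Min {ev. \<exists>x::nat \<Rightarrow> real. (\<exists>j<N. x j \<noteq> 0) \<and>
                         (\<forall>i<N. (\<Sum>j<N. G i j * x j) = ev * x i)}))"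

definition kappa_sbtd :: "nat list \<Rightarrow> tensor set list \<Rightarrow> tensor list \<Rightarrow> ereal" where
  "kappa_sbtd ns Ms Bs = (let s = sigma_last (\<Prod>d<length ns. ns ! d) (terracini_cols Ms Bs) in
     if s = 0 then \<infinity> else ereal (1 / s))"

end

theory Submission
  imports Defs
begin

text \<open>At \<open>U \<cdot> C\<close> the tangent space of a structured Tucker manifold consists of the tensors
  \<open>U \<cdot> c + \<Sum>\<^sub>d (U\<^sub>1, \<dots>, X\<^sub>d, \<dots>, U\<^sub>D) \<cdot> C\<close> with \<open>c\<close> tangent to the core structure and arbitrary \<open>X\<^sub>d\<close>.
  Hence a tangent vector at \<open>Q \<cdot> G\<^sub>r\<close> is the image under \<open>Q\<close> of a tangent vector at \<open>G\<^sub>r\<close> plus, for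
  each mode, a term whose \<open>d\<close>-th factor is orthogonal to the range of \<open>Q\<^sub>d\<close>; all these parts are
  orthogonal to each other, also across different \<open>r\<close>. The \<open>d\<close>-slices of the extra terms are
  isometric to tangent vectors at \<open>G\<^sub>r\<close>, so the extra terms satisfy every bound
  \<open>c \<Sum> |v\<^sub>r|\<^sup>2 \<le> |\<Sum> v\<^sub>r|\<^sup>2\<close> that holds for the tangent vectors at the \<open>G\<^sub>r\<close>. The best such
  \<open>c\<close> is the squared smallest singular value of the Terracini matrix.\<close>

subsection \<open>Tensors\<close>

text \<open>Tensors of all sizes share one type, which is infinite-dimensional and incomplete; every
  analytic argument is therefore confined to a finite support. A tangent vector is the velocity of a
  curve that need only be differentiable at one instant, so linearity of tangent spaces, without
  which they have no orthonormal bases, has to be extracted from local equations by an implicit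
  function argument. A curve in a structured Tucker manifold comes with no differentiable choice of
  core and factors; one is produced by a linear system whose solvability near the base point rests
  on full multilinear rank. The two Terracini matrices differ in size, and their blocks are
  arbitrary bases, so they are compared through the inequalities
  \<open>c * |x|^2 <= |T x|^2\<close>, which see only the tangent spaces. With more columns than
  rows a kernel vector makes \<open>c = 0\<close> the best constant, in agreement with the
  convention for the singular value.\<close>

abbreviation lk :: "tensor \<Rightarrow> nat list \<Rightarrow> real" where
  "lk \<equiv> Poly_Mapping.lookup"

lemma finite_ibox [simp]: "finite (ibox ns)"
proof -
  have "ibox ns \<subseteq> {i. set i \<subseteq> {..<Max (insert 0 (set ns))} \<and> length i = length ns}"
  proof
    fix i assume i: "i \<in> ibox ns"
    have "x < Max (insert 0 (set ns))" if x: "x \<in> set i" for x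
    proof -
      have len: "length i = length ns" using i by (simp add: ibox_def)
      obtain d where d: "d < length ns" "x = i ! d"
        using x len unfolding in_set_conv_nth by auto
      then have "x < ns ! d" using i by (auto simp: ibox_def)
      also have "\<dots> \<le> Max (insert 0 (set ns))"
        using d by (intro Max_ge) auto
      finally show ?thesis .
    qed
    then show "i \<in> {i. set i \<subseteq> {..<Max (insert 0 (set ns))} \<and> length i = length ns}"
      using i by (auto simp: ibox_def)
  qed
  then show ?thesis
    using finite_lists_length_eq finite_subset by blast
qed

lemma tspace_iff: "A \<in> tspace ns \<longleftrightarrow> (\<forall>i. i \<notin> ibox ns \<longrightarrow> lk A i = 0)"
  by (auto simp: tspace_def in_keys_iff)

lemma lookup_scaleR [simp]: "lk (c *\<^sub>R A) i = c * lk A i"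
  unfolding scaleR_poly_mapping_def
  by (simp add: Abs_poly_mapping_inverse finite_subset[OF _ finite_lookup[of A]] Collect_mono)

lemma subspace_supported: "subspace {A::tensor. \<forall>i. i \<notin> I \<longrightarrow> lk A i = 0}"
  by (auto simp: subspace_def lookup_add)

lemma tspace_eq: "tspace ns = {A. \<forall>i. i \<notin> ibox ns \<longrightarrow> lk A i = 0}"
  by (auto simp: tspace_iff)

lemma subspace_tspace: "subspace (tspace ns)"
  unfolding tspace_eq by (rule subspace_supported)

lemma linear_lookup: "linear (\<lambda>A. lk A i)"
  by (rule linearI) (auto simp: lookup_add)

text \<open>The norm of this type is the l1 norm. It supplies the topology, whereas lengths and
  angles come from \<open>tinner\<close>.\<close>

lemma tensor_norm_eq:
  assumes "finite I" "\<And>i. i \<notin> I \<Longrightarrow> lk A i = 0"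
  shows "norm A = (\<Sum>i\<in>I. \<bar>lk A i\<bar>)"
proof -
  have "norm A = (\<Sum>i\<in>Poly_Mapping.keys A. \<bar>lk A i\<bar>)"
    by (simp add: norm_poly_mapping_def dist_poly_mapping_def)
  also have "\<dots> = (\<Sum>i\<in>I. \<bar>lk A i\<bar>)"
    using assms by (intro sum.mono_neutral_left) (auto simp: in_keys_iff)
  finally show ?thesis .
qed

lemma abs_lookup_le_norm: "\<bar>lk A i\<bar> \<le> norm A"
proof (cases "i \<in> Poly_Mapping.keys A")
  case True
  then show ?thesis
    unfolding tensor_norm_eq[of "Poly_Mapping.keys A" A, simplified in_keys_iff, simplified]
    by (intro member_le_sum[of i _ "\<lambda>i. \<bar>lk A i\<bar>"]) auto
qed (simp add: in_keys_iff)

lemma bounded_linear_lookup: "bounded_linear (\<lambda>A. lk A i)"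
  using linear_lookup abs_lookup_le_norm
  by (intro bounded_linear_intro[of _ 1]) (auto simp: lookup_add)

lemma tensor_expand:
  assumes "finite I" "\<And>i. i \<notin> I \<Longrightarrow> lk A i = 0"
  shows "A = (\<Sum>i\<in>I. lk A i *\<^sub>R Poly_Mapping.single i 1)"
proof (rule poly_mapping_eqI)
  fix k
  have "lk (\<Sum>i\<in>I. lk A i *\<^sub>R Poly_Mapping.single i 1) k
      = (\<Sum>i\<in>I. if i = k then lk A i else 0)"
    by (auto simp: lookup_sum lookup_single when_def intro!: sum.cong)
  also have "\<dots> = lk A k" using assms by simp
  finally show "lk A k = lk (\<Sum>i\<in>I. lk A i *\<^sub>R Poly_Mapping.single i 1) k" by simp
qed

lemma single_in_tspace: "i \<in> ibox ns \<Longrightarrow> Poly_Mapping.single i c \<in> tspace ns"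
  by (auto simp: tspace_iff lookup_single when_def)

text \<open>On the whole type a linear map may be unbounded; on a fixed finite support the images of
  finitely many unit tensors give a bound.\<close>

lemma linear_tensor_bounded:
  fixes L :: "tensor \<Rightarrow> 'b::real_normed_vector"
  assumes L: "linear L" and I: "finite I"
  obtains K where "K > 0" "\<And>A. (\<And>i. i \<notin> I \<Longrightarrow> lk A i = 0) \<Longrightarrow> norm (L A) \<le> K * norm A"
proof
  let ?K = "1 + (\<Sum>i\<in>I. norm (L (Poly_Mapping.single i 1)))"
  have nn: "0 \<le> (\<Sum>i\<in>I. norm (L (Poly_Mapping.single i 1)))" by (intro sum_nonneg) auto
  then show "?K > 0" by linarith
  fix A :: tensor assume A: "\<And>i. i \<notin> I \<Longrightarrow> lk A i = 0"
  have "L A = L (\<Sum>i\<in>I. lk A i *\<^sub>R Poly_Mapping.single i 1)"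
    using tensor_expand[OF I A] by simp
  also have "\<dots> = (\<Sum>i\<in>I. lk A i *\<^sub>R L (Poly_Mapping.single i 1))"
    using L by (simp add: linear_sum linear_cmul)
  finally have "norm (L A) \<le> (\<Sum>i\<in>I. norm (lk A i *\<^sub>R L (Poly_Mapping.single i 1)))"
    by (simp only: norm_sum)
  also have "\<dots> \<le> (\<Sum>i\<in>I. norm A * norm (L (Poly_Mapping.single i 1)))"
    by (intro sum_mono) (auto intro!: mult_right_mono abs_lookup_le_norm)
  also have "\<dots> \<le> ?K * norm A"
    using nn by (simp add: sum_distrib_left[symmetric] algebra_simps)
  finally show "norm (L A) \<le> ?K * norm A" .
qed

text \<open>The fixed-point argument below needs completeness, which the type itself lacks.\<close>

lemma complete_supported:
  assumes I: "finite I"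
  shows "complete {A::tensor. \<forall>i. i \<notin> I \<longrightarrow> lk A i = 0}"
proof (rule completeI)
  fix f :: "nat \<Rightarrow> tensor"
  assume f: "\<forall>n. f n \<in> {A. \<forall>i. i \<notin> I \<longrightarrow> lk A i = 0}" and C: "Cauchy f"
  have "Cauchy (\<lambda>n. lk (f n) i)" for i
    by (rule bounded_linear.Cauchy[OF bounded_linear_lookup C])
  then have "\<exists>l. (\<lambda>n. lk (f n) i) \<longlonglongrightarrow> l" for i
    by (simp add: Cauchy_convergent_iff convergent_def)
  then obtain l where l: "\<And>i. (\<lambda>n. lk (f n) i) \<longlonglongrightarrow> l i" by metis
  define A :: tensor where "A = (\<Sum>i\<in>I. l i *\<^sub>R Poly_Mapping.single i 1)"
  have "(\<lambda>n. \<Sum>i\<in>I. lk (f n) i *\<^sub>R (Poly_Mapping.single i 1 :: tensor)) \<longlonglongrightarrow> A"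
    unfolding A_def by (intro tendsto_sum tendsto_scaleR l tendsto_const)
  moreover have "(\<lambda>n. \<Sum>i\<in>I. lk (f n) i *\<^sub>R (Poly_Mapping.single i 1 :: tensor)) = f"
    using f tensor_expand[OF I] by fastforce
  ultimately have "f \<longlonglongrightarrow> A" by simp
  moreover have "A \<in> {A. \<forall>i. i \<notin> I \<longrightarrow> lk A i = 0}"
    by (auto simp: A_def lookup_sum lookup_single when_def intro!: sum.neutral)
  ultimately show "\<exists>l\<in>{A. \<forall>i. i \<notin> I \<longrightarrow> lk A i = 0}. f \<longlonglongrightarrow> l" by blast
qed

section \<open>Derivatives of curves at time 0\<close>

text \<open>In this form curves that are known only near 0, or are built by arbitrary choices, can
  be differentiated.\<close>

lemma has_vector_derivative_at_0_iff:
  "(f has_vector_derivative v) (at 0) \<longleftrightarrow> ((\<lambda>t::real. (f t - f 0) /\<^sub>R t) \<longlongrightarrow> v) (at 0)"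
  for f :: "real \<Rightarrow> 'b::real_normed_vector"
proof -
  have "(f has_vector_derivative v) (at 0) \<longleftrightarrow>
     ((\<lambda>t. ((f t - f 0) - t *\<^sub>R v) /\<^sub>R norm t) \<longlongrightarrow> 0) (at 0)"
    by (simp add: has_vector_derivative_def has_derivative_def bounded_linear_scaleR_left
        netlimit_at)
  also have "\<dots> \<longleftrightarrow> ((\<lambda>t. norm (((f t - f 0) - t *\<^sub>R v) /\<^sub>R norm t)) \<longlongrightarrow> 0) (at 0)"
    by (rule tendsto_norm_zero_iff[symmetric])
  also have "\<dots> \<longleftrightarrow> ((\<lambda>t. norm ((f t - f 0) /\<^sub>R t - v)) \<longlongrightarrow> 0) (at 0)"
  proof (rule tendsto_cong)
    have "norm (((f t - f 0) - t *\<^sub>R v) /\<^sub>R norm t) = norm ((f t - f 0) /\<^sub>R t - v)" if "t \<noteq> 0" for t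
    proof -
      have "(f t - f 0) /\<^sub>R t - v = ((f t - f 0) - t *\<^sub>R v) /\<^sub>R t"
        using that by (simp add: scaleR_diff_right)
      then show ?thesis by simp
    qed
    then show "\<forall>\<^sub>F t in at 0. norm (((f t - f 0) - t *\<^sub>R v) /\<^sub>R norm t) = norm ((f t - f 0) /\<^sub>R t - v)"
      by (simp add: eventually_at_filter)
  qed
  also have "\<dots> \<longleftrightarrow> ((\<lambda>t. (f t - f 0) /\<^sub>R t) \<longlongrightarrow> v) (at 0)"
    unfolding tendsto_norm_zero_iff by (rule Lim_null[symmetric])
  finally show ?thesis .
qed

lemma tensor_curve_derivative_iff:
  assumes "finite I" "\<And>t i. i \<notin> I \<Longrightarrow> lk (\<gamma> t) i = 0" "\<And>i. i \<notin> I \<Longrightarrow> lk v i = 0"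
  shows "(\<gamma> has_vector_derivative v) F \<longleftrightarrow>
    (\<forall>i\<in>I. ((\<lambda>t. lk (\<gamma> t) i) has_vector_derivative lk v i) F)"
proof
  assume "(\<gamma> has_vector_derivative v) F"
  then show "\<forall>i\<in>I. ((\<lambda>t. lk (\<gamma> t) i) has_vector_derivative lk v i) F"
    using bounded_linear.has_vector_derivative[OF bounded_linear_lookup] by blast
next
  assume "\<forall>i\<in>I. ((\<lambda>t. lk (\<gamma> t) i) has_vector_derivative lk v i) F"
  then have "((\<lambda>t. \<Sum>i\<in>I. lk (\<gamma> t) i *\<^sub>R (Poly_Mapping.single i 1::tensor)) has_vector_derivative
      (\<Sum>i\<in>I. lk v i *\<^sub>R Poly_Mapping.single i 1)) F"
    by (intro has_vector_derivative_sum
        bounded_linear.has_vector_derivative[OF bounded_linear_scaleR_left]) auto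
  moreover have "(\<lambda>t. \<Sum>i\<in>I. lk (\<gamma> t) i *\<^sub>R (Poly_Mapping.single i 1::tensor)) = \<gamma>"
    using tensor_expand[OF assms(1)] assms(2) by fastforce
  ultimately show "(\<gamma> has_vector_derivative v) F"
    using tensor_expand[of I v] assms by simp
qed

subsection \<open>Tangent spaces of embedded submanifolds\<close>

text \<open>A coordinatewise box rather than a ball of the l1 norm: replacing some coordinates of
  one point by those of another may leave a ball but not a box.\<close>

definition in_box :: "nat list set \<Rightarrow> tensor \<Rightarrow> real \<Rightarrow> tensor \<Rightarrow> bool" where
  "in_box I p \<delta> x \<longleftrightarrow> (\<forall>i. if i \<in> I then \<bar>lk x i - lk p i\<bar> < \<delta> else lk x i = 0)"

text \<open>Moving from y to x one coordinate at a time keeps every intermediate point in the box,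
  so only the partial derivatives have to be controlled.\<close>
lemma box_increment_bound:
  fixes F :: "tensor \<Rightarrow> 'b::real_normed_vector"
  assumes I: "finite I" and "J \<subseteq> I" and D: "linear D"
    and df: "\<And>x i. in_box I p \<delta> x \<Longrightarrow> i \<in> I \<Longrightarrow>
      (\<lambda>t. F (x + t *\<^sub>R Poly_Mapping.single i 1)) differentiable (at 0)"
    and b: "\<And>x i. in_box I p \<delta> x \<Longrightarrow> i \<in> I \<Longrightarrow>
      norm (dderiv F x (Poly_Mapping.single i 1) - D (Poly_Mapping.single i 1)) \<le> \<epsilon>"
    and "in_box I p \<delta> x" "in_box I p \<delta> y" "\<And>i. i \<notin> J \<Longrightarrow> lk x i = lk y i"
  shows "norm (F x - F y - D (x - y)) \<le> \<epsilon> * norm (x - y)"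
proof -
  have "finite J" using assms(1,2) finite_subset by blast
  then show ?thesis using assms(2,6,7,8)
  proof (induction J arbitrary: y)
    case empty
    then have "x = y" by (intro poly_mapping_eqI) auto
    then show ?case using linear_0[OF D] by simp
  next
    case (insert j J)
    define c where "c = lk x j - lk y j"
    define e :: tensor where "e = Poly_Mapping.single j 1"
    define z where "z = y + c *\<^sub>R e"
    have j: "j \<in> I" using insert by auto
    have lkz: "lk (y + s *\<^sub>R e) i = (if i = j then lk y j + s else lk y i)" for i s
      by (auto simp: e_def lookup_add lookup_single when_def)
    have box: "in_box I p \<delta> (y + s *\<^sub>R e)" if s: "s \<in> closed_segment 0 c" for s
    proof -
      have "\<bar>lk y j + s - lk p j\<bar> < \<delta>"
      proof -
        have 1: "\<bar>lk y j - lk p j\<bar> < \<delta>" "\<bar>lk x j - lk p j\<bar> < \<delta>"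
          using insert.prems(2,3) j by (auto simp: in_box_def split: if_splits)
        show ?thesis using s 1 unfolding c_def closed_segment_eq_real_ivl
          by (auto simp: abs_less_iff split: if_splits)
      qed
      then show ?thesis using insert.prems(3) j unfolding in_box_def lkz by auto
    qed
    have boxz: "in_box I p \<delta> z" unfolding z_def by (rule box) simp
    have lkz': "lk z i = lk x i" if "i \<notin> J" for i
      using that insert.prems(4)[of i] unfolding z_def lkz c_def by auto
    have IH: "norm (F x - F z - D (x - z)) \<le> \<epsilon> * norm (x - z)"
      using insert.IH[OF _ insert.prems(2) boxz] insert.prems(1) lkz' by auto
    have der: "((\<lambda>s. F (y + s *\<^sub>R e)) has_vector_derivative dderiv F (y + s *\<^sub>R e) e) (at s)"
      if s: "s \<in> closed_segment 0 c" for s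
    proof -
      have "((\<lambda>t. F ((y + s *\<^sub>R e) + t *\<^sub>R e)) has_vector_derivative dderiv F (y + s *\<^sub>R e) e) (at 0)"
        using df[OF box[OF s] j] unfolding dderiv_def e_def
        by (simp add: vector_derivative_works)
      then have "((\<lambda>t. F ((y + s *\<^sub>R e) + t *\<^sub>R e)) has_vector_derivative dderiv F (y + s *\<^sub>R e) e)
          (at (s - s))" by simp
      moreover have "((\<lambda>u. u - s) has_vector_derivative 1 - 0) (at s)"
        by (intro has_vector_derivative_diff has_vector_derivative_id has_vector_derivative_const)
      ultimately have "((\<lambda>t. F ((y + s *\<^sub>R e) + t *\<^sub>R e)) \<circ> (\<lambda>u. u - s) has_vector_derivative
          (1 - 0) *\<^sub>R dderiv F (y + s *\<^sub>R e) e) (at s)"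
        by (rule vector_diff_chain_at[rotated])
      moreover have "(\<lambda>t. F ((y + s *\<^sub>R e) + t *\<^sub>R e)) \<circ> (\<lambda>u. u - s) = (\<lambda>s. F (y + s *\<^sub>R e))"
        by (simp add: o_def add.assoc flip: scaleR_left_distrib)
      ultimately show ?thesis by simp
    qed
    have step: "norm (F z - F y - D (z - y)) \<le> \<epsilon> * norm (z - y)"
    proof -
      \<comment> \<open>Subtracting the linear part first makes the mean value inequality bound the
        linearisation error itself.\<close>
      let ?h = "\<lambda>s. F (y + s *\<^sub>R e) - s *\<^sub>R D e"
      have "norm (?h c - ?h 0) \<le> \<epsilon> * norm (c - 0)"
      proof (rule differentiable_bound[where S="closed_segment 0 c"
            and f' = "\<lambda>s t. t *\<^sub>R (dderiv F (y + s *\<^sub>R e) e - D e)"])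
        fix s assume s: "s \<in> closed_segment 0 c"
        have "(?h has_vector_derivative (dderiv F (y + s *\<^sub>R e) e - D e)) (at s)"
          using der[OF s] by (auto intro!: derivative_eq_intros)
        then show "(?h has_derivative (\<lambda>t. t *\<^sub>R (dderiv F (y + s *\<^sub>R e) e - D e)))
            (at s within closed_segment 0 c)"
          using has_derivative_at_withinI has_vector_derivative_def by blast
        have "norm (dderiv F (y + s *\<^sub>R e) e - D e) \<le> \<epsilon>"
          using b[OF box[OF s] j] by (simp add: e_def)
        then show "onorm (\<lambda>t. t *\<^sub>R (dderiv F (y + s *\<^sub>R e) e - D e)) \<le> \<epsilon>"
          using onorm_scaleR_left[OF bounded_linear_ident, of "dderiv F (y + s *\<^sub>R e) e - D e"]
          by (simp add: onorm_id)
      qed auto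
      moreover have "norm (z - y) = \<bar>c\<bar>"
      proof -
        have "norm e = 1" unfolding e_def
          by (subst tensor_norm_eq[of "{j}"]) (auto simp: lookup_single when_def)
        then show ?thesis by (simp add: z_def)
      qed
      moreover have "D (z - y) = c *\<^sub>R D e" by (simp add: z_def linear_cmul[OF D])
      ultimately show ?thesis by (auto simp: z_def algebra_simps)
    qed
    \<comment> \<open>\<open>z\<close> differs from \<open>x\<close> only on \<open>J\<close> and
      from \<open>y\<close> only at \<open>j\<close>, so the l1 norm is additive here; with a mere
      triangle inequality the errors of the single moves would not add up to
      \<open>\<epsilon> * norm (x - y)\<close>.\<close>
    have nrm: "norm (x - y) = norm (x - z) + norm (z - y)"
    proof -
      have sup: "lk x i = 0" "lk y i = 0" "lk z i = 0" if "i \<notin> I" for i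
        using that insert.prems(2,3) boxz by (auto simp: in_box_def split: if_splits)
      have pw: "\<bar>lk (x - y) i\<bar> = \<bar>lk (x - z) i\<bar> + \<bar>lk (z - y) i\<bar>" for i
        using lkz'[of i] insert.hyps insert.prems(4)[of i]
        by (auto simp: z_def lookup_add lookup_minus e_def lookup_single when_def c_def)
      show ?thesis
        using sup by (simp add: tensor_norm_eq[OF I] lookup_minus)
          (simp add: sum.distrib[symmetric] pw[unfolded lookup_minus])
    qed
    have "F x - F y - D (x - y) = (F x - F z - D (x - z)) + (F z - F y - D (z - y))"
      by (simp add: linear_diff[OF D])
    then have "norm (F x - F y - D (x - y)) \<le> \<epsilon> * norm (x - z) + \<epsilon> * norm (z - y)"
      using IH step norm_triangle_mono by metis
    then show ?case by (simp add: nrm distrib_left)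
  qed
qed

section \<open>Strict differentiability and the chain rule along curves\<close>

text \<open>Continuous partial derivatives control the difference of any two points near
  \<open>p\<close>. This two-point form of differentiability, rather than the usual one, is what
  makes an iteration near \<open>p\<close> contract.\<close>

lemma smooth_strictly_differentiable:
  fixes F :: "tensor \<Rightarrow> 'b::real_normed_vector"
  assumes U: "open U" "p \<in> U" "p \<in> tspace ns" and sm: "smooth_on (tspace ns) (U \<inter> tspace ns) F"
  obtains D where "linear D" "\<And>\<epsilon>. \<epsilon> > 0 \<Longrightarrow> \<exists>\<delta>>0. \<forall>x\<in>tspace ns. \<forall>y\<in>tspace ns.
      norm (x - p) < \<delta> \<longrightarrow> norm (y - p) < \<delta> \<longrightarrow> norm (F x - F y - D (x - y)) \<le> \<epsilon> * norm (x - y)"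
proof
  let ?e = "\<lambda>i. Poly_Mapping.single i 1 :: tensor"
  let ?I = "ibox ns"
  define D where "D u = (\<Sum>i\<in>?I. lk u i *\<^sub>R dderiv F p (?e i))" for u
  show D: "linear D"
    unfolding D_def by (rule linearI) (simp_all add: lookup_add scaleR_left_distrib sum.distrib
        scaleR_sum_right)
  have De: "D (?e i) = dderiv F p (?e i)" if "i \<in> ?I" for i
  proof -
    have "D (?e i) = (\<Sum>k\<in>?I. if k = i then dderiv F p (?e k) else 0)"
      unfolding D_def by (intro sum.cong) (auto simp: lookup_single when_def)
    then show ?thesis using that by simp
  qed
  have dd: "dd_cont (U \<inter> tspace ns) F [?e i]" if "i \<in> ?I" for i
    by (rule sm[unfolded smooth_on_def, rule_format]) (use that single_in_tspace in auto)
  fix \<epsilon> :: real assume \<epsilon>: "\<epsilon> > 0"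
  have "\<exists>\<delta>>0. \<forall>x\<in>U \<inter> tspace ns. dist x p < \<delta> \<longrightarrow>
      norm (dderiv F x (?e i) - dderiv F p (?e i)) \<le> \<epsilon>" if i: "i \<in> ?I" for i
  proof -
    have "continuous_on (U \<inter> tspace ns) (\<lambda>x. dderiv F x (?e i))" using dd[OF i] by simp
    then obtain \<delta> where "\<delta> > 0" "\<forall>x\<in>U \<inter> tspace ns. dist x p < \<delta> \<longrightarrow>
      dist (dderiv F x (?e i)) (dderiv F p (?e i)) < \<epsilon>"
      using U \<epsilon> unfolding continuous_on_iff by (metis IntI)
    then show ?thesis by (auto simp: dist_norm intro!: exI[of _ \<delta>])
  qed
  then obtain d where d: "\<And>i. i \<in> ?I \<Longrightarrow> d i > 0"
    "\<And>i x. i \<in> ?I \<Longrightarrow> x \<in> U \<inter> tspace ns \<Longrightarrow> dist x p < d i \<Longrightarrow>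
      norm (dderiv F x (?e i) - dderiv F p (?e i)) \<le> \<epsilon>"
    by metis
  obtain d0 where d0: "d0 > 0" "ball p d0 \<subseteq> U" using U openE by metis
  define m where "m = Min (insert d0 (d ` ?I))"
  have m: "m > 0" "m \<le> d0" "\<And>i. i \<in> ?I \<Longrightarrow> m \<le> d i"
    using d d0 unfolding m_def by auto
  \<comment> \<open>A box of half-width \<open>\<delta>\<close> in \<open>card ?I\<close>
    coordinates has l1 radius below \<open>m\<close>; the added 1 makes the bound strict and covers
    an empty index set.\<close>
  define \<delta> where "\<delta> = m / (real (card ?I) + 1)"
  have \<delta>: "\<delta> > 0" unfolding \<delta>_def using m by simp
  have bx: "x \<in> U \<inter> tspace ns \<and> dist x p < m" if x: "in_box ?I p \<delta> x" for x
  proof -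
    have xt: "x \<in> tspace ns" using x by (auto simp: in_box_def tspace_iff split: if_splits)
    have "norm (x - p) = (\<Sum>i\<in>?I. \<bar>lk x i - lk p i\<bar>)"
      using xt U by (subst tensor_norm_eq[of ?I]) (auto simp: tspace_iff lookup_minus)
    also have "\<dots> \<le> (\<Sum>i\<in>?I. \<delta>)"
      using x by (intro sum_mono) (auto simp: in_box_def less_imp_le split: if_splits)
    also have "\<dots> < (real (card ?I) + 1) * \<delta>" using \<delta> by (simp add: algebra_simps)
    also have "\<dots> = m" by (simp add: \<delta>_def add_nonneg_eq_0_iff)
    finally have "dist x p < m" by (simp add: dist_norm)
    then show ?thesis using xt d0 m by (auto simp: dist_commute)
  qed
  have "norm (F x - F y - D (x - y)) \<le> \<epsilon> * norm (x - y)"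
    if xy: "x \<in> tspace ns" "y \<in> tspace ns" "norm (x - p) < \<delta>" "norm (y - p) < \<delta>" for x y
  proof (rule box_increment_bound[of ?I ?I D p \<delta>])
    have "in_box ?I p \<delta> x" if "x \<in> tspace ns" "norm (x - p) < \<delta>" for x
      using that abs_lookup_le_norm[of "x - p"]
      by (auto simp: in_box_def tspace_iff lookup_minus intro: le_less_trans)
    then show "in_box ?I p \<delta> x" "in_box ?I p \<delta> y" using xy by auto
    show "(\<lambda>t. F (x + t *\<^sub>R ?e i)) differentiable (at 0)" if "in_box ?I p \<delta> x" "i \<in> ?I" for x i
      using dd[OF that(2)] bx[OF that(1)] by auto
    show "norm (dderiv F x (?e i) - D (?e i)) \<le> \<epsilon>" if "in_box ?I p \<delta> x" "i \<in> ?I" for x i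
      using that d(2)[of i x] m(3)[of i] bx[OF that(1)] De by auto
    show "lk x i = lk y i" if "i \<notin> ?I" for i using that xy by (auto simp: tspace_iff)
  qed (use D in auto)
  then show "\<exists>\<delta>>0. \<forall>x\<in>tspace ns. \<forall>y\<in>tspace ns.
      norm (x - p) < \<delta> \<longrightarrow> norm (y - p) < \<delta> \<longrightarrow> norm (F x - F y - D (x - y)) \<le> \<epsilon> * norm (x - y)"
    using \<delta> by blast
qed

text \<open>A chain rule for a function differentiable only relative to \<open>tspace ns\<close> and
  a curve differentiable only at 0: the quotient of \<open>F\<close> along the curve is compared
  with \<open>D\<close> of the quotient of the curve, and \<open>D\<close> is continuous on
  \<open>tspace ns\<close>.\<close>

lemma strict_derivative_along_curve:
  fixes F :: "tensor \<Rightarrow> 'b::real_normed_vector"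
  assumes D: "linear D" and sd: "\<And>\<epsilon>. \<epsilon> > 0 \<Longrightarrow> \<exists>\<delta>>0. \<forall>x\<in>tspace ns. \<forall>y\<in>tspace ns.
      norm (x - p) < \<delta> \<longrightarrow> norm (y - p) < \<delta> \<longrightarrow> norm (F x - F y - D (x - y)) \<le> \<epsilon> * norm (x - y)"
    and \<gamma>: "(\<gamma> has_vector_derivative v) (at 0)" "\<gamma> 0 = p" "\<And>t::real. \<gamma> t \<in> tspace ns"
    and v: "v \<in> tspace ns"
  shows "((\<lambda>t. F (\<gamma> t)) has_vector_derivative D v) (at 0)"
proof -
  have p: "p \<in> tspace ns" using \<gamma> by metis
  have q: "((\<lambda>t. (\<gamma> t - p) /\<^sub>R t) \<longlongrightarrow> v) (at 0)"
    using \<gamma> by (simp add: has_vector_derivative_at_0_iff)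
  have cont: "(\<gamma> \<longlongrightarrow> p) (at 0)"
    using has_vector_derivative_continuous[OF \<gamma>(1)] \<gamma>(2) by (simp add: continuous_at)
  obtain K where K: "K > 0" "\<And>A. A \<in> tspace ns \<Longrightarrow> norm (D A) \<le> K * norm A"
    using linear_tensor_bounded[OF D finite_ibox[of ns]] unfolding tspace_iff by metis
  have qt: "(\<gamma> t - p) /\<^sub>R t \<in> tspace ns" for t
    using \<gamma>(3) p subspace_tspace by (simp add: subspace_scale subspace_diff)
  have D1: "((\<lambda>t. D ((\<gamma> t - p) /\<^sub>R t)) \<longlongrightarrow> D v) (at 0)"
  proof (rule Lim_null_comparison[where g = "\<lambda>t. K * norm ((\<gamma> t - p) /\<^sub>R t - v)", THEN iffD2[OF Lim_null]])
    show "\<forall>\<^sub>F t in at 0. norm (D ((\<gamma> t - p) /\<^sub>R t) - D v) \<le> K * norm ((\<gamma> t - p) /\<^sub>R t - v)"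
      using K(2)[OF subspace_diff[OF subspace_tspace qt v]]
      by (simp only: linear_diff[OF D]) simp
    show "((\<lambda>t. K * norm ((\<gamma> t - p) /\<^sub>R t - v)) \<longlongrightarrow> 0) (at 0)"
      using tendsto_mult_right_zero[OF tendsto_norm_zero[OF iffD1[OF Lim_null q]]] .
  qed
  have D2: "((\<lambda>t. (F (\<gamma> t) - F p) /\<^sub>R t - D ((\<gamma> t - p) /\<^sub>R t)) \<longlongrightarrow> 0) (at 0)"
  proof (rule tendstoI)
    fix e :: real assume e: "e > 0"
    \<comment> \<open>The quotients of the curve are eventually shorter than
      \<open>norm v + 1\<close>, so this error rate costs less than \<open>e\<close>.\<close>
    define \<epsilon> where "\<epsilon> = e / (norm v + 1)"
    have \<epsilon>: "\<epsilon> > 0" "\<epsilon> * (norm v + 1) = e"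
      using e by (auto simp: \<epsilon>_def add_nonneg_pos add_nonneg_eq_0_iff)
    obtain \<delta> where \<delta>: "\<delta> > 0" "\<And>x y. x \<in> tspace ns \<Longrightarrow> y \<in> tspace ns \<Longrightarrow>
      norm (x - p) < \<delta> \<Longrightarrow> norm (y - p) < \<delta> \<Longrightarrow> norm (F x - F y - D (x - y)) \<le> \<epsilon> * norm (x - y)"
      using sd[OF \<epsilon>(1)] by metis
    have "\<forall>\<^sub>F t in at 0. dist (\<gamma> t) p < \<delta>" using cont \<delta>(1) by (rule tendstoD)
    moreover have "\<forall>\<^sub>F t in at 0. norm ((\<gamma> t - p) /\<^sub>R t) < norm v + 1"
      using order_tendstoD(2)[OF tendsto_norm[OF q], of "norm v + 1"] by simp
    ultimately show "\<forall>\<^sub>F t in at 0. dist ((F (\<gamma> t) - F p) /\<^sub>R t - D ((\<gamma> t - p) /\<^sub>R t)) 0 < e"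
    proof eventually_elim
      case (elim t)
      have "norm (F (\<gamma> t) - F p - D (\<gamma> t - p)) \<le> \<epsilon> * norm (\<gamma> t - p)"
        using \<delta>(2)[OF \<gamma>(3) p] elim \<delta>(1) by (simp add: dist_norm)
      then have "\<bar>inverse t\<bar> * norm (F (\<gamma> t) - F p - D (\<gamma> t - p)) \<le> \<bar>inverse t\<bar> * (\<epsilon> * norm (\<gamma> t - p))"
        by (intro mult_left_mono) auto
      moreover have "(F (\<gamma> t) - F p) /\<^sub>R t - D ((\<gamma> t - p) /\<^sub>R t) = (F (\<gamma> t) - F p - D (\<gamma> t - p)) /\<^sub>R t"
        by (simp only: linear_cmul[OF D]) (simp only: scaleR_diff_right)
      ultimately have "norm ((F (\<gamma> t) - F p) /\<^sub>R t - D ((\<gamma> t - p) /\<^sub>R t)) \<le> \<epsilon> * norm ((\<gamma> t - p) /\<^sub>R t)"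
        by (simp add: mult_ac)
      also have "\<dots> < \<epsilon> * (norm v + 1)" using elim \<epsilon> by (intro mult_strict_left_mono) auto
      finally show ?case using \<epsilon> by simp
    qed
  qed
  have "((\<lambda>t. (F (\<gamma> t) - F p) /\<^sub>R t) \<longlongrightarrow> D v) (at 0)"
    using tendsto_add[OF D2 D1] by simp
  then show ?thesis using \<gamma>(2) by (simp add: has_vector_derivative_at_0_iff)
qed


section \<open>Velocities of curves in a set\<close>

lemma tangent_spaceI:
  assumes "\<gamma> 0 = p" "p \<in> M" "\<forall>\<^sub>F t in at 0. \<gamma> t \<in> M" "(\<gamma> has_vector_derivative v) (at 0)"
  shows "v \<in> tangent_space M p"
proof -
  obtain e where "e > 0" "\<And>t. t \<noteq> 0 \<Longrightarrow> dist t 0 < e \<Longrightarrow> \<gamma> t \<in> M"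
    using assms(3) unfolding eventually_at by auto
  then have "\<forall>t. \<bar>t\<bar> < e \<longrightarrow> \<gamma> t \<in> M" using assms(1,2) by (metis dist_0_norm dist_commute real_norm_def)
  then show ?thesis using assms \<open>e > 0\<close> unfolding tangent_space_def by blast
qed

lemma tangent_spaceE:
  assumes "v \<in> tangent_space M p"
  obtains \<gamma> where "\<gamma> 0 = p" "\<And>t::real. \<gamma> t \<in> M" "(\<gamma> has_vector_derivative v) (at 0)"
proof -
  obtain \<gamma> e where g: "e > 0" "\<gamma> 0 = p" "\<forall>t. \<bar>t\<bar> < e \<longrightarrow> \<gamma> t \<in> M" "(\<gamma> has_vector_derivative v) (at 0)"
    using assms unfolding tangent_space_def by blast
  \<comment> \<open>Freezing the curve at \<open>p\<close> away from 0 keeps its velocity and places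
    it in the set at all times.\<close>
  define \<gamma>' where "\<gamma>' t = (if \<bar>t\<bar> < e then \<gamma> t else p)" for t
  have "(\<gamma>' has_vector_derivative v) (at 0)"
    by (rule has_vector_derivative_transform_within_open[OF g(4), of "{-e<..<e}"])
      (use g in \<open>auto simp: \<gamma>'_def\<close>)
  moreover have "\<gamma>' t \<in> M" for t
  proof -
    have "\<gamma> 0 \<in> M" using g(1,3) by simp
    then show ?thesis using g unfolding \<gamma>'_def by auto
  qed
  moreover have "\<gamma>' 0 = p" using g by (simp add: \<gamma>'_def)
  ultimately show thesis using that by blast
qed

lemma tangent_space_subset:
  assumes "M \<subseteq> tspace ns"
  shows "tangent_space M p \<subseteq> tspace ns"
proof
  fix v assume "v \<in> tangent_space M p"
  then obtain \<gamma> where \<gamma>: "\<And>t::real. \<gamma> t \<in> M" "(\<gamma> has_vector_derivative v) (at 0)"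
    by (rule tangent_spaceE) blast
  have "lk v i = 0" if i: "i \<notin> ibox ns" for i
  proof -
    have "((\<lambda>t. lk (\<gamma> t) i) has_vector_derivative lk v i) (at 0)"
      by (rule bounded_linear.has_vector_derivative[OF bounded_linear_lookup \<gamma>(2)])
    moreover have "(\<lambda>t. lk (\<gamma> t) i) = (\<lambda>t. 0)"
      using \<gamma>(1) assms i by (auto simp: tspace_iff subset_iff)
    ultimately show ?thesis
      using has_vector_derivative_const vector_derivative_unique_at by metis
  qed
  then show "v \<in> tspace ns" by (simp add: tspace_iff)
qed

text \<open>The equation is solved for \<open>s\<close> by the chord (simplified Newton) iteration, which is a
  contraction because \<open>F\<close> is strictly differentiable; only the size of the solution matters.\<close>
lemma chord_iteration_zero:
  assumes D: "linear D" and L: "linear L"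
    and S: "subspace S" "\<And>s. s \<in> S \<Longrightarrow> D (L s) = s" "\<And>s. s \<in> S \<Longrightarrow> norm (L s) \<le> K * norm s" "complete S"
    and K: "K > 0" and q: "q \<in> V" and V: "subspace V" "\<And>s. L s \<in> V"
    and F: "\<And>x. x \<in> V \<Longrightarrow> norm (x - p) < \<delta> \<Longrightarrow> F x \<in> S"
    and sd: "\<And>x y. x \<in> V \<Longrightarrow> y \<in> V \<Longrightarrow> norm (x - p) < \<delta> \<Longrightarrow> norm (y - p) < \<delta> \<Longrightarrow>
      norm (F x - F y - D (x - y)) \<le> 1 / (2 * K) * norm (x - y)"
    and small: "norm (q - p) + 2 * K * norm (F q) < \<delta>"
  obtains s where "s \<in> S" "norm s \<le> 2 * norm (F q)" "F (q + L s) = 0"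
proof -
  \<comment> \<open>The iteration sends 0 to \<open>- F q\<close> and halves distances; the radius
    \<open>r = 2 * norm (F q)\<close> solves \<open>r / 2 + norm (F q) = r\<close>, so the ball is
    mapped into itself.\<close>
  let ?B = "S \<inter> cball 0 (2 * norm (F q))"
  have Kn: "0 \<le> 2 * K * norm (F q)" using K by simp
  have near: "q + L s \<in> V \<and> norm (q + L s - p) < \<delta>" if s: "s \<in> ?B" for s
  proof
    show "q + L s \<in> V" using q V by (simp add: subspace_add)
    have "norm (L s) \<le> K * norm s" using S s by auto
    also have "\<dots> \<le> K * (2 * norm (F q))" using s K by (intro mult_left_mono) auto
    finally have "norm (L s) \<le> 2 * K * norm (F q)" by simp
    moreover have "norm (q + L s - p) \<le> norm (q - p) + norm (L s)"
      using norm_triangle_ineq[of "q - p" "L s"] by (simp add: algebra_simps)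
    ultimately show "norm (q + L s - p) < \<delta>" using small by linarith
  qed
  \<comment> \<open>Since \<open>s - s' = D (L (s - s'))\<close>, only the linearisation error
    remains; the factors \<open>1 / (2 * K)\<close> and \<open>K\<close> multiply to one
    half.\<close>
  have contr: "norm ((s - F (q + L s)) - (s' - F (q + L s'))) \<le> 1/2 * norm (s - s')"
    if s: "s \<in> ?B" "s' \<in> ?B" for s s'
  proof -
    let ?x = "q + L s" and ?y = "q + L s'"
    have d: "?x - ?y = L (s - s')" by (simp add: linear_diff[OF L])
    have sS: "s - s' \<in> S" using S(1) s by (auto intro: subspace_diff)
    have "norm ((s - F ?x) - (s' - F ?y)) = norm (F ?x - F ?y - D (?x - ?y))"
      unfolding d S(2)[OF sS] by (simp add: norm_minus_commute algebra_simps)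
    also have "\<dots> \<le> 1 / (2 * K) * norm (?x - ?y)" using near s by (intro sd) auto
    also have "\<dots> \<le> 1 / (2 * K) * (K * norm (s - s'))"
      unfolding d using K S(3)[OF sS] by (intro mult_left_mono) auto
    also have "\<dots> = 1/2 * norm (s - s')" using K by simp
    finally show ?thesis .
  qed
  have zero: "0 \<in> ?B" using S(1) subspace_0 by auto
  have "\<exists>!s\<in>?B. s - F (q + L s) = s"
  proof (rule Banach_fix[where c = "1/2"])
    show "complete ?B" using S(4) by (intro complete_Int_closed) auto
    show "?B \<noteq> {}" using zero by blast
    show "(\<lambda>s. s - F (q + L s)) ` ?B \<subseteq> ?B"
    proof safe
      fix s assume s: "s \<in> S" "s \<in> cball 0 (2 * norm (F q))"
      then have sB: "s \<in> ?B" by blast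
      show "s - F (q + L s) \<in> S"
        using near[OF sB] F S(1) s(1) by (auto intro: subspace_diff)
      have "norm ((s - F (q + L s)) - (0 - F (q + L 0))) \<le> 1/2 * norm (s - 0)"
        by (rule contr[OF sB zero])
      moreover have "norm (s - F (q + L s)) \<le>
          norm ((s - F (q + L s)) - (0 - F (q + L 0))) + norm (F q)"
        using norm_triangle_ineq2[of "s - F (q + L s)" "0 - F (q + L 0)"]
        by (simp add: linear_0[OF L])
      ultimately show "s - F (q + L s) \<in> cball 0 (2 * norm (F q))" using s by simp
    qed
    show "dist (s - F (q + L s)) (s' - F (q + L s')) \<le> 1/2 * dist s s'"
      if "s \<in> ?B" "s' \<in> ?B" for s s'
      using contr that by (simp add: dist_norm)
  qed auto
  then obtain s where s: "s \<in> ?B" "s - F (q + L s) = s" by blast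
  then show thesis using that[of s] by simp
qed

text \<open>The values of \<open>F\<close> may have any support, so \<open>S\<close> need not lie in
  \<open>tspace ns\<close>. Being spanned by finitely many images it still has a common finite
  support, and it is closed there as the fixed-point set of the continuous map
  \<open>D \<circ> L\<close>.\<close>

lemma complete_finite_dim_image:
  fixes D L :: "tensor \<Rightarrow> tensor"
  assumes D: "linear D" and L: "linear L" "\<And>s. L s \<in> tspace ns" and S: "S = D ` tspace ns"
    and DL: "\<And>s. s \<in> S \<Longrightarrow> D (L s) = s"
  obtains K where "complete S" "K > 0" "\<And>s. s \<in> S \<Longrightarrow> norm (L s) \<le> K * norm s"
proof -
  define I where "I = (\<Union>i\<in>ibox ns. Poly_Mapping.keys (D (Poly_Mapping.single i 1)))"
  have I: "finite I" by (simp add: I_def)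
  let ?W = "{A::tensor. \<forall>i. i \<notin> I \<longrightarrow> lk A i = 0}"
  have SW: "S \<subseteq> ?W"
  proof
    fix s assume "s \<in> S"
    then obtain u where u: "u \<in> tspace ns" "s = D u" using S by blast
    have "s = D (\<Sum>i\<in>ibox ns. lk u i *\<^sub>R Poly_Mapping.single i 1)"
      using u tensor_expand[of "ibox ns" u] by (simp add: tspace_iff)
    also have "\<dots> = (\<Sum>i\<in>ibox ns. lk u i *\<^sub>R D (Poly_Mapping.single i 1))"
      by (simp add: linear_sum[OF D] linear_cmul[OF D])
    finally have s: "s = (\<Sum>i\<in>ibox ns. lk u i *\<^sub>R D (Poly_Mapping.single i 1))" .
    have "lk s k = 0" if "k \<notin> I" for k
      using that unfolding s by (auto simp: lookup_sum I_def in_keys_iff intro!: sum.neutral)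
    then show "s \<in> ?W" by blast
  qed
  obtain K where K: "K > 0" "\<And>A. A \<in> ?W \<Longrightarrow> norm (L A) \<le> K * norm A"
    using linear_tensor_bounded[OF L(1) I] by (metis (mono_tags, lifting) mem_Collect_eq)
  obtain K' where K': "K' > 0" "\<And>A. A \<in> tspace ns \<Longrightarrow> norm (D A) \<le> K' * norm A"
    using linear_tensor_bounded[OF D finite_ibox[of ns]] unfolding tspace_iff by metis
  have "complete S"
  proof (rule completeI)
    fix f assume f: "\<forall>n. f n \<in> S" and C: "Cauchy f"
    obtain l where l: "l \<in> ?W" "f \<longlonglongrightarrow> l"
      using complete_supported[OF I] f C SW unfolding complete_def by (metis (no_types, lifting) subsetD)
    have "(\<lambda>n. D (L (f n)) - D (L l)) \<longlonglongrightarrow> 0"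
    proof (rule Lim_null_comparison)
      show "\<forall>\<^sub>F n in sequentially. norm (D (L (f n)) - D (L l)) \<le> K' * (K * norm (f n - l))"
      proof (intro always_eventually allI)
        fix n
        have "norm (D (L (f n - l))) \<le> K' * norm (L (f n - l))" using K' L(2) by blast
        also have "\<dots> \<le> K' * (K * norm (f n - l))"
        proof (intro mult_left_mono K)
          show "f n - l \<in> ?W" using l(1) f SW subspace_diff[OF subspace_supported[of I]] by blast
        qed (use K' in simp)
        finally show "norm (D (L (f n)) - D (L l)) \<le> K' * (K * norm (f n - l))"
          by (simp add: linear_diff[OF L(1)] linear_diff[OF D])
      qed
      show "(\<lambda>n. K' * (K * norm (f n - l))) \<longlonglongrightarrow> 0"
        using l(2) by (intro tendsto_mult_right_zero tendsto_norm_zero LIM_zero)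
    qed
    moreover have "D (L (f n)) = f n" for n using f DL by blast
    ultimately have "f \<longlonglongrightarrow> D (L l)" by (simp add: LIM_zero_iff)
    then have "l = D (L l)" using l(2) LIMSEQ_unique by blast
    then have "l \<in> S" using S L(2) by blast
    then show "\<exists>l\<in>S. f \<longlonglongrightarrow> l" using l(2) by blast
  qed
  then show thesis using that K SW by blast
qed

lemma linear_vanishing_tendsto:
  fixes f g :: "'a \<Rightarrow> 'b::real_normed_vector"
  assumes "(g \<longlongrightarrow> 0) F" "\<forall>\<^sub>F x in F. norm (f x) \<le> K * norm (g x)"
  shows "(f \<longlongrightarrow> 0) F"
  using assms(2) by (rule Lim_null_comparison) (intro tendsto_mult_right_zero tendsto_norm_zero assms)

text \<open>One inclusion differentiates \<open>F = 0\<close> along a curve. For the other, a line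
  in a direction annihilated by \<open>D\<close> violates the equation only to order o(t), and a
  correction of comparable size brings it back to \<open>M\<close> without changing the
  velocity.\<close>

theorem tangent_space_level_set:
  assumes emb: "embedded_submanifold (tspace ns) M" and p: "p \<in> M"
  obtains D :: "tensor \<Rightarrow> tensor" where "linear D" "tangent_space M p = {v \<in> tspace ns. D v = 0}"
proof -
  let ?V = "tspace ns"
  obtain U S and F :: "tensor \<Rightarrow> tensor" where U: "open U" "p \<in> U" and S: "subspace S"
    and sm: "smooth_on ?V (U \<inter> ?V) F" and FS: "F ` (U \<inter> ?V) \<subseteq> S"
    and dd: "\<forall>x\<in>U \<inter> ?V. dderiv F x ` ?V = S" and MU: "M \<inter> U = {x \<in> U \<inter> ?V. F x = 0}"
    and MV: "M \<subseteq> ?V"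
    using emb p unfolding embedded_submanifold_def by (elim conjE) (drule (1) bspec, elim exE conjE, blast)
  have pV: "p \<in> ?V" using MV p by blast
  have Fp: "F p = 0" using MU p U by blast
  obtain D where D: "linear D" and sd: "\<And>\<epsilon>. \<epsilon> > 0 \<Longrightarrow> \<exists>\<delta>>0. \<forall>x\<in>?V. \<forall>y\<in>?V.
      norm (x - p) < \<delta> \<longrightarrow> norm (y - p) < \<delta> \<longrightarrow> norm (F x - F y - D (x - y)) \<le> \<epsilon> * norm (x - y)"
    using smooth_strictly_differentiable[OF U pV sm] by blast
  have line: "((\<lambda>t. p + t *\<^sub>R v) has_vector_derivative v) (at 0)" for v
    by (auto intro!: derivative_eq_intros)
  have lineV: "p + t *\<^sub>R v \<in> ?V" if "v \<in> ?V" for t v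
    using that pV subspace_tspace by (simp add: subspace_add subspace_scale)
  have Fline: "((\<lambda>t. F (p + t *\<^sub>R v)) has_vector_derivative D v) (at 0)" if "v \<in> ?V" for v
    using that lineV by (intro strict_derivative_along_curve[OF D sd line]) auto
  have "dderiv F p v = D v" if "v \<in> ?V" for v
    unfolding dderiv_def using Fline[OF that] by (rule vector_derivative_at)
  then have DV: "S = D ` ?V" using dd U pV by (metis IntI image_cong)
  \<comment> \<open>Corrections of the line are sought in the range of this right inverse, which
    turns the equation for a point into one for a parameter in \<open>S\<close>.\<close>
  obtain L where L: "\<And>s. L s \<in> ?V" "linear L" "\<And>s. s \<in> S \<Longrightarrow> D (L s) = s"
    using linear_exists_right_inverse_on[OF D subspace_tspace[of ns]] DV by auto
  obtain K where K: "complete S" "K > 0" "\<And>s. s \<in> S \<Longrightarrow> norm (L s) \<le> K * norm s"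
    using complete_finite_dim_image[OF D L(2,1) DV L(3)] by blast
  have sub: "D v = 0" if v: "v \<in> tangent_space M p" for v
  proof -
    obtain \<gamma> where \<gamma>: "\<gamma> 0 = p" "\<And>t::real. \<gamma> t \<in> M" "(\<gamma> has_vector_derivative v) (at 0)"
      using tangent_spaceE[OF v] by blast
    have "((\<lambda>t. F (\<gamma> t)) has_vector_derivative D v) (at 0)"
      using \<gamma> MV tangent_space_subset[OF MV] v
      by (intro strict_derivative_along_curve[OF D sd]) auto
    moreover have "((\<lambda>t. F (\<gamma> t)) has_vector_derivative 0) (at 0)"
    proof -
      have "(\<gamma> \<longlongrightarrow> p) (at 0)"
        using has_vector_derivative_continuous[OF \<gamma>(3)] \<gamma>(1) by (simp add: continuous_at)
      then have "\<forall>\<^sub>F t in at 0. \<gamma> t \<in> U" using U by (rule topological_tendstoD)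
      then have "\<forall>\<^sub>F t in at 0. (F (\<gamma> t) - F (\<gamma> 0)) /\<^sub>R t = 0"
        by eventually_elim (use MU \<gamma> Fp in auto)
      then show ?thesis
        unfolding has_vector_derivative_at_0_iff by (rule tendsto_eventually)
    qed
    ultimately show ?thesis by (rule vector_derivative_unique_at)
  qed
  have sup: "v \<in> tangent_space M p" if v: "v \<in> ?V" "D v = 0" for v
  proof -
    obtain \<delta>1 where \<delta>1: "\<delta>1 > 0" "\<And>x y. x \<in> ?V \<Longrightarrow> y \<in> ?V \<Longrightarrow> norm (x - p) < \<delta>1 \<Longrightarrow>
      norm (y - p) < \<delta>1 \<Longrightarrow> norm (F x - F y - D (x - y)) \<le> 1 / (2 * K) * norm (x - y)"
      using sd[of "1 / (2 * K)"] K(2) by auto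
    obtain \<delta>2 where \<delta>2: "\<delta>2 > 0" "ball p \<delta>2 \<subseteq> U" using U openE by metis
    define \<delta> where "\<delta> = min \<delta>1 \<delta>2"
    have \<delta>: "\<delta> > 0" using \<delta>1 \<delta>2 by (simp add: \<delta>_def)
    let ?q = "\<lambda>t. p + t *\<^sub>R v"
    have inU: "x \<in> U" if "norm (x - p) < \<delta>" for x
      using that \<delta>2 by (auto simp: \<delta>_def dist_norm norm_minus_commute)
    have Fq0: "((\<lambda>t. F (?q t) /\<^sub>R t) \<longlongrightarrow> 0) (at 0)"
      using Fline[OF v(1)] v(2) Fp by (simp add: has_vector_derivative_at_0_iff)
    have Fq1: "((\<lambda>t. F (?q t)) \<longlongrightarrow> 0) (at 0)"
      using has_vector_derivative_continuous[OF Fline[OF v(1)]] Fp by (simp add: continuous_at)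
    have "((\<lambda>t. norm (?q t - p) + 2 * K * norm (F (?q t))) \<longlongrightarrow> norm (0 *\<^sub>R v) + 2 * K * norm (0::tensor)) (at 0)"
      unfolding add_diff_cancel_left' by (intro tendsto_intros Fq1)
    then have ev: "\<forall>\<^sub>F t in at 0. norm (?q t - p) + 2 * K * norm (F (?q t)) < \<delta>"
      using \<delta> by (intro order_tendstoD(2)) auto
    define good where "good t s \<longleftrightarrow> s \<in> S \<and> norm s \<le> 2 * norm (F (?q t)) \<and> F (?q t + L s) = 0" for t s
    have "\<exists>s. good t s" if "norm (?q t - p) + 2 * K * norm (F (?q t)) < \<delta>" for t
    proof (rule chord_iteration_zero[where D = D and L = L and S = S and K = K and q = "?q t"
          and V = ?V and F = F and p = p and \<delta> = \<delta>])
      show "F x \<in> S" if "x \<in> ?V" "norm (x - p) < \<delta>" for x using inU that FS by blast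
      show "norm (F x - F y - D (x - y)) \<le> 1 / (2 * K) * norm (x - y)"
        if "x \<in> ?V" "y \<in> ?V" "norm (x - p) < \<delta>" "norm (y - p) < \<delta>" for x y
        using that by (intro \<delta>1(2)) (auto simp: \<delta>_def)
      show "\<exists>s. good t s" if "s \<in> S" "norm s \<le> 2 * norm (F (?q t))" "F (?q t + L s) = 0" for s
        using that by (auto simp: good_def)
    qed (use D L S K lineV[OF v(1)] subspace_tspace that in auto)
    then obtain s where s: "\<And>t. norm (?q t - p) + 2 * K * norm (F (?q t)) < \<delta> \<Longrightarrow> good t (s t)"
      by metis
    have evs: "\<forall>\<^sub>F t in at 0. good t (s t)" using ev s by (rule eventually_mono)
    \<comment> \<open>At time 0 the size bound reads
      \<open>norm (s 0) <= 2 * norm (F p) = 0\<close>, so the corrected curve really starts at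
      \<open>p\<close>.\<close>
    have s0: "s 0 = 0" using s[of 0] \<delta> Fp by (simp add: good_def)
    have bnd: "norm (L (s t)) \<le> K * (2 * norm (F (?q t)))" if "good t (s t)" for t
    proof -
      have "norm (L (s t)) \<le> K * norm (s t)" using that K(3) by (simp add: good_def)
      also have "\<dots> \<le> K * (2 * norm (F (?q t)))" using that K(2) by (intro mult_left_mono) (auto simp: good_def)
      finally show ?thesis .
    qed
    let ?\<gamma> = "\<lambda>t. ?q t + L (s t)"
    show ?thesis
    proof (rule tangent_spaceI[of ?\<gamma>])
      show "?\<gamma> 0 = p" by (simp add: s0 linear_0[OF L(2)])
      have "\<forall>\<^sub>F t in at 0. norm (?q t - p) + 2 * K * norm (F (?q t)) < \<delta> \<and> good t (s t)"
        using ev evs by (rule eventually_conj)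
      then show "\<forall>\<^sub>F t in at 0. ?\<gamma> t \<in> M"
      proof eventually_elim
        case (elim t)
        have "norm (?\<gamma> t - p) \<le> norm (?q t - p) + norm (L (s t))"
          using norm_triangle_ineq[of "?q t - p" "L (s t)"] by (simp add: algebra_simps)
        also have "\<dots> < \<delta>" using elim bnd[of t] by linarith
        finally have "?\<gamma> t \<in> U" by (rule inU)
        moreover have "?\<gamma> t \<in> ?V" using lineV[OF v(1)] L(1) subspace_tspace by (simp add: subspace_add)
        ultimately show ?case using elim MU by (auto simp: good_def)
      qed
      \<comment> \<open>The correction is at most a multiple of \<open>F (?q t)\<close>, which is
        o(t) because \<open>D v = 0\<close>.\<close>
      have "((\<lambda>t. L (s t) /\<^sub>R t) \<longlongrightarrow> 0) (at 0)"
      proof (rule linear_vanishing_tendsto[OF Fq0, of _ "2 * K"])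
        show "\<forall>\<^sub>F t in at 0. norm (L (s t) /\<^sub>R t) \<le> 2 * K * norm (F (?q t) /\<^sub>R t)"
          using evs
        proof eventually_elim
          case (elim t)
          then have "\<bar>inverse t\<bar> * norm (L (s t)) \<le> \<bar>inverse t\<bar> * (K * (2 * norm (F (?q t))))"
            by (intro mult_left_mono bnd) auto
          then show ?case by (simp add: mult_ac)
        qed
      qed
      then have "((\<lambda>t. L (s t)) has_vector_derivative 0) (at 0)"
        by (simp add: has_vector_derivative_at_0_iff s0 linear_0[OF L(2)])
      from has_vector_derivative_add[OF line this, of v]
      show "(?\<gamma> has_vector_derivative v) (at 0)" by simp
    qed (rule p)
  qed
  have "tangent_space M p = {v \<in> ?V. D v = 0}"
    using sub sup tangent_space_subset[OF MV] by blast
  then show thesis using that D by blast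
qed

corollary subspace_tangent_space:
  assumes "embedded_submanifold (tspace ns) M" "p \<in> M"
  shows "subspace (tangent_space M p)"
proof -
  obtain D :: "tensor \<Rightarrow> tensor" where D: "linear D" and T: "tangent_space M p = {v \<in> tspace ns. D v = 0}"
    using tangent_space_level_set[OF assms] .
  show ?thesis unfolding T using subspace_tspace[of ns] D
    by (auto simp: subspace_def linear_0 linear_add linear_cmul)
qed

subsection \<open>Matrices as functions on index pairs\<close>

definition mmul :: "nat \<Rightarrow> mat \<Rightarrow> mat \<Rightarrow> mat" where
  "mmul l A B = (\<lambda>i j. \<Sum>k<l. A i k * B k j)"

definition mid :: mat where
  "mid = (\<lambda>i j. if i = j then 1 else 0)"

text \<open>Matrices are total functions with arbitrary entries outside the relevant block, so
  identities between them are asserted on the block only.\<close>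

definition meq :: "nat \<Rightarrow> nat \<Rightarrow> mat \<Rightarrow> mat \<Rightarrow> bool" where
  "meq k l A B \<longleftrightarrow> (\<forall>i<k. \<forall>j<l. A i j = B i j)"

lemma meq_refl [simp]: "meq k l A A"
  and meq_sym: "meq k l A B \<Longrightarrow> meq k l B A"
  and meq_trans [trans]: "meq k l A B \<Longrightarrow> meq k l B C \<Longrightarrow> meq k l A C"
  by (auto simp: meq_def)

lemma meqD: "meq k l A B \<Longrightarrow> i < k \<Longrightarrow> j < l \<Longrightarrow> A i j = B i j"
  by (auto simp: meq_def)

lemma mmul_assoc: "mmul l (mmul k A B) C = mmul k A (mmul l B C)"
  unfolding mmul_def
  by (intro ext) (simp add: sum_distrib_left sum_distrib_right mult.assoc sum.swap[of _ "{..<l}"])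

lemma mmul_meq: "meq k m A A' \<Longrightarrow> meq m l B B' \<Longrightarrow> meq k l (mmul m A B) (mmul m A' B')"
  by (auto simp: meq_def mmul_def intro!: sum.cong)

lemma mmul_mid_left: "meq k l (mmul k mid A) A"
proof -
  have "(\<Sum>m<k. mid i m * A m j) = A i j" if "i < k" for i j
  proof -
    have "(\<Sum>m<k. mid i m * A m j) = (\<Sum>m<k. if m = i then A m j else 0)"
      by (intro sum.cong) (auto simp: mid_def)
    then show ?thesis using that by simp
  qed
  then show ?thesis by (simp add: meq_def mmul_def)
qed

lemma mmul_mid_right: "meq k l (mmul l A mid) A"
proof -
  have "(\<Sum>m<l. A i m * mid m j) = A i j" if "j < l" for i j
  proof -
    have "(\<Sum>m<l. A i m * mid m j) = (\<Sum>m<l. if m = j then A i m else 0)"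
      by (intro sum.cong) (auto simp: mid_def)
    then show ?thesis using that by simp
  qed
  then show ?thesis by (simp add: meq_def mmul_def)
qed

section \<open>Linear systems and inverses\<close>

text \<open>One equation is eliminated together with one unknown. The lemma supplies the dimension
  counts for inverses, finiteness of the spectrum, the length of orthonormal lists and Terracini
  matrices with too many columns.\<close>

lemma underdetermined_system:
  fixes A :: "'a \<Rightarrow> 'b \<Rightarrow> real"
  assumes "finite I" "finite J" "card I < card J"
  obtains x where "\<exists>j\<in>J. x j \<noteq> 0" "\<And>i. i \<in> I \<Longrightarrow> (\<Sum>j\<in>J. A i j * x j) = 0"
proof -
  have "\<exists>x. (\<exists>j\<in>J. x j \<noteq> 0) \<and> (\<forall>i\<in>I. (\<Sum>j\<in>J. A i j * x j) = 0)"
    using assms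
  proof (induction I arbitrary: J A)
    case empty
    then have "J \<noteq> {}" by auto
    then show ?case by (auto intro!: exI[of _ "\<lambda>_. 1"])
  next
    case (insert i I)
    show ?case
    proof (cases "\<forall>j\<in>J. A i j = 0")
      case True
      have "card I < card J" using insert by simp
      from insert.IH[OF insert.prems(1) this, of A] True show ?thesis by auto
    next
      case False
      then obtain p where p: "p \<in> J" "A i p \<noteq> 0" by blast
      define J' where "J' = J - {p}"
      have J': "finite J'" "card I < card J'" "J = insert p J'" "p \<notin> J'"
        using insert p by (auto simp: J'_def)
      obtain x where x: "\<exists>j\<in>J'. x j \<noteq> 0"
        "\<And>k. k \<in> I \<Longrightarrow> (\<Sum>j\<in>J'. (A k j - A k p / A i p * A i j) * x j) = 0"
        using insert.IH[OF J'(1,2), of "\<lambda>k j. A k j - A k p / A i p * A i j"] by blast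
      \<comment> \<open>The pivot unknown is solved from equation \<open>i\<close>; the reduced
        system is what the other equations become after this substitution.\<close>
      define y where "y = x(p := - (\<Sum>j\<in>J'. A i j * x j) / A i p)"
      have yJ: "(\<Sum>j\<in>J. A k j * y j) = (\<Sum>j\<in>J'. A k j * x j) - A k p / A i p * (\<Sum>j\<in>J'. A i j * x j)" for k
      proof -
        have "(\<Sum>j\<in>J'. A k j * y j) = (\<Sum>j\<in>J'. A k j * x j)"
          using J'(4) by (intro sum.cong) (auto simp: y_def)
        moreover have "A k p * y p = - (A k p / A i p * (\<Sum>j\<in>J'. A i j * x j))" by (simp add: y_def)
        ultimately show ?thesis using J' by simp
      qed
      have "(\<Sum>j\<in>J. A k j * y j) = 0" if "k \<in> insert i I" for k
      proof (cases "k = i")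
        case True
        then show ?thesis using p by (simp add: yJ)
      next
        case False
        then have "k \<in> I" using that by simp
        from x(2)[OF this] show ?thesis
          by (simp add: yJ left_diff_distrib sum_subtractf sum_distrib_left mult.assoc)
      qed
      moreover have "\<exists>j\<in>J. y j \<noteq> 0" using x(1) J'(3,4) by (auto simp: y_def)
      ultimately show ?thesis by blast
    qed
  qed
  then show thesis using that by blast
qed

text \<open>With a unit vector as extra column there are \<open>l\<close> equations in
  \<open>l + 1\<close> unknowns. In a nontrivial solution the extra coefficient cannot vanish, as
  \<open>N\<close> is injective, and dividing by it gives a column of the inverse. The other product
  follows from \<open>N (J N - 1) = 0\<close>.\<close>

lemma full_col_rank_inverse:
  assumes N: "full_col_rank l l N"
  obtains J where "meq l l (mmul l N J) mid" "meq l l (mmul l J N) mid"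
proof -
  have "\<exists>y. \<forall>i<l. (\<Sum>j<l. N i j * y j) = mid i k" for k
  proof -
    obtain x where x: "\<exists>j\<in>{..l}. x j \<noteq> 0"
      "\<And>i. i \<in> {..<l} \<Longrightarrow> (\<Sum>j\<in>{..l}. (if j < l then N i j else mid i k) * x j) = 0"
      using underdetermined_system[of "{..<l}" "{..l}" "\<lambda>i j. if j < l then N i j else mid i k"]
      by auto
    have eq: "(\<Sum>j<l. N i j * x j) + mid i k * x l = 0" if "i < l" for i
    proof -
      have "{..l} = insert l {..<l}" by auto
      then have "(\<Sum>j\<in>{..l}. (if j < l then N i j else mid i k) * x j)
          = mid i k * x l + (\<Sum>j<l. (if j < l then N i j else mid i k) * x j)" by simp
      also have "(\<Sum>j<l. (if j < l then N i j else mid i k) * x j) = (\<Sum>j<l. N i j * x j)"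
        by (intro sum.cong) auto
      finally show ?thesis using x(2)[of i] that by simp
    qed
    have xl: "x l \<noteq> 0"
    proof
      assume 0: "x l = 0"
      then have "\<forall>i<l. x i = 0" using N eq unfolding full_col_rank_def by auto
      then show False using x(1) 0 by (auto simp: le_less)
    qed
    have "(\<Sum>j<l. N i j * (- x j / x l)) = mid i k" if "i < l" for i
    proof -
      have "(\<Sum>j<l. N i j * (- x j / x l)) = (\<Sum>j<l. N i j * x j) * (- 1 / x l)"
        unfolding sum_distrib_right by (intro sum.cong) auto
      also have "(\<Sum>j<l. N i j * x j) = - mid i k * x l" using eq[OF that] by linarith
      finally show ?thesis using xl by simp
    qed
    then show ?thesis by (intro exI[of _ "\<lambda>j. - x j / x l"]) blast
  qed
  then obtain y where y: "\<And>k i. i < l \<Longrightarrow> (\<Sum>j<l. N i j * y k j) = mid i k" by metis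
  define J where "J = (\<lambda>i j. y j i)"
  have NJ: "meq l l (mmul l N J) mid" using y by (auto simp: meq_def mmul_def J_def)
  have "mmul l J N i j = mid i j" if ij: "i < l" "j < l" for i j
  proof -
    have "(\<Sum>k<l. N a k * (mmul l J N k j - mid k j)) = 0" if a: "a < l" for a
    proof -
      have "mmul l N (mmul l J N) a j = N a j"
        using mmul_meq[OF NJ meq_refl[where A = N and k = l and l = l]] mmul_mid_left[of l l N] a ij
        unfolding mmul_assoc[symmetric] meq_def by metis
      moreover have "mmul l N mid a j = N a j" using mmul_mid_right[of l l N] a ij by (simp add: meq_def)
      ultimately show ?thesis by (simp add: mmul_def right_diff_distrib sum_subtractf)
    qed
    then have "\<forall>i<l. mmul l J N i j - mid i j = 0"
      using N[unfolded full_col_rank_def, rule_format, of "\<lambda>k. mmul l J N k j - mid k j"] by blast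
    then show ?thesis using ij by simp
  qed
  then have "meq l l (mmul l J N) mid" by (simp add: meq_def)
  with NJ show thesis by (rule that)
qed

lemma left_inverse_imp_full_col_rank:
  assumes "meq l l (mmul k P U) mid"
  shows "full_col_rank k l U"
  unfolding full_col_rank_def
proof (intro allI impI)
  fix x :: "nat \<Rightarrow> real" and i assume x: "\<forall>j<k. (\<Sum>i<l. U j i * x i) = 0" and i: "i < l"
  have "x i = (\<Sum>j<l. mid i j * x j)" using mmul_mid_left[of l 1 "\<lambda>i _. x i"] i by (simp add: meq_def mmul_def)
  also have "\<dots> = (\<Sum>j<l. mmul k P U i j * x j)"
    using assms i by (intro sum.cong) (auto simp: meq_def)
  also have "\<dots> = (\<Sum>m<k. P i m * (\<Sum>j<l. U m j * x j))"
    unfolding mmul_def by (simp add: sum_distrib_left sum_distrib_right mult.assoc sum.swap[of _ "{..<l}"])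
  also have "\<dots> = 0" using x by simp
  finally show "x i = 0" .
qed

text \<open>\<open>Z\<close> has the left inverse \<open>N\<close>, hence a two-sided inverse
  \<open>J\<close>; then \<open>N = N Z J = J\<close>, so \<open>Z\<close> is a left inverse of
  \<open>N\<close>.\<close>

lemma right_inverse_imp_full_col_rank:
  assumes NZ: "meq l l (mmul l N Z) mid"
  shows "full_col_rank l l N"
proof -
  obtain J where J: "meq l l (mmul l Z J) mid" "meq l l (mmul l J Z) mid"
    using full_col_rank_inverse[OF left_inverse_imp_full_col_rank[OF NZ]] .
  have "meq l l N (mmul l N mid)" by (rule meq_sym[OF mmul_mid_right])
  also have "meq l l (mmul l N mid) (mmul l N (mmul l Z J))" by (rule mmul_meq[OF meq_refl meq_sym[OF J(1)]])
  also have "mmul l N (mmul l Z J) = mmul l (mmul l N Z) J" by (simp add: mmul_assoc)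
  also have "meq l l (mmul l (mmul l N Z) J) (mmul l mid J)" by (rule mmul_meq[OF NZ meq_refl])
  also have "meq l l (mmul l mid J) J" by (rule mmul_mid_left)
  finally have "meq l l N J" .
  then have "meq l l (mmul l Z N) (mmul l Z J)" by (intro mmul_meq) auto
  then have "meq l l (mmul l Z N) mid" using J(1) meq_trans by blast
  then show ?thesis by (rule left_inverse_imp_full_col_rank)
qed

text \<open>The Gram matrix of the columns is injective because \<open>x\<^sup>T (U\<^sup>T U) x = |U x|\<^sup>2\<close>.\<close>
lemma gram_inverse:
  fixes B :: "'a \<Rightarrow> nat \<Rightarrow> real"
  assumes I: "finite I"
    and inj: "\<And>x. (\<And>i. i \<in> I \<Longrightarrow> (\<Sum>j<l. B i j * x j) = 0) \<Longrightarrow> \<forall>j<l. x j = 0"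
  obtains P where "\<And>j k. j < l \<Longrightarrow> k < l \<Longrightarrow> (\<Sum>i\<in>I. P j i * B i k) = mid j k"
proof -
  define K where "K = (\<lambda>j k. \<Sum>i\<in>I. B i j * B i k)"
  have "full_col_rank l l K"
    unfolding full_col_rank_def
  proof (rule allI, rule impI)
    fix x :: "nat \<Rightarrow> real" assume x: "\<forall>j<l. (\<Sum>k<l. K j k * x k) = 0"
    have "(\<Sum>i\<in>I. (\<Sum>j<l. B i j * x j)^2) = (\<Sum>i\<in>I. \<Sum>j<l. \<Sum>k<l. (B i j * x j) * (B i k * x k))"
      by (simp add: power2_eq_square sum_product)
    also have "\<dots> = (\<Sum>j<l. \<Sum>i\<in>I. \<Sum>k<l. (B i j * x j) * (B i k * x k))" by (rule sum.swap)
    also have "\<dots> = (\<Sum>j<l. \<Sum>k<l. \<Sum>i\<in>I. (B i j * x j) * (B i k * x k))"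
      by (intro sum.cong sum.swap) auto
    also have "\<dots> = (\<Sum>j<l. x j * (\<Sum>k<l. K j k * x k))"
      by (simp add: K_def sum_distrib_left sum_distrib_right mult_ac)
    also have "\<dots> = 0" using x by simp
    finally have "\<forall>i\<in>I. (\<Sum>j<l. B i j * x j)^2 = 0"
      using I by (simp add: sum_nonneg_eq_0_iff)
    then show "\<forall>i<l. x i = 0" using inj by simp
  qed
  then obtain J where J: "meq l l (mmul l J K) mid" using full_col_rank_inverse by blast
  define P where "P = (\<lambda>j i. \<Sum>m<l. J j m * B i m)"
  have "(\<Sum>i\<in>I. P j i * B i k) = mmul l J K j k" for j k
    unfolding P_def K_def mmul_def sum_distrib_left sum_distrib_right
    by (simp add: mult.assoc sum.swap[of _ I])
  then show thesis using that[of P] J by (simp add: meq_def)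
qed

lemma full_col_rank_left_inverse:
  assumes "full_col_rank k l U"
  obtains P where "meq l l (mmul k P U) mid"
proof -
  obtain P where "\<And>j m. j < l \<Longrightarrow> m < l \<Longrightarrow> (\<Sum>i\<in>{..<k}. P j i * U i m) = mid j m"
    using gram_inverse[where I = "{..<k}" and B = U and l = l] assms unfolding full_col_rank_def by auto
  then show thesis using that[of P] by (simp add: meq_def mmul_def)
qed

section \<open>Perturbations of the identity matrix\<close>

text \<open>The absolute entry sum \<open>s\<close> of a kernel vector is at most a factor below 1
  times \<open>s\<close>, hence 0.\<close>

lemma full_col_rank_near_identity:
  assumes "(\<Sum>i<l. \<Sum>j<l. \<bar>N i j - mid i j\<bar>) < 1"
  shows "full_col_rank l l N"
  unfolding full_col_rank_def
proof (rule allI, rule impI)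
  fix x :: "nat \<Rightarrow> real" assume x: "\<forall>j<l. (\<Sum>i<l. N j i * x i) = 0"
  define s where "s = (\<Sum>i<l. \<bar>x i\<bar>)"
  have xs: "\<bar>x j\<bar> \<le> s" if "j < l" for j
    unfolding s_def using that by (intro member_le_sum) auto
  have "\<bar>x i\<bar> \<le> (\<Sum>j<l. \<bar>N i j - mid i j\<bar> * s)" if i: "i < l" for i
  proof -
    have "(\<Sum>j<l. mid i j * x j) = x i" using mmul_mid_left[of l 1 "\<lambda>i _. x i"] i by (simp add: meq_def mmul_def)
    then have "x i = - (\<Sum>j<l. (N i j - mid i j) * x j)"
      using x i by (simp add: left_diff_distrib sum_subtractf)
    then have "\<bar>x i\<bar> \<le> (\<Sum>j<l. \<bar>(N i j - mid i j) * x j\<bar>)" by (simp only: abs_minus_cancel sum_abs)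
    also have "\<dots> \<le> (\<Sum>j<l. \<bar>N i j - mid i j\<bar> * s)"
      by (intro sum_mono) (auto simp: abs_mult intro!: mult_left_mono xs)
    finally show ?thesis .
  qed
  then have "s \<le> (\<Sum>i<l. \<Sum>j<l. \<bar>N i j - mid i j\<bar> * s)" unfolding s_def[symmetric] unfolding s_def
    by (intro sum_mono) (auto simp: s_def)
  also have "\<dots> = (\<Sum>i<l. \<Sum>j<l. \<bar>N i j - mid i j\<bar>) * s" by (simp add: sum_distrib_right)
  finally have "s \<le> (\<Sum>i<l. \<Sum>j<l. \<bar>N i j - mid i j\<bar>) * s" .
  moreover have "0 \<le> s" by (simp add: s_def sum_nonneg)
  moreover have "(\<Sum>i<l. \<Sum>j<l. \<bar>N i j - mid i j\<bar>) * s < 1 * s" if "0 < s"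
    using assms that by (rule mult_strict_right_mono)
  ultimately have "s = 0" by (cases "0 < s") auto
  then show "\<forall>i<l. x i = 0" using xs by fastforce
qed

lemma eventually_full_col_rank:
  fixes N :: "'a \<Rightarrow> mat"
  assumes "\<And>i j. i < l \<Longrightarrow> j < l \<Longrightarrow> ((\<lambda>t. N t i j) \<longlongrightarrow> mid i j) F"
  shows "\<forall>\<^sub>F t in F. full_col_rank l l (N t)"
proof -
  have "((\<lambda>t. \<Sum>i<l. \<Sum>j<l. \<bar>N t i j - mid i j\<bar>) \<longlongrightarrow> (\<Sum>i<l. \<Sum>j<l. \<bar>mid i j - mid i j\<bar>)) F"
    using assms by (intro tendsto_intros) auto
  then have "\<forall>\<^sub>F t in F. (\<Sum>i<l. \<Sum>j<l. \<bar>N t i j - mid i j\<bar>) < 1"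
    by (intro order_tendstoD(2)) auto
  then show ?thesis by eventually_elim (rule full_col_rank_near_identity)
qed

text \<open>Meant for difference quotients \<open>x\<close> about which no bound is known
  beforehand. The system itself provides one: once \<open>M t\<close> is within 1/2 of the identity,
  \<open>x t\<close> is at most twice as large as the right-hand side, and then
  \<open>x - x M\<close> tends to 0.\<close>

lemma tendsto_solve_near_identity:
  fixes M :: "'a \<Rightarrow> mat" and x :: "'a \<Rightarrow> nat \<Rightarrow> real"
  assumes M: "\<And>i j. i < l \<Longrightarrow> j < l \<Longrightarrow> ((\<lambda>t. M t i j) \<longlongrightarrow> mid i j) F"
    and y: "\<And>k. k < l \<Longrightarrow> ((\<lambda>t. \<Sum>j<l. x t j * M t j k) \<longlongrightarrow> y k) F"
    and k: "k < l"
  shows "((\<lambda>t. x t k) \<longlongrightarrow> y k) F"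
proof -
  define s where "s t = (\<Sum>j<l. \<bar>x t j\<bar>)" for t
  define \<delta> where "\<delta> t = (\<Sum>i<l. \<Sum>j<l. \<bar>M t i j - mid i j\<bar>)" for t
  define z where "z t k = (\<Sum>j<l. x t j * M t j k)" for t k
  have "(\<delta> \<longlongrightarrow> (\<Sum>i<l. \<Sum>j<l. \<bar>mid i j - mid i j\<bar>)) F"
    unfolding \<delta>_def using M by (intro tendsto_intros) auto
  then have \<delta>: "(\<delta> \<longlongrightarrow> 0) F" by simp
  have s0: "0 \<le> s t" for t by (simp add: s_def sum_nonneg)
  have diff: "(\<Sum>k<l. \<bar>x t k - z t k\<bar>) \<le> \<delta> t * s t" for t
  proof -
    have "\<bar>x t k - z t k\<bar> \<le> (\<Sum>j<l. \<bar>M t j k - mid j k\<bar> * s t)" if "k < l" for k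
    proof -
      have "(\<Sum>j<l. x t j * mid j k) = x t k"
        using mmul_mid_right[of 1 l "\<lambda>_ j. x t j"] that by (simp add: meq_def mmul_def)
      then have "x t k - z t k = - (\<Sum>j<l. x t j * (M t j k - mid j k))"
        unfolding z_def right_diff_distrib sum_subtractf by linarith
      then have "\<bar>x t k - z t k\<bar> \<le> (\<Sum>j<l. \<bar>x t j * (M t j k - mid j k)\<bar>)"
        by (simp only: abs_minus_cancel sum_abs)
      also have "\<dots> \<le> (\<Sum>j<l. \<bar>M t j k - mid j k\<bar> * s t)"
      proof (intro sum_mono)
        fix j assume "j \<in> {..<l}"
        then have "\<bar>x t j\<bar> \<le> s t" unfolding s_def by (intro member_le_sum) auto
        then show "\<bar>x t j * (M t j k - mid j k)\<bar> \<le> \<bar>M t j k - mid j k\<bar> * s t"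
          by (simp add: abs_mult mult.commute mult_right_mono)
      qed
      finally show ?thesis .
    qed
    then have "(\<Sum>k<l. \<bar>x t k - z t k\<bar>) \<le> (\<Sum>k<l. \<Sum>j<l. \<bar>M t j k - mid j k\<bar> * s t)"
      by (intro sum_mono) auto
    also have "\<dots> = (\<Sum>j<l. \<Sum>k<l. \<bar>M t j k - mid j k\<bar> * s t)" by (rule sum.swap)
    also have "\<dots> = \<delta> t * s t" by (simp add: \<delta>_def sum_distrib_right)
    finally show ?thesis .
  qed
  define w where "w t = 2 * (\<Sum>k<l. \<bar>z t k\<bar>)" for t
  have w: "(w \<longlongrightarrow> 2 * (\<Sum>k<l. \<bar>y k\<bar>)) F"
    unfolding w_def using y unfolding z_def by (intro tendsto_intros) auto
  have "\<forall>\<^sub>F t in F. \<delta> t < 1/2" using \<delta> by (intro order_tendstoD(2)) auto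
  then have sw: "\<forall>\<^sub>F t in F. s t \<le> w t"
  proof eventually_elim
    case (elim t)
    have "s t \<le> (\<Sum>k<l. \<bar>x t k - z t k\<bar> + \<bar>z t k\<bar>)"
      unfolding s_def by (intro sum_mono) arith
    then have "s t \<le> \<delta> t * s t + w t / 2" using diff[of t] by (simp add: sum.distrib w_def)
    moreover have "\<delta> t * s t \<le> 1/2 * s t" using elim s0 by (intro mult_right_mono) auto
    ultimately show ?case by linarith
  qed
  have \<delta>0: "0 \<le> \<delta> t" for t by (simp add: \<delta>_def sum_nonneg)
  have "((\<lambda>t. x t k - z t k) \<longlongrightarrow> 0) F"
  proof (rule Lim_null_comparison[where g = "\<lambda>t. \<delta> t * w t"])
    show "\<forall>\<^sub>F t in F. norm (x t k - z t k) \<le> \<delta> t * w t"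
      using sw
    proof eventually_elim
      case (elim t)
      have "\<bar>x t k - z t k\<bar> \<le> (\<Sum>k<l. \<bar>x t k - z t k\<bar>)" using k by (intro member_le_sum) auto
      also have "\<dots> \<le> \<delta> t * s t" by (rule diff)
      also have "\<dots> \<le> \<delta> t * w t" using elim \<delta>0 by (intro mult_left_mono) auto
      finally show ?case by simp
    qed
    show "((\<lambda>t. \<delta> t * w t) \<longlongrightarrow> 0) F" using tendsto_mult[OF \<delta> w] by simp
  qed
  from tendsto_add[OF this y[OF k, folded z_def]] show ?thesis by simp
qed

subsection \<open>Multilinear multiplication\<close>

text \<open>With the factors given as a function of the mode, exchanging one of them is the update
  \<open>F(d := X)\<close>, in which the product is linear.\<close>

definition tmul :: "nat list \<Rightarrow> nat list \<Rightarrow> (nat \<Rightarrow> mat) \<Rightarrow> tensor \<Rightarrow> tensor" where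
  "tmul ks ls F = mlmult ks ls (map F [0..<length ls])"

lemma lookup_tmul: "lk (tmul ks ls F C) j =
    (if j \<in> ibox ks then \<Sum>i\<in>ibox ls. lk C i * (\<Prod>d<length ls. F d (j ! d) (i ! d)) else 0)"
proof -
  let ?f = "\<lambda>j. if j \<in> ibox ks then \<Sum>i\<in>ibox ls. lk C i *
    (\<Prod>d<length ls. (map F [0..<length ls] ! d) (j ! d) (i ! d)) else 0"
  have "finite {j. ?f j \<noteq> 0}" by (rule finite_subset[of _ "ibox ks"]) auto
  then have "lk (tmul ks ls F C) j = ?f j" unfolding tmul_def mlmult_def by (subst lookup_Abs_poly_mapping) auto
  then show ?thesis by simp
qed

lemma mlmult_eq_tmul: "mlmult ks ls As C = tmul ks ls (\<lambda>d. As ! d) C"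
  unfolding tmul_def mlmult_def
  by (intro arg_cong[of _ _ Abs_poly_mapping] ext) (auto intro!: sum.cong prod.cong)

lemma tmul_in_tspace [simp]: "tmul ks ls F C \<in> tspace ks"
  by (simp add: tspace_iff lookup_tmul)

lemma ibox_nth: "i \<in> ibox ns \<Longrightarrow> d < length ns \<Longrightarrow> i ! d < ns ! d"
  by (simp add: ibox_def)

lemma tmul_cong:
  assumes "length ks = length ls" "\<And>d. d < length ls \<Longrightarrow> meq (ks ! d) (ls ! d) (F d) (G d)"
  shows "tmul ks ls F C = tmul ks ls G C"
  by (rule poly_mapping_eqI)
    (use assms in \<open>auto simp: lookup_tmul meq_def ibox_nth intro!: sum.cong prod.cong\<close>)

text \<open>Because of this distributivity, compositions and inner products of multilinear products
  factor over the modes.\<close>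

lemma sum_prod_ibox:
  fixes f :: "nat \<Rightarrow> nat \<Rightarrow> real"
  shows "(\<Sum>j\<in>ibox ks. \<Prod>d<length ks. f d (j ! d)) = (\<Prod>d<length ks. \<Sum>a<ks ! d. f d a)"
proof -
  have "(\<Prod>d<length ks. \<Sum>a<ks ! d. f d a) =
      (\<Sum>g\<in>PiE {..<length ks} (\<lambda>d. {..<ks ! d}). \<Prod>d<length ks. f d (g d))"
    by (rule prod_sum_PiE) auto
  also have "\<dots> = (\<Sum>j\<in>ibox ks. \<Prod>d<length ks. f d (j ! d))"
    by (rule sum.reindex_bij_witness[where j = "\<lambda>g. map g [0..<length ks]"
          and i = "\<lambda>j. restrict (\<lambda>d. j ! d) {..<length ks}"])
      (auto simp: ibox_def PiE_def extensional_def fun_eq_iff Pi_def intro!: nth_equalityI)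
  finally show ?thesis by simp
qed

lemma card_ibox: "card (ibox ks) = (\<Prod>d<length ks. ks ! d)"
proof -
  have "real (card (ibox ks)) = real (\<Prod>d<length ks. ks ! d)"
    using sum_prod_ibox[of "\<lambda>_ _. 1" ks] by simp
  then show ?thesis by linarith
qed

lemma tmul_tmul:
  assumes "length ms = length ls"
  shows "tmul ks ms F (tmul ms ls G C) = tmul ks ls (\<lambda>d. mmul (ms ! d) (F d) (G d)) C"
proof (rule poly_mapping_eqI)
  fix j
  have "(\<Sum>m\<in>ibox ms. (\<Sum>i\<in>ibox ls. lk C i * (\<Prod>d<length ls. G d (m ! d) (i ! d))) *
        (\<Prod>d<length ms. F d (j ! d) (m ! d)))
      = (\<Sum>i\<in>ibox ls. lk C i * (\<Sum>m\<in>ibox ms. \<Prod>d<length ms. F d (j ! d) (m ! d) * G d (m ! d) (i ! d)))"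
    by (simp add: sum_distrib_left sum_distrib_right prod.distrib assms mult_ac sum.swap[of _ "ibox ms"])
  also have "\<dots> = (\<Sum>i\<in>ibox ls. lk C i * (\<Prod>d<length ls. mmul (ms ! d) (F d) (G d) (j ! d) (i ! d)))"
    by (subst sum_prod_ibox) (simp add: mmul_def assms)
  finally show "lk (tmul ks ms F (tmul ms ls G C)) j = lk (tmul ks ls (\<lambda>d. mmul (ms ! d) (F d) (G d)) C) j"
    by (simp add: lookup_tmul)
qed

lemma ibox_eqI: "i \<in> ibox ns \<Longrightarrow> j \<in> ibox ns \<Longrightarrow> (\<And>d. d < length ns \<Longrightarrow> i ! d = j ! d) \<Longrightarrow> i = j"
  by (auto simp: ibox_def intro: nth_equalityI)

lemma prod_mid:
  assumes "i \<in> ibox ns" "j \<in> ibox ns"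
  shows "(\<Prod>d<length ns. mid (j ! d) (i ! d)) = (if i = j then 1 else 0)"
proof (cases "i = j")
  case False
  then obtain d where "d < length ns" "i ! d \<noteq> j ! d" using ibox_eqI[OF assms] by metis
  then show ?thesis using False by (auto simp: mid_def intro!: bexI[of _ d])
qed (simp add: mid_def)

lemma tmul_mid: "C \<in> tspace ns \<Longrightarrow> tmul ns ns (\<lambda>_. mid) C = C"
proof (rule poly_mapping_eqI)
  fix j assume C: "C \<in> tspace ns"
  have "(\<Sum>i\<in>ibox ns. lk C i * (\<Prod>d<length ns. mid (j ! d) (i ! d))) = lk C j" if j: "j \<in> ibox ns"
  proof -
    have "(\<Sum>i\<in>ibox ns. lk C i * (\<Prod>d<length ns. mid (j ! d) (i ! d))) = (\<Sum>i\<in>ibox ns. if i = j then lk C i else 0)"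
      using j by (intro sum.cong) (auto simp: prod_mid)
    then show ?thesis using j by simp
  qed
  then show "lk (tmul ns ns (\<lambda>_. mid) C) j = lk C j" using C by (auto simp: lookup_tmul tspace_iff)
qed

lemma linear_tmul: "linear (tmul ks ls F)"
  by (rule linearI; rule poly_mapping_eqI)
    (auto simp: lookup_tmul lookup_add distrib_right sum.distrib sum_distrib_left mult.assoc)

lemma prod_fun_upd:
  assumes "d < (n::nat)"
  shows "(\<Prod>e<n. (F(d := X)) e (j ! e) (i ! e)) =
    (X (j ! d) (i ! d) :: real) * (\<Prod>e\<in>{..<n} - {d}. F e (j ! e) (i ! e))"
  using assms by (subst prod.remove[of _ d]) (auto intro!: prod.cong)

lemma lookup_tmul_upd:
  assumes "d < length ls"
  shows "lk (tmul ks ls (F(d := X)) C) j = (if j \<in> ibox ks then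
    \<Sum>i\<in>ibox ls. lk C i * (X (j ! d) (i ! d) * (\<Prod>e\<in>{..<length ls} - {d}. F e (j ! e) (i ! e))) else 0)"
  using assms by (simp only: lookup_tmul prod_fun_upd)

lemma tmul_upd_add:
  "d < length ls \<Longrightarrow> tmul ks ls (F(d := \<lambda>a b. X a b + Y a b)) C =
    tmul ks ls (F(d := X)) C + tmul ks ls (F(d := Y)) C"
  by (rule poly_mapping_eqI)
    (simp add: lookup_tmul_upd lookup_add algebra_simps sum.distrib)

lemma tmul_upd_scale:
  "d < length ls \<Longrightarrow> tmul ks ls (F(d := \<lambda>a b. c * X a b)) C = c *\<^sub>R tmul ks ls (F(d := X)) C"
  by (rule poly_mapping_eqI)
    (simp add: lookup_tmul_upd sum_distrib_left mult_ac)

section \<open>The Euclidean inner product\<close>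

lemma tinner_eq:
  assumes "finite I" "\<And>i. i \<notin> I \<Longrightarrow> lk A i = 0 \<or> lk B i = 0"
  shows "tinner A B = (\<Sum>i\<in>I. lk A i * lk B i)"
proof -
  let ?J = "I \<union> (Poly_Mapping.keys A \<union> Poly_Mapping.keys B)"
  have "tinner A B = (\<Sum>i\<in>?J. lk A i * lk B i)"
    unfolding tinner_def using assms by (intro sum.mono_neutral_left) (auto simp: in_keys_iff)
  also have "\<dots> = (\<Sum>i\<in>I. lk A i * lk B i)"
    using assms by (intro sum.mono_neutral_right) auto
  finally show ?thesis .
qed

lemma tinner_tspace: "A \<in> tspace ns \<Longrightarrow> tinner A B = (\<Sum>i\<in>ibox ns. lk A i * lk B i)"
  by (rule tinner_eq) (auto simp: tspace_iff)

lemma tinner_commute: "tinner A B = tinner B A"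
  by (simp add: tinner_def Un_commute mult.commute)

lemma tinner_add_left: "tinner (A + B) C = tinner A C + tinner B C"
proof -
  have "tinner X C = (\<Sum>i\<in>Poly_Mapping.keys C. lk X i * lk C i)" for X
    by (rule tinner_eq) (auto simp: in_keys_iff)
  then show ?thesis by (simp add: lookup_add distrib_right sum.distrib)
qed

lemma tinner_scaleR_left: "tinner (c *\<^sub>R A) C = c * tinner A C"
proof -
  have "tinner X C = (\<Sum>i\<in>Poly_Mapping.keys C. lk X i * lk C i)" for X
    by (rule tinner_eq) (auto simp: in_keys_iff)
  then show ?thesis by (simp add: sum_distrib_left mult.assoc)
qed

lemma linear_tinner_left: "linear (\<lambda>A. tinner A C)"
  by (rule linearI) (auto simp: tinner_add_left tinner_scaleR_left)

lemma linear_tinner_right: "linear (tinner A)"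
proof -
  have "tinner A = (\<lambda>B. tinner B A)" by (rule ext) (rule tinner_commute)
  then show ?thesis using linear_tinner_left[of A] by simp
qed

lemma tinner_eq_0_iff: "tinner A A = 0 \<longleftrightarrow> A = 0"
proof
  assume "tinner A A = 0"
  then have "(\<Sum>i\<in>Poly_Mapping.keys A. lk A i * lk A i) = 0" by (simp add: tinner_def)
  then have "\<forall>i\<in>Poly_Mapping.keys A. lk A i * lk A i = 0"
    by (subst (asm) sum_nonneg_eq_0_iff) auto
  then show "A = 0" by (intro poly_mapping_eqI) (auto simp: in_keys_iff)
qed (simp add: tinner_def)

lemma tinner_nonneg: "0 \<le> tinner A A"
  by (simp add: tinner_def sum_nonneg)

definition mtrans :: "mat \<Rightarrow> mat" where
  "mtrans A = (\<lambda>i j. A j i)"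

text \<open>Inner products see the factors only through the matrices \<open>F_d^T H_d\<close>. Hence
  orthogonality in a single mode annihilates them, and factors with orthonormal columns
  cancel.\<close>

lemma tinner_tmul_tmul:
  assumes "length ls = length ks" "length ls' = length ks"
  shows "tinner (tmul ks ls F C) (tmul ks ls' H E) =
    (\<Sum>i\<in>ibox ls. \<Sum>i'\<in>ibox ls'. lk C i * lk E i' *
      (\<Prod>d<length ks. mmul (ks ! d) (mtrans (F d)) (H d) (i ! d) (i' ! d)))"
proof -
  have "tinner (tmul ks ls F C) (tmul ks ls' H E) =
    (\<Sum>j\<in>ibox ks. (\<Sum>i\<in>ibox ls. lk C i * (\<Prod>d<length ls. F d (j ! d) (i ! d))) *
       (\<Sum>i'\<in>ibox ls'. lk E i' * (\<Prod>d<length ls'. H d (j ! d) (i' ! d))))"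
    by (simp add: tinner_tspace[of _ ks] lookup_tmul)
  also have "\<dots> = (\<Sum>j\<in>ibox ks. \<Sum>i\<in>ibox ls. \<Sum>i'\<in>ibox ls'. lk C i * lk E i' *
      (\<Prod>d<length ks. F d (j ! d) (i ! d) * H d (j ! d) (i' ! d)))"
    by (simp add: sum_product prod.distrib assms mult_ac)
  also have "\<dots> = (\<Sum>i\<in>ibox ls. \<Sum>j\<in>ibox ks. \<Sum>i'\<in>ibox ls'. lk C i * lk E i' *
      (\<Prod>d<length ks. F d (j ! d) (i ! d) * H d (j ! d) (i' ! d)))" by (rule sum.swap)
  also have "\<dots> = (\<Sum>i\<in>ibox ls. \<Sum>i'\<in>ibox ls'. \<Sum>j\<in>ibox ks. lk C i * lk E i' *
      (\<Prod>d<length ks. F d (j ! d) (i ! d) * H d (j ! d) (i' ! d)))"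
    by (intro sum.cong sum.swap) auto
  also have "\<dots> = (\<Sum>i\<in>ibox ls. \<Sum>i'\<in>ibox ls'. lk C i * lk E i' *
      (\<Prod>d<length ks. mmul (ks ! d) (mtrans (F d)) (H d) (i ! d) (i' ! d)))"
    by (simp add: sum_distrib_left[symmetric] mmul_def mtrans_def
        sum_prod_ibox[where f = "\<lambda>d a. F d a (_ ! d) * H d a (_ ! d)"])
  finally show ?thesis .
qed

subsection \<open>Tangent spaces of structured Tucker manifolds\<close>

lemma structured_tucker_iff:
  "B \<in> structured_tucker ks ls M \<longleftrightarrow> (\<exists>C F. C \<in> M \<and>
     (\<forall>d<length ls. full_col_rank (ks ! d) (ls ! d) (F d)) \<and> B = tmul ks ls F C)"
proof
  assume "B \<in> structured_tucker ks ls M"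
  then show "\<exists>C F. C \<in> M \<and> (\<forall>d<length ls. full_col_rank (ks ! d) (ls ! d) (F d)) \<and> B = tmul ks ls F C"
    unfolding structured_tucker_def mlmult_eq_tmul by blast
next
  assume "\<exists>C F. C \<in> M \<and> (\<forall>d<length ls. full_col_rank (ks ! d) (ls ! d) (F d)) \<and> B = tmul ks ls F C"
  then obtain C F where *: "C \<in> M" "\<forall>d<length ls. full_col_rank (ks ! d) (ls ! d) (F d)"
    "B = mlmult ks ls (map F [0..<length ls]) C" unfolding tmul_def by blast
  then show "B \<in> structured_tucker ks ls M"
    unfolding structured_tucker_def
    by (intro CollectI exI[of _ C] exI[of _ "map F [0..<length ls]"]) auto
qed

lemma tucker_core_tmul:
  assumes "tucker_core_structure ls M" "C \<in> M" "\<And>d. d < length ls \<Longrightarrow> full_col_rank (ls ! d) (ls ! d) (F d)"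
  shows "tmul ls ls F C \<in> M"
proof -
  have "mlmult ls ls As C \<in> M"
    if "length As = length ls" "\<forall>d<length ls. full_col_rank (ls ! d) (ls ! d) (As ! d)" for As
    using that assms(1,2) unfolding tucker_core_structure_def invertible_mat_def by blast
  then show ?thesis unfolding tmul_def using assms(3) by simp
qed

lemma full_col_rank_of_mmul:
  assumes "full_col_rank l l (mmul k P V)"
  shows "full_col_rank k l V"
proof -
  obtain J where "meq l l (mmul l J (mmul k P V)) mid" using full_col_rank_inverse[OF assms] by blast
  then have "meq l l (mmul k (mmul l J P) V) mid" by (simp add: mmul_assoc)
  then show ?thesis by (rule left_inverse_imp_full_col_rank)
qed

lemma full_col_rank_mmul:
  assumes "full_col_rank k m A" "full_col_rank m l B"
  shows "full_col_rank k l (mmul m A B)"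
proof -
  obtain P Q where P: "meq m m (mmul k P A) mid" and Q: "meq l l (mmul m Q B) mid"
    using full_col_rank_left_inverse assms by metis
  have eq: "mmul k (mmul m Q P) (mmul m A B) = mmul m Q (mmul m (mmul k P A) B)"
    by (simp add: mmul_assoc)
  have 1: "meq l l (mmul m Q (mmul m (mmul k P A) B)) (mmul m Q (mmul m mid B))"
    by (intro mmul_meq P meq_refl)
  have 2: "meq l l (mmul m Q (mmul m mid B)) (mmul m Q B)"
    by (rule mmul_meq[OF meq_refl mmul_mid_left])
  have "meq l l (mmul k (mmul m Q P) (mmul m A B)) mid"
    unfolding eq by (rule meq_trans[OF 1 meq_trans[OF 2 Q]])
  then show ?thesis by (rule left_inverse_imp_full_col_rank)
qed

text \<open>The product rule. Differentiability is asked only of entries inside the blocks, because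
  the others are arbitrary.\<close>

lemma tmul_curve_derivative:
  assumes len: "length ks = length ls"
    and F: "\<And>d a b. d < length ls \<Longrightarrow> a < ks ! d \<Longrightarrow> b < ls ! d \<Longrightarrow>
      ((\<lambda>t. F t d a b) has_real_derivative X d a b) (at 0)"
    and C: "(C has_vector_derivative c) (at 0)"
  shows "((\<lambda>t. tmul ks ls (F t) (C t)) has_vector_derivative
    (tmul ks ls (F 0) c + (\<Sum>d<length ls. tmul ks ls ((F 0)(d := X d)) (C 0)))) (at 0)" (is "(_ has_vector_derivative ?v) _")
proof (subst tensor_curve_derivative_iff[of "ibox ks"])
  show "\<And>t i. i \<notin> ibox ks \<Longrightarrow> lk (tmul ks ls (F t) (C t)) i = 0" by (simp add: lookup_tmul)
  show "\<And>i. i \<notin> ibox ks \<Longrightarrow> lk ?v i = 0" by (simp add: lookup_tmul lookup_add lookup_sum)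
  show "\<forall>j\<in>ibox ks. ((\<lambda>t. lk (tmul ks ls (F t) (C t)) j) has_vector_derivative lk ?v j) (at 0)"
  proof
    fix j assume j: "j \<in> ibox ks"
    let ?D = "length ls"
    have Ci: "((\<lambda>t. lk (C t) i) has_real_derivative lk c i) (at 0)" for i
      using bounded_linear.has_vector_derivative[OF bounded_linear_lookup C]
      by (simp add: has_real_derivative_iff_has_vector_derivative)
    have "((\<lambda>t. \<Sum>i\<in>ibox ls. lk (C t) i * (\<Prod>d<?D. F t d (j ! d) (i ! d))) has_real_derivative
       (\<Sum>i\<in>ibox ls. lk c i * (\<Prod>d<?D. F 0 d (j ! d) (i ! d)) +
          (\<Sum>d<?D. X d (j ! d) (i ! d) * (\<Prod>e\<in>{..<?D} - {d}. F 0 e (j ! e) (i ! e))) * lk (C 0) i)) (at 0)"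
      using j len by (intro DERIV_sum DERIV_mult Ci has_field_derivative_prod F) (auto simp: ibox_nth)
    moreover have "lk ?v j = (\<Sum>i\<in>ibox ls. lk c i * (\<Prod>d<?D. F 0 d (j ! d) (i ! d)) +
          (\<Sum>d<?D. X d (j ! d) (i ! d) * (\<Prod>e\<in>{..<?D} - {d}. F 0 e (j ! e) (i ! e))) * lk (C 0) i)"
    proof -
      have "lk ?v j = (\<Sum>i\<in>ibox ls. lk c i * (\<Prod>d<?D. F 0 d (j ! d) (i ! d))) +
        (\<Sum>d<?D. \<Sum>i\<in>ibox ls. lk (C 0) i * (X d (j ! d) (i ! d) * (\<Prod>e\<in>{..<?D} - {d}. F 0 e (j ! e) (i ! e))))"
        using j unfolding lookup_add lookup_sum
        by (intro arg_cong2[of _ _ _ _ "(+)"] sum.cong refl) (simp_all add: lookup_tmul prod_fun_upd del: fun_upd_apply)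
      also have "(\<Sum>d<?D. \<Sum>i\<in>ibox ls. lk (C 0) i * (X d (j ! d) (i ! d) * (\<Prod>e\<in>{..<?D} - {d}. F 0 e (j ! e) (i ! e))))
         = (\<Sum>i\<in>ibox ls. \<Sum>d<?D. lk (C 0) i * (X d (j ! d) (i ! d) * (\<Prod>e\<in>{..<?D} - {d}. F 0 e (j ! e) (i ! e))))"
        by (rule sum.swap)
      finally have *: "lk ?v j = (\<Sum>i\<in>ibox ls. lk c i * (\<Prod>d<?D. F 0 d (j ! d) (i ! d))) +
        (\<Sum>i\<in>ibox ls. \<Sum>d<?D. lk (C 0) i * (X d (j ! d) (i ! d) * (\<Prod>e\<in>{..<?D} - {d}. F 0 e (j ! e) (i ! e))))" .
      show ?thesis
        by (rule trans[OF *]) (simp add: sum.distrib sum_distrib_left sum_distrib_right mult_ac)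
    qed
    ultimately show "((\<lambda>t. lk (tmul ks ls (F t) (C t)) j) has_vector_derivative lk ?v j) (at 0)"
      using j by (simp add: lookup_tmul has_real_derivative_iff_has_vector_derivative)
  qed
qed simp

lemma tmul_has_vector_derivative:
  assumes "length ks = length ls" "(C has_vector_derivative c) (at 0)"
  shows "((\<lambda>t. tmul ks ls F (C t)) has_vector_derivative tmul ks ls F c) (at 0)"
proof -
  have "tmul ks ls (F(d := \<lambda>a b. 0)) (C 0) = 0" if "d < length ls" for d
    using tmul_upd_scale[OF that, of ks F 0 "\<lambda>a b. 0" "C 0"] by simp
  then show ?thesis
    using tmul_curve_derivative[OF assms(1) _ assms(2), of "\<lambda>_. F" "\<lambda>d a b. 0"] by simp
qed

section \<open>Unfoldings\<close>

lemma ibox_update: "i \<in> ibox ls \<Longrightarrow> b < k \<Longrightarrow> i[d := b] \<in> ibox (ls[d := k])"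
  by (cases "d < length ls") (auto simp: ibox_def nth_list_update list_update_beyond)

lemma ibox_update_same: "i \<in> ibox ls \<Longrightarrow> d < length ls \<Longrightarrow> b < ls ! d \<Longrightarrow> i[d := b] \<in> ibox ls"
  using ibox_update[of i ls b "ls ! d" d] by simp

text \<open>Identities in the other modes fix all coordinates except the \<open>d\<close>-th, so the
  product acts as the matrix \<open>W\<close> on the mode-\<open>d\<close> unfolding. A column of
  the unfolding is named by any \<open>i\<close> of the box, whose own \<open>d\<close>-th entry
  gets overwritten.\<close>

lemma lookup_tmul_mode:
  assumes d: "d < length ls" and i: "i \<in> ibox ls" and a: "a < k"
  shows "lk (tmul (ls[d := k]) ls ((\<lambda>_. mid)(d := W)) C) (i[d := a]) =
    (\<Sum>b<ls ! d. W a b * lk C (i[d := b]))"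
proof -
  let ?D = "length ls"
  let ?f = "\<lambda>i'. lk C i' * (W a (i' ! d) * (\<Prod>e\<in>{..<?D} - {d}. mid (i ! e) (i' ! e)))"
  have li: "length i = ?D" using i by (simp add: ibox_def)
  have "lk (tmul (ls[d := k]) ls ((\<lambda>_. mid)(d := W)) C) (i[d := a]) =
    (\<Sum>i'\<in>ibox ls. lk C i' * (W (i[d := a] ! d) (i' ! d) *
       (\<Prod>e\<in>{..<?D} - {d}. mid (i[d := a] ! e) (i' ! e))))"
    using ibox_update[OF i a, of d] by (simp add: lookup_tmul_upd[OF d] del: fun_upd_apply)
  also have "\<dots> = (\<Sum>i'\<in>ibox ls. ?f i')"
    using d li by (intro sum.cong refl arg_cong2[of _ _ _ _ "(*)"] prod.cong) auto
  also have "\<dots> = (\<Sum>i'\<in>(\<lambda>b. i[d := b]) ` {..<ls ! d}. ?f i')"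
  proof (rule sum.mono_neutral_right)
    show "(\<lambda>b. i[d := b]) ` {..<ls ! d} \<subseteq> ibox ls" using ibox_update_same[OF i d] by auto
    show "\<forall>i'\<in>ibox ls - (\<lambda>b. i[d := b]) ` {..<ls ! d}. ?f i' = 0"
    proof
      fix i' assume i': "i' \<in> ibox ls - (\<lambda>b. i[d := b]) ` {..<ls ! d}"
      have "\<exists>e\<in>{..<?D} - {d}. i ! e \<noteq> i' ! e"
      proof (rule ccontr)
        assume "\<not> ?thesis"
        then have "i' = i[d := i' ! d]"
          using i' li d by (intro nth_equalityI) (auto simp: ibox_def nth_list_update)
        then show False using i' d by (auto simp: ibox_nth)
      qed
      then have "(\<Prod>e\<in>{..<?D} - {d}. mid (i ! e) (i' ! e)) = 0"
        by (auto simp: mid_def)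
      then show "?f i' = 0" by simp
    qed
  qed simp
  also have "\<dots> = (\<Sum>b<ls ! d. ?f (i[d := b]))"
  proof (subst sum.reindex)
    show "inj_on (\<lambda>b. i[d := b]) {..<ls ! d}"
    proof (rule inj_onI)
      fix x y assume "i[d := x] = i[d := y]"
      then have "i[d := x] ! d = i[d := y] ! d" by simp
      then show "x = y" using d li by simp
    qed
  qed simp
  also have "\<dots> = (\<Sum>b<ls ! d. W a b * lk C (i[d := b]))"
  proof (intro sum.cong refl)
    fix b
    have "(\<Prod>e\<in>{..<?D} - {d}. mid (i ! e) (i[d := b] ! e)) = 1"
      by (rule prod.neutral) (auto simp: mid_def)
    then show "?f (i[d := b]) = W a b * lk C (i[d := b])" using d li by simp
  qed
  finally show ?thesis .
qed

text \<open>The range of the differential of the parametrisation by factors and core, with the core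
  moving along \<open>T\<close>. The pair \<open>(c, X)\<close> need not be unique, since changes of
  basis can be shifted between core and factors.\<close>

definition tucker_tangent :: "nat list \<Rightarrow> nat list \<Rightarrow> tensor set \<Rightarrow> (nat \<Rightarrow> mat) \<Rightarrow> tensor \<Rightarrow> tensor set" where
  "tucker_tangent ks ls T U C =
    {tmul ks ls U c + (\<Sum>d<length ls. tmul ks ls (U(d := X d)) C) | c X. c \<in> T}"

lemma subspace_tucker_tangent:
  assumes T: "subspace T"
  shows "subspace (tucker_tangent ks ls T U C)"
  unfolding subspace_def
proof (intro conjI ballI allI)
  let ?E = "\<lambda>c X. tmul ks ls U c + (\<Sum>d<length ls. tmul ks ls (U(d := X d)) C)"
  have lin: "?E (c + c') (\<lambda>d a b. X d a b + X' d a b) = ?E c X + ?E c' X'" for c c' X X'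
    by (simp add: linear_add[OF linear_tmul] tmul_upd_add sum.distrib)
  have scl: "?E (r *\<^sub>R c) (\<lambda>d a b. r * X d a b) = r *\<^sub>R ?E c X" for r c X
    by (simp add: linear_cmul[OF linear_tmul] tmul_upd_scale scaleR_sum_right scaleR_add_right)
  have I: "?E c X \<in> tucker_tangent ks ls T U C" if "c \<in> T" for c X
    using that unfolding tucker_tangent_def by blast
  have "0 *\<^sub>R ?E 0 (\<lambda>_ _ _. 0) \<in> tucker_tangent ks ls T U C"
    unfolding scl[of 0 0 "\<lambda>_ _ _. 0", symmetric] by (intro I subspace_scale[OF T] subspace_0[OF T])
  then show "0 \<in> tucker_tangent ks ls T U C" by simp
  fix x assume x: "x \<in> tucker_tangent ks ls T U C"
  then obtain c X where cX: "c \<in> T" "x = ?E c X" unfolding tucker_tangent_def by blast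
  show "r *\<^sub>R x \<in> tucker_tangent ks ls T U C" for r
  proof -
    have "r *\<^sub>R x = ?E (r *\<^sub>R c) (\<lambda>d a b. r * X d a b)" unfolding cX(2) by (rule scl[symmetric])
    then show ?thesis by (rule ssubst) (rule I[OF subspace_scale[OF T cX(1)]])
  qed
  fix y assume "y \<in> tucker_tangent ks ls T U C"
  then obtain c' X' where cX': "c' \<in> T" "y = ?E c' X'" unfolding tucker_tangent_def by blast
  show "x + y \<in> tucker_tangent ks ls T U C"
  proof -
    have "x + y = ?E (c + c') (\<lambda>d a b. X d a b + X' d a b)" unfolding cX(2) cX'(2) by (rule lin[symmetric])
    then show ?thesis by (rule ssubst) (rule I[OF subspace_add[OF T cX(1) cX'(1)]])
  qed
qed

text \<open>Moving the factors along straight lines keeps full column rank for small times: with a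
  left inverse \<open>P\<close> of \<open>U d\<close>, the product of \<open>P\<close> and the moved
  factor stays near the identity.\<close>

lemma tucker_tangent_sub:
  assumes len: "length ks = length ls"
    and U: "\<And>d. d < length ls \<Longrightarrow> full_col_rank (ks ! d) (ls ! d) (U d)" and C: "C \<in> M"
  shows "tucker_tangent ks ls (tangent_space M C) U C \<subseteq>
    tangent_space (structured_tucker ks ls M) (tmul ks ls U C)"
proof
  let ?D = "length ls"
  fix v assume "v \<in> tucker_tangent ks ls (tangent_space M C) U C"
  then obtain c X where c: "c \<in> tangent_space M C"
    and v: "v = tmul ks ls U c + (\<Sum>d<?D. tmul ks ls (U(d := X d)) C)"
    unfolding tucker_tangent_def by blast
  obtain \<gamma> where \<gamma>: "\<gamma> 0 = C" "\<And>t::real. \<gamma> t \<in> M" "(\<gamma> has_vector_derivative c) (at 0)"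
    using tangent_spaceE[OF c] by blast
  define F where "F t d a b = U d a b + t * X d a b" for t d a b
  have F0: "F 0 = U" by (simp add: F_def fun_eq_iff)
  show "v \<in> tangent_space (structured_tucker ks ls M) (tmul ks ls U C)"
  proof (rule tangent_spaceI)
    show "tmul ks ls U C \<in> structured_tucker ks ls M"
      unfolding structured_tucker_iff using C U by blast
    show "tmul ks ls (F 0) (\<gamma> 0) = tmul ks ls U C" by (simp add: F0 \<gamma>)
    have "\<forall>\<^sub>F t in at 0. \<forall>d\<in>{..<?D}. full_col_rank (ks ! d) (ls ! d) (F t d)"
    proof (rule eventually_ball_finite[OF finite_lessThan], rule ballI)
      fix d assume "d \<in> {..<?D}"
      then obtain P where P: "meq (ls ! d) (ls ! d) (mmul (ks ! d) P (U d)) mid"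
        using U full_col_rank_left_inverse by blast
      have "\<forall>\<^sub>F t in at 0. full_col_rank (ls ! d) (ls ! d) (mmul (ks ! d) P (F t d))"
      proof (rule eventually_full_col_rank)
        fix i j assume ij: "i < ls ! d" "j < ls ! d"
        have "((\<lambda>t. \<Sum>k<ks ! d. P i k * (U d k j + t * X d k j)) \<longlongrightarrow>
            (\<Sum>k<ks ! d. P i k * (U d k j + 0 * X d k j))) (at 0)"
          by (intro tendsto_intros)
        then show "((\<lambda>t. mmul (ks ! d) P (F t d) i j) \<longlongrightarrow> mid i j) (at 0)"
          using meqD[OF P ij] by (simp add: mmul_def F_def)
      qed
      then show "\<forall>\<^sub>F t in at 0. full_col_rank (ks ! d) (ls ! d) (F t d)"
        by eventually_elim (rule full_col_rank_of_mmul)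
    qed
    then show "\<forall>\<^sub>F t in at 0. tmul ks ls (F t) (\<gamma> t) \<in> structured_tucker ks ls M"
      by eventually_elim (use \<gamma>(2) in \<open>auto simp: structured_tucker_iff\<close>)
    have "((\<lambda>t. tmul ks ls (F t) (\<gamma> t)) has_vector_derivative
      (tmul ks ls (F 0) c + (\<Sum>d<length ls. tmul ks ls ((F 0)(d := X d)) (\<gamma> 0)))) (at 0)"
    proof (rule tmul_curve_derivative[OF len _ \<gamma>(3)])
      show "((\<lambda>t. F t d a b) has_real_derivative X d a b) (at 0)" for d a b
        unfolding F_def by (auto intro!: derivative_eq_intros)
    qed
    then show "((\<lambda>t. tmul ks ls (F t) (\<gamma> t)) has_vector_derivative v) (at 0)"
      by (simp add: F0 \<gamma> v)
  qed
qed


text \<open>Exhibits the mode-\<open>d\<close> unfolding of the product as \<open>K d\<close> times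
  another matrix, so that the rank of the unfolding bounds the rank of \<open>K d\<close> from
  below.\<close>

lemma tmul_split_mode:
  assumes "d < length ls"
  shows "tmul ls ls K C = tmul ls ls ((\<lambda>_. mid)(d := K d)) (tmul ls ls (K(d := mid)) C)"
proof -
  have "meq (ls ! e) (ls ! e) (K e) (mmul (ls ! e) (((\<lambda>_. mid)(d := K d)) e) ((K(d := mid)) e))" for e
    by (cases "e = d") (auto intro: meq_sym[OF mmul_mid_left] meq_sym[OF mmul_mid_right])
  then show ?thesis unfolding tmul_tmul[OF refl] by (intro tmul_cong) auto
qed

text \<open>Full multilinear rank makes the rows of the unfolding independent, and the inverse of
  their Gram matrix yields a right inverse. Letting \<open>i\<close> run over the whole box only
  repeats columns.\<close>

lemma unfolding_right_inverse:
  assumes C: "full_mlrank ls C" and d: "d < length ls"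
  obtains \<rho> where "\<And>j k. j < ls ! d \<Longrightarrow> k < ls ! d \<Longrightarrow>
    (\<Sum>i\<in>ibox ls. lk C (i[d := j]) * \<rho> k i) = mid j k"
proof -
  obtain P where P: "\<And>j k. j < ls ! d \<Longrightarrow> k < ls ! d \<Longrightarrow>
      (\<Sum>i\<in>ibox ls. P j i * lk C (i[d := k])) = mid j k"
  proof (rule gram_inverse[where I = "ibox ls" and B = "\<lambda>i j. lk C (i[d := j])" and l = "ls ! d"])
    fix x :: "nat \<Rightarrow> real" assume "\<And>i. i \<in> ibox ls \<Longrightarrow> (\<Sum>j<ls ! d. lk C (i[d := j]) * x j) = 0"
    then have "\<forall>i\<in>ibox ls. (\<Sum>j<ls ! d. x j * lk C (i[d := j])) = 0" by (simp add: mult.commute)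
    then show "\<forall>j<ls ! d. x j = 0" using C d unfolding full_mlrank_def by blast
  qed (auto intro: that)
  show thesis
    by (rule that[of P]) (use P in \<open>simp add: mult.commute mid_def\<close>)
qed

text \<open>A curve through \<open>U \<cdot> C\<close> in the structured Tucker manifold is lifted to the core by the left
  inverses \<open>P\<close> of \<open>U\<close>; the factors normalised by \<open>P W = 1\<close> are then determined linearly by an
  unfolding of the curve, which makes them differentiable.\<close>
lemma tucker_tangent_sup:
  assumes len: "length ks = length ls" and M: "tucker_core_structure ls M"
    and U: "\<And>d. d < length ls \<Longrightarrow> full_col_rank (ks ! d) (ls ! d) (U d)" and C: "C \<in> M"
  shows "tangent_space (structured_tucker ks ls M) (tmul ks ls U C) \<subseteq>
    tucker_tangent ks ls (tangent_space M C) U C"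
proof
  let ?D = "length ls"
  fix v assume v: "v \<in> tangent_space (structured_tucker ks ls M) (tmul ks ls U C)"
  obtain \<gamma> where \<gamma>: "\<gamma> 0 = tmul ks ls U C" "\<And>t::real. \<gamma> t \<in> structured_tucker ks ls M"
    "(\<gamma> has_vector_derivative v) (at 0)"
    using tangent_spaceE[OF v] by blast
  have Ct: "C \<in> tspace ls" and rank: "full_mlrank ls C"
    using M C unfolding tucker_core_structure_def embedded_submanifold_def by auto
  have "\<forall>d. \<exists>P. d < ?D \<longrightarrow> meq (ls ! d) (ls ! d) (mmul (ks ! d) P (U d)) mid"
    using U full_col_rank_left_inverse by metis
  then obtain P where P: "\<And>d. d < ?D \<Longrightarrow> meq (ls ! d) (ls ! d) (mmul (ks ! d) (P d) (U d)) mid"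
    by metis
  have "\<forall>d. \<exists>\<rho>. d < ?D \<longrightarrow> (\<forall>j<ls ! d. \<forall>k<ls ! d. (\<Sum>i\<in>ibox ls. lk C (i[d := j]) * \<rho> k i) = mid j k)"
    using unfolding_right_inverse[OF rank] by metis
  then obtain \<rho> where \<rho>: "\<And>d j k. d < ?D \<Longrightarrow> j < ls ! d \<Longrightarrow> k < ls ! d \<Longrightarrow>
      (\<Sum>i\<in>ibox ls. lk C (i[d := j]) * \<rho> d k i) = mid j k"
    by metis
  define \<Gamma> where "\<Gamma> t = tmul ls ks P (\<gamma> t)" for t
  \<comment> \<open>The mode-\<open>d\<close> unfolding of the lifted core times the fixed right
    inverse belonging to \<open>C\<close>: the identity at time 0 and differentiable there, hence
    invertible for small \<open>t\<close>.\<close>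
  define M' where "M' d t = (\<lambda>j k. \<Sum>i\<in>ibox ls. lk (\<Gamma> t) (i[d := j]) * \<rho> d k i)" for d t
  define ls' where "ls' d = ls[d := ks ! d]" for d
  \<comment> \<open>Compressing all modes but the \<open>d\<close>-th isolates the
    \<open>d\<close>-th factor, and \<open>H d\<close> inherits the differentiability of
    \<open>\<gamma>\<close>.\<close>
  define H where "H d t = tmul (ls' d) ks (P(d := mid)) (\<gamma> t)" for d t
  define N where "N d t = (\<lambda>a k. \<Sum>i\<in>ibox ls. lk (H d t) (i[d := a]) * \<rho> d k i)" for d t
  \<comment> \<open>The last clause is the linear system \<open>N = W M'\<close> with differentiable
    \<open>N\<close> and \<open>M'\<close>, from which the factors are recovered.\<close>
  define good where "good t W \<longleftrightarrow> \<Gamma> t \<in> M \<and> \<gamma> t = tmul ks ls W (\<Gamma> t) \<and>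
    (\<forall>d<?D. meq (ks ! d) (ls ! d) (N d t) (mmul (ls ! d) (W d) (M' d t)))" for t W
  have \<Gamma>0: "\<Gamma> 0 = C"
  proof -
    have "\<Gamma> 0 = tmul ls ls (\<lambda>d. mmul (ks ! d) (P d) (U d)) C"
      unfolding \<Gamma>_def \<gamma>(1) by (rule tmul_tmul[OF len])
    also have "\<dots> = tmul ls ls (\<lambda>_. mid) C" using P by (intro tmul_cong) auto
    finally show ?thesis using tmul_mid[OF Ct] by simp
  qed
  have \<Gamma>d: "(\<Gamma> has_vector_derivative tmul ls ks P v) (at 0)"
    unfolding \<Gamma>_def using tmul_has_vector_derivative[OF len[symmetric] \<gamma>(3)] .
  have Hd: "(H d has_vector_derivative tmul (ls' d) ks (P(d := mid)) v) (at 0)" for d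
    unfolding H_def using tmul_has_vector_derivative[OF _ \<gamma>(3)] len by (simp add: ls'_def)
  have lkd: "((\<lambda>t. lk (G t) i) has_real_derivative lk g i) (at 0)"
    if "(G has_vector_derivative g) (at 0)" for G g i
    using bounded_linear.has_vector_derivative[OF bounded_linear_lookup that]
    by (simp add: has_real_derivative_iff_has_vector_derivative)
  have M'd: "\<exists>m. ((\<lambda>t. M' d t j k) has_real_derivative m) (at 0)" for d j k
    unfolding M'_def
    by (rule exI[of _ "\<Sum>i\<in>ibox ls. lk (tmul ls ks P v) (i[d := j]) * \<rho> d k i"])
      (intro DERIV_sum DERIV_cmult_right lkd[OF \<Gamma>d])
  have Nd: "\<exists>n. ((\<lambda>t. N d t a k) has_real_derivative n) (at 0)" for d a k
    unfolding N_def
    by (rule exI[of _ "\<Sum>i\<in>ibox ls. lk (tmul (ls' d) ks (P(d := mid)) v) (i[d := a]) * \<rho> d k i"])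
      (intro DERIV_sum DERIV_cmult_right lkd[OF Hd])
  have M'lim: "((\<lambda>t. M' d t j k) \<longlongrightarrow> mid j k) (at 0)" if "d < ?D" "j < ls ! d" "k < ls ! d" for d j k
  proof -
    have "M' d 0 j k = mid j k" using \<rho>[OF that] by (simp add: M'_def \<Gamma>0)
    moreover obtain m where "((\<lambda>t. M' d t j k) has_real_derivative m) (at 0)" using M'd by blast
    ultimately show ?thesis using DERIV_isCont isCont_def by metis
  qed
  \<comment> \<open>With \<open>P W = 1\<close> in the other modes, the compression leaves the core
    multiplied by \<open>W d\<close> in mode \<open>d\<close> alone.\<close>
  have key: "meq (ks ! d) (ls ! d) (N d t) (mmul (ls ! d) (W d) (M' d t))"
    if d: "d < ?D" and \<gamma>t: "\<gamma> t = tmul ks ls W (\<Gamma> t)" and PW: "\<And>e. e < ?D \<Longrightarrow> meq (ls ! e) (ls ! e) (mmul (ks ! e) (P e) (W e)) mid"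
    for d t W
  proof -
    have "H d t = tmul (ls' d) ls (\<lambda>e. mmul (ks ! e) ((P(d := mid)) e) (W e)) (\<Gamma> t)"
      unfolding H_def by (subst \<gamma>t) (rule tmul_tmul[OF len])
    also have "\<dots> = tmul (ls' d) ls ((\<lambda>_. mid)(d := W d)) (\<Gamma> t)"
    proof (rule tmul_cong)
      fix e assume e: "e < ?D"
      show "meq (ls' d ! e) (ls ! e) (mmul (ks ! e) ((P(d := mid)) e) (W e)) (((\<lambda>_. mid)(d := W d)) e)"
        using PW[OF e] e d by (cases "e = d") (auto simp: ls'_def mmul_mid_left)
    qed (simp add: ls'_def)
    finally have H: "H d t = tmul (ls' d) ls ((\<lambda>_. mid)(d := W d)) (\<Gamma> t)" .
    have "N d t a k = mmul (ls ! d) (W d) (M' d t) a k" if a: "a < ks ! d" for a k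
    proof -
      have "N d t a k = (\<Sum>i\<in>ibox ls. (\<Sum>b<ls ! d. W d a b * lk (\<Gamma> t) (i[d := b])) * \<rho> d k i)"
        unfolding N_def H ls'_def using lookup_tmul_mode[OF d _ a] by (intro sum.cong) auto
      also have "\<dots> = mmul (ls ! d) (W d) (M' d t) a k"
        unfolding mmul_def M'_def
        by (simp add: sum_distrib_left sum_distrib_right mult.assoc sum.swap[of _ "ibox ls"])
      finally show ?thesis .
    qed
    then show ?thesis by (simp add: meq_def)
  qed
  have good0: "good 0 U"
    unfolding good_def using \<Gamma>0 C \<gamma>(1) P by (auto intro: key)
  have "\<forall>\<^sub>F t in at 0. \<forall>d\<in>{..<?D}. full_col_rank (ls ! d) (ls ! d) (M' d t)"
    using M'lim by (intro eventually_ball_finite[OF finite_lessThan] ballI eventually_full_col_rank) auto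
  then have good_ev: "\<forall>\<^sub>F t in at 0. \<exists>W. good t W"
  proof eventually_elim
    case (elim t)
    obtain E V where E: "E \<in> M" and \<gamma>t: "\<gamma> t = tmul ks ls V E"
      using \<gamma>(2)[of t] unfolding structured_tucker_iff by blast
    define K where "K d = mmul (ks ! d) (P d) (V d)" for d
    have \<Gamma>t: "\<Gamma> t = tmul ls ls K E"
      unfolding \<Gamma>_def \<gamma>t K_def by (rule tmul_tmul[OF len])
    \<comment> \<open>\<open>M' d t\<close> is invertible for small \<open>t\<close> and has
      \<open>K d\<close> as its left factor, so \<open>K d\<close> is invertible too.\<close>
    have Kfull: "full_col_rank (ls ! d) (ls ! d) (K d)" if d: "d < ?D" for d
    proof -
      define Z where "Z = (\<lambda>b k. \<Sum>i\<in>ibox ls. lk (tmul ls ls (K(d := mid)) E) (i[d := b]) * \<rho> d k i)"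
      have "M' d t j k = mmul (ls ! d) (K d) Z j k" if j: "j < ls ! d" for j k
      proof -
        have "lk (\<Gamma> t) (i[d := j]) = (\<Sum>b<ls ! d. K d j b * lk (tmul ls ls (K(d := mid)) E) (i[d := b]))"
          if "i \<in> ibox ls" for i
          using lookup_tmul_mode[OF d that j, of "K d" "tmul ls ls (K(d := mid)) E"]
          unfolding \<Gamma>t tmul_split_mode[OF d, of K] by simp
        then have "M' d t j k = (\<Sum>i\<in>ibox ls. (\<Sum>b<ls ! d. K d j b * lk (tmul ls ls (K(d := mid)) E) (i[d := b])) * \<rho> d k i)"
          unfolding M'_def by (intro sum.cong) auto
        also have "\<dots> = mmul (ls ! d) (K d) Z j k"
          unfolding mmul_def Z_def
          by (simp add: sum_distrib_left sum_distrib_right mult.assoc sum.swap[of _ "ibox ls"])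
        finally show ?thesis .
      qed
      then have MKZ: "meq (ls ! d) (ls ! d) (M' d t) (mmul (ls ! d) (K d) Z)" by (simp add: meq_def)
      obtain J where J: "meq (ls ! d) (ls ! d) (mmul (ls ! d) (M' d t) J) mid"
        using full_col_rank_inverse elim d by (metis lessThan_iff)
      have "meq (ls ! d) (ls ! d) (mmul (ls ! d) (mmul (ls ! d) (K d) Z) J) mid"
        by (rule meq_trans[OF mmul_meq[OF meq_sym[OF MKZ] meq_refl] J])
      then show ?thesis unfolding mmul_assoc by (rule right_inverse_imp_full_col_rank)
    qed
    then have "\<forall>d. \<exists>J. d < ?D \<longrightarrow> meq (ls ! d) (ls ! d) (mmul (ls ! d) (K d) J) mid \<and>
        meq (ls ! d) (ls ! d) (mmul (ls ! d) J (K d)) mid"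
      using full_col_rank_inverse by metis
    then obtain J where J: "\<And>d. d < ?D \<Longrightarrow> meq (ls ! d) (ls ! d) (mmul (ls ! d) (K d) (J d)) mid"
       "\<And>d. d < ?D \<Longrightarrow> meq (ls ! d) (ls ! d) (mmul (ls ! d) (J d) (K d)) mid" by metis
    \<comment> \<open>The representation by \<open>V\<close> and \<open>E\<close> is arbitrary.
      Absorbing \<open>K\<close> into the core replaces \<open>V\<close> by \<open>V K^-1\<close>,
      which satisfies the normalisation \<open>P W = 1\<close>.\<close>
    define W where "W d = mmul (ls ! d) (V d) (J d)" for d
    have "tmul ks ls W (\<Gamma> t) = tmul ks ls (\<lambda>d. mmul (ls ! d) (W d) (K d)) E"
      unfolding \<Gamma>t by (rule tmul_tmul) simp
    also have "\<dots> = tmul ks ls V E"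
    proof (rule tmul_cong[OF len])
      fix d assume d: "d < ?D"
      have "meq (ks ! d) (ls ! d) (mmul (ls ! d) (V d) (mmul (ls ! d) (J d) (K d))) (V d)"
        by (rule meq_trans[OF mmul_meq[OF meq_refl J(2)[OF d]] mmul_mid_right])
      then show "meq (ks ! d) (ls ! d) (mmul (ls ! d) (W d) (K d)) (V d)"
        by (simp add: W_def mmul_assoc)
    qed
    finally have 1: "\<gamma> t = tmul ks ls W (\<Gamma> t)" using \<gamma>t by simp
    have 2: "meq (ls ! d) (ls ! d) (mmul (ks ! d) (P d) (W d)) mid" if "d < ?D" for d
      using J(1)[OF that] by (simp add: W_def K_def mmul_assoc)
    have "\<Gamma> t \<in> M" unfolding \<Gamma>t by (rule tucker_core_tmul[OF M E Kfull])
    then have "good t W" unfolding good_def using 1 2 by (auto intro: key)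
    then show ?case by blast
  qed
  \<comment> \<open>A pointwise choice carries no regularity; its value at 0 is fixed to
    \<open>U\<close>, and differentiability there is derived from the linear system.\<close>
  define W where "W t = (if t = 0 then U else SOME W. good t W)" for t
  have W0: "W 0 = U" by (simp add: W_def)
  have goodW: "\<forall>\<^sub>F t in at 0. good t (W t)"
    using good_ev unfolding eventually_at_filter
  proof eventually_elim
    case (elim t)
    have "good t (SOME W. good t W)" if t: "t \<noteq> 0"
    proof -
      obtain W' where "good t W'" using elim t by blast
      then show ?thesis by (rule someI[where P = "good t"])
    qed
    then show ?case by (simp add: W_def)
  qed
  have "\<exists>Y. \<forall>d<?D. \<forall>a<ks ! d. \<forall>k<ls ! d. ((\<lambda>t. W t d a k) has_real_derivative Y d a k) (at 0)"
  proof -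
    have ex: "\<exists>y. ((\<lambda>t. N d t a k - (\<Sum>j<ls ! d. U d a j * M' d t j k)) has_real_derivative y) (at 0)" for d a k
    proof -
      obtain n where n: "((\<lambda>t. N d t a k) has_real_derivative n) (at 0)" using Nd by blast
      have "\<exists>m. \<forall>j. ((\<lambda>t. M' d t j k) has_real_derivative m j) (at 0)"
        by (rule choice) (rule allI, rule M'd)
      then obtain m where m: "\<And>j. ((\<lambda>t. M' d t j k) has_real_derivative m j) (at 0)" by blast
      show ?thesis by (rule exI[of _ "n - (\<Sum>j<ls ! d. U d a j * m j)"]) (intro DERIV_diff n DERIV_sum DERIV_cmult m)
    qed
    define Y where "Y d a k = (SOME y. ((\<lambda>t. N d t a k -
      (\<Sum>j<ls ! d. U d a j * M' d t j k)) has_real_derivative y) (at 0))" for d a k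
    have Y: "((\<lambda>t. N d t a k - (\<Sum>j<ls ! d. U d a j * M' d t j k)) has_real_derivative Y d a k) (at 0)" for d a k
      unfolding Y_def by (rule someI_ex[OF ex])
    have "((\<lambda>t. W t d a k) has_real_derivative Y d a k) (at 0)"
      if d: "d < ?D" and a: "a < ks ! d" and k: "k < ls ! d" for d a k
    proof -
      \<comment> \<open>By \<open>W M' = N\<close> these quotients solve a system whose matrix
        \<open>M'\<close> tends to the identity and whose right-hand side is the quotient of
        \<open>N - U M'\<close>.\<close>
      let ?x = "\<lambda>t j. (W t d a j - U d a j) /\<^sub>R t"
      have "((\<lambda>t. ?x t k) \<longlongrightarrow> Y d a k) (at 0)"
      proof (rule tendsto_solve_near_identity[where M = "M' d" and l = "ls ! d"])
        show "((\<lambda>t. M' d t i j) \<longlongrightarrow> mid i j) (at 0)" if "i < ls ! d" "j < ls ! d" for i j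
          using M'lim d that by blast
        fix k assume k: "k < ls ! d"
        let ?g = "\<lambda>t. N d t a k - (\<Sum>j<ls ! d. U d a j * M' d t j k)"
        have g: "?g t = (\<Sum>j<ls ! d. W' d a j * M' d t j k) - (\<Sum>j<ls ! d. U d a j * M' d t j k)"
          if "good t W'" for t W'
          using that d a k by (auto simp: good_def meq_def mmul_def)
        have g0: "?g 0 = 0" using g[OF good0] by simp
        have "((\<lambda>t. (?g t - ?g 0) /\<^sub>R t) \<longlongrightarrow> Y d a k) (at 0)"
          using Y[of d a k] unfolding has_real_derivative_iff_has_vector_derivative has_vector_derivative_at_0_iff .
        moreover have "\<forall>\<^sub>F t in at 0. (?g t - ?g 0) /\<^sub>R t = (\<Sum>j<ls ! d. ?x t j * M' d t j k)"
          using goodW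
        proof eventually_elim
          case (elim t)
          have "(?g t - ?g 0) /\<^sub>R t = ((\<Sum>j<ls ! d. W t d a j * M' d t j k) - (\<Sum>j<ls ! d. U d a j * M' d t j k)) /\<^sub>R t"
            unfolding g0 g[OF elim] by simp
          also have "\<dots> = (\<Sum>j<ls ! d. ?x t j * M' d t j k)"
            by (simp add: sum_subtractf[symmetric] sum_distrib_left algebra_simps)
          finally show ?case .
        qed
        ultimately show "((\<lambda>t. \<Sum>j<ls ! d. ?x t j * M' d t j k) \<longlongrightarrow> Y d a k) (at 0)"
          by (rule Lim_transform_eventually)
      qed (rule k)
      then show ?thesis
        unfolding has_real_derivative_iff_has_vector_derivative has_vector_derivative_at_0_iff W0 .
    qed
    then show ?thesis by blast
  qed
  then obtain Y where Y: "\<And>d a k. d < ?D \<Longrightarrow> a < ks ! d \<Longrightarrow> k < ls ! d \<Longrightarrow>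
      ((\<lambda>t. W t d a k) has_real_derivative Y d a k) (at 0)" by blast
  have "((\<lambda>t. tmul ks ls (W t) (\<Gamma> t)) has_vector_derivative
    (tmul ks ls (W 0) (tmul ls ks P v) + (\<Sum>d<length ls. tmul ks ls ((W 0)(d := Y d)) (\<Gamma> 0)))) (at 0)"
    by (rule tmul_curve_derivative[OF len Y \<Gamma>d])
  then have d1: "((\<lambda>t. tmul ks ls (W t) (\<Gamma> t)) has_vector_derivative
    (tmul ks ls U (tmul ls ks P v) + (\<Sum>d<length ls. tmul ks ls (U(d := Y d)) C))) (at 0)"
    by (simp only: W0 \<Gamma>0)
  have d2: "((\<lambda>t. tmul ks ls (W t) (\<Gamma> t)) has_vector_derivative v) (at 0)"
    unfolding has_vector_derivative_at_0_iff
  proof (rule Lim_transform_eventually)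
    show "((\<lambda>t. (\<gamma> t - \<gamma> 0) /\<^sub>R t) \<longlongrightarrow> v) (at 0)"
      using \<gamma>(3) unfolding has_vector_derivative_at_0_iff .
    show "\<forall>\<^sub>F t in at 0. (\<gamma> t - \<gamma> 0) /\<^sub>R t = (tmul ks ls (W t) (\<Gamma> t) - tmul ks ls (W 0) (\<Gamma> 0)) /\<^sub>R t"
      using goodW by eventually_elim (simp add: good_def \<gamma>(1) W0 \<Gamma>0)
  qed
  have veq: "v = tmul ks ls U (tmul ls ks P v) + (\<Sum>d<length ls. tmul ks ls (U(d := Y d)) C)"
    by (rule vector_derivative_unique_at[OF d2 d1])
  have "tmul ls ks P v \<in> tangent_space M C"
  proof (rule tangent_spaceI[OF \<Gamma>0 C _ \<Gamma>d])
    show "\<forall>\<^sub>F t in at 0. \<Gamma> t \<in> M" using goodW by eventually_elim (simp add: good_def)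
  qed
  then show "v \<in> tucker_tangent ks ls (tangent_space M C) U C"
    unfolding tucker_tangent_def using veq by blast
qed

theorem tangent_space_structured_tucker:
  assumes "length ks = length ls" "tucker_core_structure ls M"
    and "\<And>d. d < length ls \<Longrightarrow> full_col_rank (ks ! d) (ls ! d) (U d)" and "C \<in> M"
  shows "tangent_space (structured_tucker ks ls M) (tmul ks ls U C) =
    tucker_tangent ks ls (tangent_space M C) U C"
  using tucker_tangent_sub tucker_tangent_sup assms by (intro equalityI) auto

subsection \<open>The smallest singular value\<close>

definition eigenvalues :: "nat \<Rightarrow> mat \<Rightarrow> real set" where
  "eigenvalues N G = {ev. \<exists>x::nat \<Rightarrow> real. (\<exists>j<N. x j \<noteq> 0) \<and>
     (\<forall>i<N. (\<Sum>j<N. G i j * x j) = ev * x i)}"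

definition qform :: "nat \<Rightarrow> mat \<Rightarrow> (nat \<Rightarrow> real) \<Rightarrow> (nat \<Rightarrow> real) \<Rightarrow> real" where
  "qform N G x y = (\<Sum>i<N. x i * (\<Sum>j<N. G i j * y j))"

lemma sum_squares_pos_nat:
  fixes x :: "nat \<Rightarrow> real"
  assumes "j < N" "x j \<noteq> 0"
  shows "0 < (\<Sum>i<N. x i * x i)"
  using assms by (intro sum_pos2[of _ j]) (auto simp: zero_less_mult_iff linorder_neq_iff)

lemma qform_commute:
  assumes "\<And>i j. G i j = G j i"
  shows "qform N G x y = qform N G y x"
proof -
  have "qform N G x y = (\<Sum>i<N. \<Sum>j<N. x i * G i j * y j)"
    by (simp add: qform_def sum_distrib_left mult.assoc)
  also have "\<dots> = (\<Sum>j<N. \<Sum>i<N. x i * G i j * y j)" by (rule sum.swap)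
  also have "\<dots> = qform N G y x"
    unfolding qform_def sum_distrib_left using assms by (intro sum.cong refl) (simp add: mult_ac)
  finally show ?thesis .
qed

lemma qform_add_left: "qform N G (\<lambda>i. x i + t * y i) z = qform N G x z + t * qform N G y z"
  unfolding qform_def by (simp add: sum.distrib distrib_right sum_distrib_left mult.assoc)

lemma qform_add_right: "qform N G z (\<lambda>i. x i + t * y i) = qform N G z x + t * qform N G z y"
  unfolding qform_def by (simp add: sum.distrib distrib_left sum_distrib_left mult_ac)

text \<open>\<open>Min\<close> has its intended value only on finite sets. Eigenvectors of distinct
  eigenvalues are orthogonal, and \<open>N + 1\<close> nonzero vectors in dimension \<open>N\<close>
  cannot be.\<close>

lemma finite_eigenvalues:
  assumes sym: "\<And>i j. G i j = G j i"
  shows "finite (eigenvalues N G)"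
proof (rule ccontr)
  assume "infinite (eigenvalues N G)"
  then obtain E where E: "E \<subseteq> eigenvalues N G" "finite E" "card E = Suc N"
    using infinite_arbitrarily_large by metis
  have "\<forall>ev\<in>E. \<exists>x. (\<exists>j<N. x j \<noteq> 0) \<and> (\<forall>i<N. (\<Sum>j<N. G i j * x j) = ev * x i)"
    using E(1) unfolding eigenvalues_def by blast
  then obtain x where x0: "\<And>e. e \<in> E \<Longrightarrow> \<exists>j<N. x e j \<noteq> 0"
    and xe: "\<And>e i. e \<in> E \<Longrightarrow> i < N \<Longrightarrow> (\<Sum>j<N. G i j * x e j) = e * x e i"
    by metis
  have orth: "(\<Sum>i<N. x e i * x e' i) = 0" if "e \<in> E" "e' \<in> E" "e \<noteq> e'" for e e'
  proof -
    have q: "qform N G (x a) (x b) = b * (\<Sum>i<N. x a i * x b i)" if "b \<in> E" for a b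
      using xe[OF that] by (simp add: qform_def sum_distrib_left mult_ac)
    have "e' * (\<Sum>i<N. x e i * x e' i) = e * (\<Sum>i<N. x e' i * x e i)"
      using q[of e' e] q[of e e'] qform_commute[OF sym, where N = N and x = "x e" and y = "x e'"] that by simp
    then show ?thesis using that(3) by (simp add: mult.commute[of "x e' _"])
  qed
  obtain s where s: "\<exists>e\<in>E. s e \<noteq> 0" "\<And>i. i \<in> {..<N} \<Longrightarrow> (\<Sum>e\<in>E. x e i * s e) = 0"
    using underdetermined_system[of "{..<N}" E "\<lambda>i e. x e i"] E by auto
  obtain e where e: "e \<in> E" "s e \<noteq> 0" using s(1) by blast
  obtain j where j: "j < N" "x e j \<noteq> 0" using x0[OF e(1)] by blast
  have "0 = (\<Sum>i<N. x e i * (\<Sum>e'\<in>E. x e' i * s e'))" using s(2) by simp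
  also have "\<dots> = (\<Sum>e'\<in>E. \<Sum>i<N. x e i * (x e' i * s e'))"
    unfolding sum_distrib_left by (rule sum.swap)
  also have "\<dots> = (\<Sum>e'\<in>E. s e' * (\<Sum>i<N. x e i * x e' i))" by (simp add: sum_distrib_left mult_ac)
  also have "\<dots> = (\<Sum>e'\<in>E. if e' = e then s e * (\<Sum>i<N. x e i * x e i) else 0)"
    using orth e by (intro sum.cong refl) auto
  also have "\<dots> = s e * (\<Sum>i<N. x e i * x e i)" using e E(2) by simp
  finally show False using e sum_squares_pos_nat[where j = j and N = N and x = "x e", OF j] by simp
qed

text \<open>Vectors are functions on all naturals in the product topology; with the entries from
  \<open>N\<close> on set to 0, the sphere is a closed subset of a compact product of
  intervals.\<close>

lemma compact_unit_sphere_fun: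
  "compact {x::nat \<Rightarrow> real. (\<forall>i. N \<le> i \<longrightarrow> x i = 0) \<and> (\<Sum>i<N. x i * x i) = 1}" (is "compact ?K")
proof -
  have c: "continuous_on UNIV (\<lambda>x::nat \<Rightarrow> real. x i)" for i by simp
  have "compactin (product_topology (\<lambda>i. euclidean) UNIV) (PiE UNIV (\<lambda>i::nat. {-1..1::real}))"
    unfolding compactin_PiE by simp
  then have B: "compact (PiE UNIV (\<lambda>i::nat. {-1..1::real}))"
    by (simp add: euclidean_product_topology)
  have K: "?K = PiE UNIV (\<lambda>i. {-1..1}) \<inter> ((\<Inter>i\<in>{N..}. {x. x i = 0}) \<inter> {x. (\<Sum>i<N. x i * x i) = 1})"
  proof -
    have "\<bar>x i\<bar> \<le> 1" if x: "\<forall>i. N \<le> i \<longrightarrow> x i = 0" "(\<Sum>i<N. x i * x i) = 1" for x :: "nat \<Rightarrow> real" and i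
    proof (cases "i < N")
      case True
      then have "x i * x i \<le> (\<Sum>i<N. x i * x i)" by (intro member_le_sum) auto
      then have "(x i)^2 \<le> 1" using x by (simp add: power2_eq_square)
      then show ?thesis by (simp add: abs_square_le_1)
    qed (use x in auto)
    then show ?thesis by (fastforce simp: abs_le_iff)
  qed
  have "closed {x::nat \<Rightarrow> real. x i = 0}" for i
    by (intro closed_Collect_eq c continuous_on_const)
  moreover have "closed {x::nat \<Rightarrow> real. (\<Sum>i<N. x i * x i) = 1}"
    by (intro closed_Collect_eq c continuous_on_const continuous_on_sum continuous_on_mult)
  ultimately show ?thesis
    unfolding K by (intro compact_Int_closed B closed_Int closed_INT) auto
qed

text \<open>The Rayleigh quotient attains its minimum on the sphere, and a minimiser is an
  eigenvector because the first variation vanishes there. Every eigenvalue is a value of the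
  quotient, so this one is the least.\<close>

lemma eigenvalues_Min:
  assumes sym: "\<And>i j. G i j = G j i" and N: "0 < N"
  shows "\<And>x. Min (eigenvalues N G) * (\<Sum>i<N. x i * x i) \<le> qform N G x x"
    and "\<exists>x. (\<exists>j<N. x j \<noteq> 0) \<and> qform N G x x = Min (eigenvalues N G) * (\<Sum>i<N. x i * x i)"
proof -
  define K where "K = {x::nat \<Rightarrow> real. (\<forall>i. N \<le> i \<longrightarrow> x i = 0) \<and> (\<Sum>i<N. x i * x i) = 1}"
  have compact: "compact K" unfolding K_def by (rule compact_unit_sphere_fun)
  let ?n = "\<lambda>x::nat \<Rightarrow> real. (\<Sum>i<N. x i * x i)"
  have "(\<Sum>i<N. (if i = 0 then 1 else 0) * (if i = 0 then 1 else 0) :: real) = (\<Sum>i<N. if i = 0 then 1 else 0)"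
    by (intro sum.cong) auto
  then have "(\<lambda>i. if i = 0 then 1 else 0) \<in> K" using N by (auto simp: K_def)
  then have ne: "K \<noteq> {}" by blast
  have "continuous_on UNIV (\<lambda>x. qform N G x x)"
    unfolding qform_def
    by (intro continuous_on_sum continuous_on_mult continuous_on_const continuous_on_product_coordinates)
  then have "continuous_on K (\<lambda>x. qform N G x x)" by (rule continuous_on_subset) simp
  then obtain x where x: "x \<in> K" "\<And>y. y \<in> K \<Longrightarrow> qform N G x x \<le> qform N G y y"
    using continuous_attains_inf[OF compact ne] by blast
  define \<mu> where "\<mu> = qform N G x x"
  have bound: "\<mu> * ?n y \<le> qform N G y y" for y
  proof (cases "?n y = 0")
    case True
    then have "\<forall>i<N. y i = 0" by (subst (asm) sum_nonneg_eq_0_iff) auto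
    then show ?thesis using True by (simp add: qform_def)
  next
    case False
    then have pos: "0 < ?n y" using sum_nonneg[of "{..<N}" "\<lambda>i. y i * y i"] by simp
    define c where "c = 1 / sqrt (?n y)"
    have c2: "c * c * ?n y = 1" using pos by (simp add: c_def)
    define z where "z i = (if i < N then c * y i else 0)" for i
    have nz: "?n z = c * c * ?n y" unfolding sum_distrib_left by (intro sum.cong) (auto simp: z_def)
    have qz: "qform N G z z = c * c * qform N G y y"
      unfolding qform_def sum_distrib_left by (intro sum.cong refl) (auto simp: z_def)
    have "z \<in> K" using nz c2 by (auto simp: z_def K_def)
    from x(2)[OF this] have "\<mu> \<le> c * c * qform N G y y" unfolding \<mu>_def qz .
    then have "\<mu> * ?n y \<le> (c * c * qform N G y y) * ?n y" using pos by (intro mult_right_mono) auto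
    also have "\<dots> = (c * c * ?n y) * qform N G y y" by (simp only: mult_ac)
    finally show ?thesis by (simp only: c2)
  qed
  have xn: "?n x = 1" using x(1) by (simp add: K_def)
  have x0: "\<exists>j<N. x j \<noteq> 0"
  proof (rule ccontr)
    assume "\<not> ?thesis"
    then have "?n x = 0" by simp
    then show False using xn by simp
  qed
  have eig: "(\<Sum>j<N. G i j * x j) = \<mu> * x i" if i: "i < N" for i
  proof -
    define e :: "nat \<Rightarrow> real" where "e = (\<lambda>k. if k = i then 1 else 0)"
    have qe: "qform N G e x = (\<Sum>j<N. G i j * x j)"
    proof -
      have "qform N G e x = (\<Sum>k<N. if k = i then (\<Sum>j<N. G i j * x j) else 0)"
        unfolding qform_def by (intro sum.cong) (auto simp: e_def)
      then show ?thesis using i by simp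
    qed
    have ne: "(\<Sum>k<N. x k * e k) = x i"
    proof -
      have "(\<Sum>k<N. x k * e k) = (\<Sum>k<N. if k = i then x i else 0)"
        by (intro sum.cong) (auto simp: e_def)
      then show ?thesis using i by simp
    qed
    have nee: "?n e = 1"
    proof -
      have "?n e = (\<Sum>k<N. if k = i then 1 else 0)" by (intro sum.cong) (auto simp: e_def)
      then show ?thesis using i by simp
    qed
    \<comment> \<open>At \<open>x + t e\<close> the form minus \<open>\<mu>\<close> times the
      squared norm equals \<open>2 t b + t^2 a\<close>.\<close>
    define b where "b = qform N G e x - \<mu> * x i"
    define a where "a = qform N G e e - \<mu>"
    have "0 \<le> 2 * t * b + t * t * a" for t
    proof -
      let ?y = "\<lambda>i. x i + t * e i"
      have "?n ?y = 1 + 2 * t * x i + t * t"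
      proof -
        have "?n ?y = ?n x + 2 * t * (\<Sum>k<N. x k * e k) + t * t * ?n e"
          by (simp add: sum_distrib_left sum.distrib algebra_simps)
        then show ?thesis by (simp add: xn ne nee)
      qed
      moreover have "qform N G ?y ?y = \<mu> + 2 * t * qform N G e x + t * t * qform N G e e"
        unfolding qform_add_left qform_add_right
        using qform_commute[OF sym, where N = N and x = e and y = x] by (simp add: \<mu>_def algebra_simps)
      ultimately show ?thesis using bound[of ?y] by (simp add: a_def b_def algebra_simps)
    qed
    note nonneg = this
    have "b = 0"
    proof (rule ccontr)
      assume b: "b \<noteq> 0"
      \<comment> \<open>For small \<open>t\<close> the linear term wins; dividing by
        \<open>\<bar>a\<bar> + 1\<close> makes this explicit for either sign of
        \<open>a\<close>.\<close>
      define t where "t = - b / (\<bar>a\<bar> + 1)"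
      have p: "0 < \<bar>a\<bar> + 1" by linarith
      have "t * t * a \<le> t * t * (\<bar>a\<bar> + 1)" by (intro mult_left_mono) auto
      also have "\<dots> = - t * b" using p by (simp add: t_def)
      finally have "0 \<le> t * b" using nonneg[of t] by linarith
      moreover have "0 < b * b / (\<bar>a\<bar> + 1)"
        using b p by (intro divide_pos_pos) (auto simp: zero_less_mult_iff linorder_neq_iff)
      moreover have "t * b = - (b * b / (\<bar>a\<bar> + 1))" by (simp add: t_def)
      ultimately show False by linarith
    qed
    then show ?thesis using qe by (simp add: b_def)
  qed
  have mem: "\<mu> \<in> eigenvalues N G" unfolding eigenvalues_def using x0 eig by blast
  have least: "\<mu> \<le> ev" if ev: "ev \<in> eigenvalues N G" for ev
  proof -
    obtain y j where y: "j < N" "y j \<noteq> 0" "\<And>i. i < N \<Longrightarrow> (\<Sum>j<N. G i j * y j) = ev * y i"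
      using ev unfolding eigenvalues_def by blast
    have "qform N G y y = ev * ?n y"
      using y(3) by (simp add: qform_def sum_distrib_left mult_ac)
    then show ?thesis using bound[of y] sum_squares_pos_nat[where j = j and N = N and x = y, OF y(1,2)]
      by (simp add: mult_le_cancel_right)
  qed
  have Min: "Min (eigenvalues N G) = \<mu>"
    using finite_eigenvalues[OF sym] mem least by (intro Min_eqI) auto
  show "Min (eigenvalues N G) * ?n x \<le> qform N G x x" for x unfolding Min by (rule bound)
  show "\<exists>x. (\<exists>j<N. x j \<noteq> 0) \<and> qform N G x x = Min (eigenvalues N G) * ?n x"
    unfolding Min using x0 by (intro exI[of _ x]) (simp add: xn \<mu>_def)
qed

section \<open>Singular values and combinations of columns\<close>

definition combo :: "tensor list \<Rightarrow> (nat \<Rightarrow> real) \<Rightarrow> tensor" where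
  "combo cols x = (\<Sum>j<length cols. x j *\<^sub>R cols ! j)"

lemma tinner_combo_left: "tinner (combo cols x) A = (\<Sum>j<length cols. x j * tinner (cols ! j) A)"
  by (simp add: combo_def linear_sum[OF linear_tinner_left] linear_cmul[OF linear_tinner_left])

lemma tinner_combo:
  "tinner (combo cols x) (combo cols x) =
    qform (length cols) (\<lambda>i j. tinner (cols ! i) (cols ! j)) x x"
proof -
  have "tinner (cols ! i) (combo cols x) = (\<Sum>j<length cols. tinner (cols ! i) (cols ! j) * x j)" for i
    unfolding tinner_commute[of "cols ! i"] tinner_combo_left by (simp add: mult.commute)
  then show ?thesis unfolding qform_def tinner_combo_left by simp
qed

text \<open>A variational description that includes the case of more columns than rows: there some
  nontrivial combination vanishes, in agreement with the value 0. An empty list is excluded because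
  it has no eigenvalues.\<close>

lemma sigma_last_characterisation:
  assumes cols: "set cols \<subseteq> tspace ns" and N: "cols \<noteq> []"
    and \<sigma>: "\<sigma> = sigma_last (\<Prod>d<length ns. ns ! d) cols"
  shows "0 \<le> \<sigma>"
    and "\<And>x. \<sigma>\<^sup>2 * (\<Sum>j<length cols. x j * x j) \<le> tinner (combo cols x) (combo cols x)"
    and "\<exists>x. 0 < (\<Sum>j<length cols. x j * x j) \<and>
      tinner (combo cols x) (combo cols x) = \<sigma>\<^sup>2 * (\<Sum>j<length cols. x j * x j)"
proof -
  let ?N = "length cols" and ?G = "\<lambda>i j. tinner (cols ! i) (cols ! j)"
  have N0: "0 < ?N" using N by simp
  have "0 \<le> \<sigma> \<and> (\<forall>x. \<sigma>\<^sup>2 * (\<Sum>j<?N. x j * x j) \<le> tinner (combo cols x) (combo cols x)) \<and>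
    (\<exists>x. 0 < (\<Sum>j<?N. x j * x j) \<and> tinner (combo cols x) (combo cols x) = \<sigma>\<^sup>2 * (\<Sum>j<?N. x j * x j))"
  proof (cases "?N > (\<Prod>d<length ns. ns ! d)")
    case True
    then have \<sigma>0: "\<sigma> = 0" by (simp add: \<sigma> sigma_last_def Let_def)
    obtain x where x: "\<exists>j\<in>{..<?N}. x j \<noteq> 0"
      "\<And>i. i \<in> ibox ns \<Longrightarrow> (\<Sum>j\<in>{..<?N}. lk (cols ! j) i * x j) = 0"
      using underdetermined_system[of "ibox ns" "{..<?N}" "\<lambda>i j. lk (cols ! j) i"] True
      by (auto simp: card_ibox)
    have "combo cols x = 0"
    proof (rule poly_mapping_eqI)
      fix i
      have "(\<Sum>j<?N. x j * lk (cols ! j) i) = 0"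
      proof (cases "i \<in> ibox ns")
        case True
        then show ?thesis using x(2) by (simp add: mult.commute)
      next
        case False
        then have "lk (cols ! j) i = 0" if "j < ?N" for j
          using cols that nth_mem unfolding tspace_eq by blast
        then show ?thesis by simp
      qed
      then show "lk (combo cols x) i = lk 0 i" by (simp add: combo_def lookup_sum)
    qed
    moreover have "0 < (\<Sum>j<?N. x j * x j)" using x(1) sum_squares_pos_nat by auto
    ultimately show ?thesis using \<sigma>0 tinner_nonneg by (auto simp: tinner_def intro!: exI[of _ x])
  next
    case False
    note E = eigenvalues_Min[of ?G ?N, OF tinner_commute N0, folded tinner_combo]
    obtain x j where x: "j < ?N" "x j \<noteq> 0"
      "tinner (combo cols x) (combo cols x) = Min (eigenvalues ?N ?G) * (\<Sum>j<?N. x j * x j)"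
      using E(2) by blast
    note pos = sum_squares_pos_nat[where j = j and N = "?N" and x = x, OF x(1,2)]
    have nn: "0 \<le> Min (eigenvalues ?N ?G)"
      using x(3) tinner_nonneg[of "combo cols x"] pos by (simp add: zero_le_mult_iff)
    have "\<sigma> = sqrt (Min (eigenvalues ?N ?G))"
      using False by (simp add: \<sigma> sigma_last_def eigenvalues_def Let_def)
    then have "\<sigma>\<^sup>2 = Min (eigenvalues ?N ?G)" "0 \<le> \<sigma>" using nn by auto
    then show ?thesis using E(1) x(3) pos by auto
  qed
  then show "0 \<le> \<sigma>"
    and "\<And>x. \<sigma>\<^sup>2 * (\<Sum>j<length cols. x j * x j) \<le> tinner (combo cols x) (combo cols x)"
    and "\<exists>x. 0 < (\<Sum>j<length cols. x j * x j) \<and>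
      tinner (combo cols x) (combo cols x) = \<sigma>\<^sup>2 * (\<Sum>j<length cols. x j * x j)" by blast+
qed

text \<open>These pairs determine the smallest singular value and, unlike the columns, do not depend on
  the choice of orthonormal bases.\<close>
definition combo_pairs :: "tensor list \<Rightarrow> (tensor \<times> real) set" where
  "combo_pairs cols = {(combo cols x, \<Sum>j<length cols. x j * x j) | x. True}"

definition norm_lower_bound :: "real \<Rightarrow> (tensor \<times> real) set \<Rightarrow> bool" where
  "norm_lower_bound c S \<longleftrightarrow> (\<forall>(v, q)\<in>S. c * q \<le> tinner v v)"

lemma norm_lower_bound_combo_pairs:
  "norm_lower_bound c (combo_pairs cols) \<longleftrightarrow>
    (\<forall>x. c * (\<Sum>j<length cols. x j * x j) \<le> tinner (combo cols x) (combo cols x))"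
  by (auto simp: norm_lower_bound_def combo_pairs_def)

text \<open>The lists may differ in length and ambient box: for a nonempty list the squared singular
  value is the largest of its lower bounds.\<close>

lemma sigma_last_eqI:
  assumes 1: "set cols1 \<subseteq> tspace ns1" and 2: "set cols2 \<subseteq> tspace ns2"
    and eq: "\<And>c. norm_lower_bound c (combo_pairs cols1) \<longleftrightarrow> norm_lower_bound c (combo_pairs cols2)"
  shows "sigma_last (\<Prod>d<length ns1. ns1 ! d) cols1 = sigma_last (\<Prod>d<length ns2. ns2 ! d) cols2"
proof -
  \<comment> \<open>Every \<open>c\<close> is a lower bound exactly when there are no columns, so
    equal bounds force both lists to be empty or neither.\<close>
  have empty: "norm_lower_bound c (combo_pairs [])" for c
    by (auto simp: norm_lower_bound_combo_pairs combo_def tinner_def)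
  have nonempty: "\<exists>c. \<not> norm_lower_bound c (combo_pairs cols)" if "cols \<noteq> []" for cols
  proof -
    let ?e = "\<lambda>j::nat. if j = 0 then 1 else 0 :: real"
    have p: "0 < (\<Sum>j<length cols. ?e j * ?e j)" (is "0 < ?s")
      using that by (intro sum_squares_pos_nat[where j = 0]) auto
    have "\<not> norm_lower_bound ((tinner (combo cols ?e) (combo cols ?e) + 1) / ?s) (combo_pairs cols)"
      unfolding norm_lower_bound_combo_pairs using p
      by (intro notI) (drule spec[of _ ?e], simp)
    then show ?thesis by blast
  qed
  show ?thesis
  proof (cases "cols1 = []")
    case True
    then have "cols2 = []" using eq empty nonempty by metis
    \<comment> \<open>Both sides are the same unspecified value
      \<open>sqrt (Min {})\<close>.\<close>
    with True show ?thesis by (simp add: sigma_last_def Let_def)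
  next
    case False
    then have False2: "cols2 \<noteq> []" using eq empty nonempty by metis
    define \<sigma>1 where "\<sigma>1 = sigma_last (\<Prod>d<length ns1. ns1 ! d) cols1"
    define \<sigma>2 where "\<sigma>2 = sigma_last (\<Prod>d<length ns2. ns2 ! d) cols2"
    note c1 = sigma_last_characterisation[OF 1 False \<sigma>1_def]
    note c2 = sigma_last_characterisation[OF 2 False2 \<sigma>2_def]
    have "norm_lower_bound (\<sigma>1\<^sup>2) (combo_pairs cols2)"
      using c1(2) unfolding eq[of "\<sigma>1\<^sup>2", symmetric] unfolding norm_lower_bound_combo_pairs by blast
    then have "\<sigma>1\<^sup>2 \<le> \<sigma>2\<^sup>2" using c2(3) unfolding norm_lower_bound_combo_pairs
      by (metis mult_le_cancel_right_pos)
    moreover have "norm_lower_bound (\<sigma>2\<^sup>2) (combo_pairs cols1)"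
      using c2(2) unfolding eq[of "\<sigma>2\<^sup>2"] unfolding norm_lower_bound_combo_pairs by blast
    then have "\<sigma>2\<^sup>2 \<le> \<sigma>1\<^sup>2" using c1(3) unfolding norm_lower_bound_combo_pairs
      by (metis mult_le_cancel_right_pos)
    ultimately have "\<sigma>1 = \<sigma>2" using c1(1) c2(1) by (simp add: power2_eq_iff_nonneg)
    then show ?thesis by (simp add: \<sigma>1_def \<sigma>2_def)
  qed
qed

lemma combo_pairs_Nil: "combo_pairs [] = {(0, 0)}"
  by (auto simp: combo_pairs_def combo_def)

lemma combo_pairs_append:
  "combo_pairs (as @ bs) = {(u + v, p + q) | u v p q. (u, p) \<in> combo_pairs as \<and> (v, q) \<in> combo_pairs bs}"
proof -
  let ?n = "length as" and ?m = "length bs"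
  have split: "(\<Sum>j<?n + ?m. g j) = (\<Sum>j<?n. g j) + (\<Sum>j<?m. g (?n + j))" for g :: "nat \<Rightarrow> 'b::comm_monoid_add"
  proof -
    have "{..<?n + ?m} = {..<?n} \<union> {?n..<?n + ?m}" by auto
    then have "(\<Sum>j<?n + ?m. g j) = (\<Sum>j<?n. g j) + (\<Sum>j\<in>{?n..<?n + ?m}. g j)"
      by (simp add: sum.union_disjoint ivl_disj_int)
    also have "(\<Sum>j\<in>{?n..<?n + ?m}. g j) = (\<Sum>j<?m. g (?n + j))"
      using sum.shift_bounds_nat_ivl[of g 0 ?n ?m] by (simp add: lessThan_atLeast0 add.commute)
    finally show ?thesis .
  qed
  have c: "combo (as @ bs) x = combo as x + combo bs (\<lambda>j. x (?n + j))" for x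
    by (simp add: combo_def split nth_append)
  show ?thesis
  proof (intro equalityI subsetI)
    fix z assume "z \<in> combo_pairs (as @ bs)"
    then show "z \<in> {(u + v, p + q) | u v p q. (u, p) \<in> combo_pairs as \<and> (v, q) \<in> combo_pairs bs}"
      unfolding combo_pairs_def by (auto simp: c split) blast
  next
    fix z assume "z \<in> {(u + v, p + q) | u v p q. (u, p) \<in> combo_pairs as \<and> (v, q) \<in> combo_pairs bs}"
    then obtain x y where z: "z = (combo as x + combo bs y, (\<Sum>j<?n. x j * x j) + (\<Sum>j<?m. y j * y j))"
      unfolding combo_pairs_def by auto
    define w where "w j = (if j < ?n then x j else y (j - ?n))" for j
    have "combo as w = combo as x" unfolding combo_def by (intro sum.cong) (auto simp: w_def)
    then have "z = (combo (as @ bs) w, \<Sum>j<length (as @ bs). w j * w j)"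
      by (simp add: z c split) (simp add: w_def)
    then show "z \<in> combo_pairs (as @ bs)" unfolding combo_pairs_def by blast
  qed
qed

lemma span_set_combo: "span (set bs) = range (combo bs)"
proof (intro equalityI subsetI)
  fix v assume "v \<in> span (set bs)"
  then show "v \<in> range (combo bs)"
  proof (induction rule: span_induct_alt)
    case base
    have "combo bs (\<lambda>_. 0) = 0" by (simp add: combo_def)
    then show ?case by (metis rangeI)
  next
    case (step c b v)
    then obtain x where x: "v = combo bs x" by blast
    obtain i where i: "i < length bs" "b = bs ! i" using step(1) by (auto simp: in_set_conv_nth)
    have "combo bs (\<lambda>j. (if j = i then c else 0) + x j) = (\<Sum>j<length bs. if j = i then c *\<^sub>R bs ! j else 0) + combo bs x"
      by (simp add: combo_def scaleR_left_distrib sum.distrib if_distrib[of "\<lambda>c. c *\<^sub>R _"] cong: if_cong)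
    also have "\<dots> = c *\<^sub>R b + v" using i x by simp
    finally show ?case by (metis rangeI)
  qed
next
  fix v assume "v \<in> range (combo bs)"
  then obtain x where "v = combo bs x" by blast
  then show "v \<in> span (set bs)" unfolding combo_def
    by (simp only:) (intro span_sum span_scale span_base nth_mem, simp)
qed

lemma tinner_combo_nth:
  assumes "\<forall>i<length bs. \<forall>j<length bs. tinner (bs ! i) (bs ! j) = (if i = j then 1 else 0)" "k < length bs"
  shows "tinner (combo bs x) (bs ! k) = x k"
proof -
  have "tinner (combo bs x) (bs ! k) = (\<Sum>j<length bs. x j * tinner (bs ! j) (bs ! k))"
    by (rule tinner_combo_left)
  also have "\<dots> = (\<Sum>j<length bs. if j = k then x k else 0)" using assms by (intro sum.cong) auto
  finally show ?thesis using assms(2) by simp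
qed

text \<open>By orthonormality the squared coefficients add up to the squared length, so the pairs
  remember only the space, and the basis picked by \<open>SOME\<close> in
  \<open>terracini_cols\<close> has no influence.\<close>

lemma combo_pairs_onb:
  assumes "onb_list S bs"
  shows "combo_pairs bs = {(v, tinner v v) | v. v \<in> S}"
proof -
  have S: "S = range (combo bs)"
    and o: "\<forall>i<length bs. \<forall>j<length bs. tinner (bs ! i) (bs ! j) = (if i = j then 1 else 0)"
    using assms unfolding onb_list_def span_set_combo by auto
  have "tinner (combo bs x) (combo bs x) = (\<Sum>j<length bs. x j * x j)" for x
  proof -
    have "tinner (combo bs x) (combo bs x) = (\<Sum>j<length bs. x j * tinner (combo bs x) (bs ! j))"
      by (subst tinner_combo_left) (simp only: tinner_commute)
    also have "\<dots> = (\<Sum>j<length bs. x j * x j)" using tinner_combo_nth[OF o] by simp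
    finally show ?thesis .
  qed
  then show ?thesis unfolding S combo_pairs_def by force
qed

text \<open>Orthonormal lists are no longer than the number of indices, so a longest one exists; if
  it did not span, a Gram-Schmidt step would lengthen it.\<close>

lemma onb_list_exists:
  assumes S: "subspace S" "S \<subseteq> tspace ns"
  obtains bs where "onb_list S bs"
proof -
  define on where "on bs \<longleftrightarrow> set bs \<subseteq> S \<and>
    (\<forall>i<length bs. \<forall>j<length bs. tinner (bs ! i) (bs ! j) = (if i = j then 1 else 0))" for bs
  have len: "length bs \<le> card (ibox ns)" if "on bs" for bs
  proof (rule ccontr)
    assume "\<not> ?thesis"
    then obtain x where x: "\<exists>j\<in>{..<length bs}. x j \<noteq> 0"
      "\<And>i. i \<in> ibox ns \<Longrightarrow> (\<Sum>j\<in>{..<length bs}. lk (bs ! j) i * x j) = 0"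
      using underdetermined_system[of "ibox ns" "{..<length bs}" "\<lambda>i j. lk (bs ! j) i"] by auto
    have "combo bs x = 0"
    proof (rule poly_mapping_eqI)
      fix i
      have "lk (bs ! j) i = 0" if "j < length bs" "i \<notin> ibox ns" for j
      proof -
        have "bs ! j \<in> tspace ns" using \<open>on bs\<close> that(1) S(2) nth_mem unfolding on_def by blast
        then show ?thesis using that(2) by (simp add: tspace_iff)
      qed
      then have "(\<Sum>j<length bs. x j * lk (bs ! j) i) = 0"
        using x(2)[of i] by (cases "i \<in> ibox ns") (auto simp: mult.commute)
      then show "lk (combo bs x) i = lk 0 i" by (simp add: combo_def lookup_sum)
    qed
    moreover obtain j where "j < length bs" "x j \<noteq> 0" using x(1) by blast
    ultimately show False
      using tinner_combo_nth[of bs j x] that unfolding on_def by (simp add: tinner_def)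
  qed
  have "on []" by (simp add: on_def)
  then obtain bs where bs: "on bs" "\<And>cs. on cs \<Longrightarrow> length cs \<le> length bs"
    using ex_has_greatest_nat[of on "[]" length "Suc (card (ibox ns))"] len by (auto simp: less_Suc_eq_le)
  have "v \<in> span (set bs)" if v: "v \<in> S" for v
  proof (rule ccontr)
    assume nv: "v \<notin> span (set bs)"
    define w where "w = v - combo bs (\<lambda>j. tinner v (bs ! j))"
    have cS: "combo bs x \<in> span (set bs)" for x by (simp add: span_set_combo)
    have spS: "span (set bs) \<subseteq> S" using bs(1) S(1) span_minimal unfolding on_def by blast
    have w0: "w \<noteq> 0" using nv cS[of "\<lambda>j. tinner v (bs ! j)"] unfolding w_def by auto
    have wS: "w \<in> S" unfolding w_def using v cS spS S(1) by (intro subspace_diff) auto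
    have o: "\<forall>i<length bs. \<forall>j<length bs. tinner (bs ! i) (bs ! j) = (if i = j then 1 else 0)"
      using bs(1) unfolding on_def by blast
    have wb: "tinner w (bs ! k) = 0" if "k < length bs" for k
      unfolding w_def linear_diff[OF linear_tinner_left] tinner_combo_nth[OF o that] by simp
    have pos: "0 < tinner w w" using tinner_nonneg[of w] tinner_eq_0_iff[of w] w0 by linarith
    define u where "u = (1 / sqrt (tinner w w)) *\<^sub>R w"
    have uu: "tinner u u = 1"
      unfolding u_def linear_cmul[OF linear_tinner_left] linear_cmul[OF linear_tinner_right]
      using pos by simp
    have ub: "tinner u (bs ! k) = 0" "tinner (bs ! k) u = 0" if "k < length bs" for k
      using wb[OF that] tinner_commute[of "bs ! k" u] by (simp_all add: u_def tinner_scaleR_left)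
    have "on (bs @ [u])"
      unfolding on_def
    proof (intro conjI allI impI)
      show "set (bs @ [u]) \<subseteq> S" using bs(1) wS S(1) unfolding on_def u_def by (auto intro: subspace_scale)
      show "tinner ((bs @ [u]) ! i) ((bs @ [u]) ! j) = (if i = j then 1 else 0)"
        if "i < length (bs @ [u])" "j < length (bs @ [u])" for i j
        using that o uu ub by (auto simp: nth_append less_Suc_eq)
    qed
    then show False using bs(2)[of "bs @ [u]"] by simp
  qed
  moreover have "span (set bs) \<subseteq> S" using bs(1) S(1) span_minimal unfolding on_def by blast
  ultimately have "onb_list S bs" using bs(1) unfolding onb_list_def on_def by blast
  then show thesis by (rule that)
qed

subsection \<open>Comparison of the two Terracini matrices\<close>

text \<open>The inequality \<open>c * |x|^2 <= |T x|^2\<close> for a single \<open>x\<close>,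
  expressed by the contributions \<open>v r\<close> of the blocks to \<open>T x\<close>.\<close>

definition block_bound :: "real \<Rightarrow> nat \<Rightarrow> (nat \<Rightarrow> tensor) \<Rightarrow> bool" where
  "block_bound c R v \<longleftrightarrow>
    c * (\<Sum>r<R. tinner (v r) (v r)) \<le> tinner (\<Sum>r<R. v r) (\<Sum>r<R. v r)"

lemma tinner_sum_sum: "tinner (\<Sum>r\<in>I. f r) (\<Sum>s\<in>J. g s) = (\<Sum>r\<in>I. \<Sum>s\<in>J. tinner (f r) (g s))"
  by (simp only: linear_sum[OF linear_tinner_left]) (simp only: linear_sum[OF linear_tinner_right])

lemma combo_pairs_concat:
  assumes "\<And>r. r < R \<Longrightarrow> onb_list (V r) (b r)"
  shows "combo_pairs (concat (map b [0..<R])) =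
    {(\<Sum>r<R. v r, \<Sum>r<R. tinner (v r) (v r)) | v. \<forall>r<R. v r \<in> V r}"
  using assms
proof (induction R)
  case 0
  then show ?case by (simp add: combo_pairs_Nil)
next
  case (Suc R)
  have IH: "combo_pairs (concat (map b [0..<R])) =
    {(\<Sum>r<R. v r, \<Sum>r<R. tinner (v r) (v r)) | v. \<forall>r<R. v r \<in> V r}"
    using Suc by simp
  have b: "combo_pairs (b R) = {(v, tinner v v) | v. v \<in> V R}"
    using Suc.prems by (intro combo_pairs_onb) simp
  show ?case
  proof (intro equalityI subsetI)
    fix z assume "z \<in> combo_pairs (concat (map b [0..<Suc R]))"
    then obtain v u where z: "\<forall>r<R. v r \<in> V r" "u \<in> V R"
      "z = ((\<Sum>r<R. v r) + u, (\<Sum>r<R. tinner (v r) (v r)) + tinner u u)"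
      by (auto simp: combo_pairs_append IH b)
    have "z = (\<Sum>r<Suc R. (v(R := u)) r, \<Sum>r<Suc R. tinner ((v(R := u)) r) ((v(R := u)) r))"
      using z(3) by simp
    moreover have "\<forall>r<Suc R. (v(R := u)) r \<in> V r" using z(1,2) by (auto simp: less_Suc_eq)
    ultimately show "z \<in> {(\<Sum>r<Suc R. v r, \<Sum>r<Suc R. tinner (v r) (v r)) | v. \<forall>r<Suc R. v r \<in> V r}"
      by blast
  next
    fix z assume "z \<in> {(\<Sum>r<Suc R. v r, \<Sum>r<Suc R. tinner (v r) (v r)) | v. \<forall>r<Suc R. v r \<in> V r}"
    then obtain v where v: "\<forall>r<Suc R. v r \<in> V r"
      "z = ((\<Sum>r<R. v r) + v R, (\<Sum>r<R. tinner (v r) (v r)) + tinner (v R) (v R))" by auto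
    have "(\<Sum>r<R. v r, \<Sum>r<R. tinner (v r) (v r)) \<in> combo_pairs (concat (map b [0..<R]))"
      unfolding IH using v(1) by (intro CollectI exI[of _ v]) auto
    moreover have "(v R, tinner (v R) (v R)) \<in> combo_pairs (b R)" unfolding b using v(1) by blast
    ultimately show "z \<in> combo_pairs (concat (map b [0..<Suc R]))"
      unfolding v(2) by (simp add: combo_pairs_append) blast
  qed
qed

text \<open>The passage from matrices to spaces: bases, ambient sizes and numbers of columns
  disappear, and inequalities for tuples of tangent vectors remain to be compared.\<close>

lemma kappa_sbtd_eqI:
  assumes len: "length As = R" "length Bs = R"
    and S: "\<And>r. r < R \<Longrightarrow> subspace (tangent_space (Ms ! r) (As ! r))"
      "\<And>r. r < R \<Longrightarrow> tangent_space (Ms ! r) (As ! r) \<subseteq> tspace ns"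
    and S': "\<And>r. r < R \<Longrightarrow> subspace (tangent_space (Ms' ! r) (Bs ! r))"
      "\<And>r. r < R \<Longrightarrow> tangent_space (Ms' ! r) (Bs ! r) \<subseteq> tspace ms"
    and eq: "\<And>c. (\<forall>v. (\<forall>r<R. v r \<in> tangent_space (Ms ! r) (As ! r)) \<longrightarrow> block_bound c R v) \<longleftrightarrow>
      (\<forall>v. (\<forall>r<R. v r \<in> tangent_space (Ms' ! r) (Bs ! r)) \<longrightarrow> block_bound c R v)"
  shows "kappa_sbtd ns Ms As = kappa_sbtd ms Ms' Bs"
proof -
  have key: "set (terracini_cols Ns Cs) \<subseteq> tspace ks \<and>
      (\<forall>c. norm_lower_bound c (combo_pairs (terracini_cols Ns Cs)) \<longleftrightarrow>
        (\<forall>v. (\<forall>r<R. v r \<in> tangent_space (Ns ! r) (Cs ! r)) \<longrightarrow> block_bound c R v))"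
    if "length Cs = R" "\<And>r. r < R \<Longrightarrow> subspace (tangent_space (Ns ! r) (Cs ! r))"
      "\<And>r. r < R \<Longrightarrow> tangent_space (Ns ! r) (Cs ! r) \<subseteq> tspace ks" for Ns Cs ks
  proof -
    let ?V = "\<lambda>r. tangent_space (Ns ! r) (Cs ! r)"
    define b where "b r = (SOME bs. onb_list (?V r) bs)" for r
    have b: "onb_list (?V r) (b r)" if "r < R" for r
    proof -
      obtain bs where "onb_list (?V r) bs"
        using onb_list_exists \<open>r < R\<close> \<open>\<And>r. r < R \<Longrightarrow> subspace (?V r)\<close> \<open>\<And>r. r < R \<Longrightarrow> ?V r \<subseteq> tspace ks\<close> by metis
      then show ?thesis unfolding b_def by (rule someI)
    qed
    have tc: "terracini_cols Ns Cs = concat (map b [0..<R])"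
      unfolding terracini_cols_def b_def that(1) ..
    have "set (b r) \<subseteq> tspace ks" if "r < R" for r
      using b[OF that] \<open>\<And>r. r < R \<Longrightarrow> ?V r \<subseteq> tspace ks\<close>[OF that] span_superset[of "set (b r)"]
      unfolding onb_list_def by blast
    then have "set (terracini_cols Ns Cs) \<subseteq> tspace ks" unfolding tc by fastforce
    moreover have cp: "combo_pairs (concat (map b [0..<R])) =
        {(\<Sum>r<R. v r, \<Sum>r<R. tinner (v r) (v r)) | v. \<forall>r<R. v r \<in> ?V r}"
      by (rule combo_pairs_concat) (rule b)
    moreover have "norm_lower_bound c (combo_pairs (terracini_cols Ns Cs)) \<longleftrightarrow>
        (\<forall>v. (\<forall>r<R. v r \<in> ?V r) \<longrightarrow> block_bound c R v)" for c
      unfolding tc cp norm_lower_bound_def block_bound_def by auto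
    ultimately show ?thesis by blast
  qed
  note kA = key[OF len(1) S] and kB = key[OF len(2) S']
  have "sigma_last (\<Prod>d<length ns. ns ! d) (terracini_cols Ms As) =
      sigma_last (\<Prod>d<length ms. ms ! d) (terracini_cols Ms' Bs)"
    using kA kB eq by (intro sigma_last_eqI) auto
  then show ?thesis unfolding kappa_sbtd_def by simp
qed

text \<open>Since the cross terms vanish between different blocks \<open>r\<close> and
  \<open>s\<close> too, both sides of the inequality split over \<open>I\<close>.\<close>

lemma block_bound_orthogonal_sum:
  assumes orth: "\<And>r s d e. r < R \<Longrightarrow> s < R \<Longrightarrow> d \<in> I \<Longrightarrow> e \<in> I \<Longrightarrow> d \<noteq> e \<Longrightarrow> tinner (z r d) (z s e) = 0"
    and I: "finite I" and b: "\<And>d. d \<in> I \<Longrightarrow> block_bound c R (\<lambda>r. z r d)"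
  shows "block_bound c R (\<lambda>r. \<Sum>d\<in>I. z r d)"
proof -
  have ip: "tinner (\<Sum>d\<in>I. z r d) (\<Sum>d\<in>I. z s d) = (\<Sum>d\<in>I. tinner (z r d) (z s d))"
    if "r < R" "s < R" for r s
  proof -
    have "tinner (\<Sum>d\<in>I. z r d) (\<Sum>d\<in>I. z s d) = (\<Sum>d\<in>I. \<Sum>e\<in>I. if e = d then tinner (z r d) (z s d) else 0)"
      unfolding tinner_sum_sum using orth that by (intro sum.cong refl) auto
    then show ?thesis using I by simp
  qed
  have "c * (\<Sum>r<R. tinner (\<Sum>d\<in>I. z r d) (\<Sum>d\<in>I. z r d)) = c * (\<Sum>r<R. \<Sum>d\<in>I. tinner (z r d) (z r d))"
    using ip by simp
  also have "\<dots> = (\<Sum>d\<in>I. c * (\<Sum>r<R. tinner (z r d) (z r d)))"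
    unfolding sum_distrib_left by (rule sum.swap)
  also have "\<dots> \<le> (\<Sum>d\<in>I. tinner (\<Sum>r<R. z r d) (\<Sum>r<R. z r d))"
    using b unfolding block_bound_def by (intro sum_mono) auto
  also have "\<dots> = (\<Sum>d\<in>I. \<Sum>r<R. \<Sum>s<R. tinner (z r d) (z s d))" by (simp add: tinner_sum_sum)
  also have "\<dots> = (\<Sum>r<R. \<Sum>d\<in>I. \<Sum>s<R. tinner (z r d) (z s d))" by (rule sum.swap)
  also have "\<dots> = (\<Sum>r<R. \<Sum>s<R. \<Sum>d\<in>I. tinner (z r d) (z s d))" by (intro sum.cong sum.swap refl)
  also have "\<dots> = (\<Sum>r<R. \<Sum>s<R. tinner (\<Sum>d\<in>I. z r d) (\<Sum>d\<in>I. z s d))" using ip by simp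
  finally show ?thesis unfolding block_bound_def tinner_sum_sum[of _ "{..<R}" _ "{..<R}"] .
qed

text \<open>The inequality involves \<open>y\<close> only through its Gram matrix, so it is
  inherited when that matrix is a sum of Gram matrices of families that satisfy it.\<close>

lemma block_bound_isometric_sum:
  assumes J: "finite J"
    and eq: "\<And>r s. r < R \<Longrightarrow> s < R \<Longrightarrow> tinner (y r) (y s) = (\<Sum>a\<in>J. tinner (x r a) (x s a))"
    and b: "\<And>a. a \<in> J \<Longrightarrow> block_bound c R (\<lambda>r. x r a)"
  shows "block_bound c R y"
proof -
  have "c * (\<Sum>r<R. tinner (y r) (y r)) = c * (\<Sum>r<R. \<Sum>a\<in>J. tinner (x r a) (x r a))"
    using eq by simp
  also have "\<dots> = (\<Sum>a\<in>J. c * (\<Sum>r<R. tinner (x r a) (x r a)))"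
    unfolding sum_distrib_left by (rule sum.swap)
  also have "\<dots> \<le> (\<Sum>a\<in>J. tinner (\<Sum>r<R. x r a) (\<Sum>r<R. x r a))"
    using b unfolding block_bound_def by (intro sum_mono) auto
  also have "\<dots> = (\<Sum>a\<in>J. \<Sum>r<R. \<Sum>s<R. tinner (x r a) (x s a))" by (simp add: tinner_sum_sum)
  also have "\<dots> = (\<Sum>r<R. \<Sum>a\<in>J. \<Sum>s<R. tinner (x r a) (x s a))" by (rule sum.swap)
  also have "\<dots> = (\<Sum>r<R. \<Sum>s<R. \<Sum>a\<in>J. tinner (x r a) (x s a))" by (intro sum.cong sum.swap refl)
  also have "\<dots> = (\<Sum>r<R. \<Sum>s<R. tinner (y r) (y s))" using eq by simp
  finally show ?thesis unfolding block_bound_def tinner_sum_sum .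
qed

section \<open>Factors with orthonormal columns\<close>

lemma mtrans_mmul: "mtrans (mmul m A B) = mmul m (mtrans B) (mtrans A)"
  by (simp add: mtrans_def mmul_def mult.commute)

lemma orthonormal_cols_iff: "orthonormal_cols k l Q \<longleftrightarrow> meq l l (mmul k (mtrans Q) Q) mid"
  by (simp add: orthonormal_cols_def meq_def mmul_def mtrans_def mid_def)

lemma tinner_tmul_orthogonal:
  assumes len: "length ls = length ks" "length ls' = length ks" and d: "d < length ks"
    and z: "meq (ls ! d) (ls' ! d) (mmul (ks ! d) (mtrans (F d)) (H d)) (\<lambda>_ _. 0)"
  shows "tinner (tmul ks ls F C) (tmul ks ls' H E) = 0"
proof -
  have "(\<Prod>d<length ks. mmul (ks ! d) (mtrans (F d)) (H d) (i ! d) (i' ! d)) = 0"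
    if "i \<in> ibox ls" "i' \<in> ibox ls'" for i i'
    using d z that len by (auto simp: meq_def ibox_nth intro!: bexI[of _ d])
  then show ?thesis unfolding tinner_tmul_tmul[OF len] by (intro sum.neutral ballI) simp
qed

lemma tinner_tmul_cong:
  assumes len: "length ls = length ks" "length ls' = length ks" "length ls = length ks'"
    and m: "\<And>d. d < length ks \<Longrightarrow> meq (ls ! d) (ls' ! d)
      (mmul (ks ! d) (mtrans (F d)) (H d)) (mmul (ks' ! d) (mtrans (F' d)) (H' d))"
  shows "tinner (tmul ks ls F C) (tmul ks ls' H E) = tinner (tmul ks' ls F' C) (tmul ks' ls' H' E)"
proof -
  have "(\<Prod>d<length ks. mmul (ks ! d) (mtrans (F d)) (H d) (i ! d) (i' ! d)) =
      (\<Prod>d<length ks'. mmul (ks' ! d) (mtrans (F' d)) (H' d) (i ! d) (i' ! d))"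
    if "i \<in> ibox ls" "i' \<in> ibox ls'" for i i'
    using m that len by (intro prod.cong) (auto simp: meq_def ibox_nth)
  then show ?thesis using len by (simp add: tinner_tmul_tmul)
qed

lemma tinner_tmul_isometry:
  assumes len: "length ms = length ns" and Q: "\<And>d. d < length ns \<Longrightarrow> orthonormal_cols (ns ! d) (ms ! d) (Q d)"
    and x: "x \<in> tspace ms" "y \<in> tspace ms"
  shows "tinner (tmul ns ms Q x) (tmul ns ms Q y) = tinner x y"
proof -
  have "tinner (tmul ns ms Q x) (tmul ns ms Q y) = tinner (tmul ms ms (\<lambda>_. mid) x) (tmul ms ms (\<lambda>_. mid) y)"
  proof (rule tinner_tmul_cong)
    fix d assume "d < length ns"
    then have "meq (ms ! d) (ms ! d) (mmul (ns ! d) (mtrans (Q d)) (Q d)) mid"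
      using Q orthonormal_cols_iff by blast
    moreover have "mtrans mid = mid" by (auto simp: mtrans_def mid_def fun_eq_iff)
    then have "meq (ms ! d) (ms ! d) mid (mmul (ms ! d) (mtrans mid) mid)"
      using mmul_mid_left meq_sym by metis
    ultimately show "meq (ms ! d) (ms ! d) (mmul (ns ! d) (mtrans (Q d)) (Q d)) (mmul (ms ! d) (mtrans mid) mid)"
      by (rule meq_trans)
  qed (use len in auto)
  then show ?thesis using x by (simp add: tmul_mid)
qed

lemma meq_isometry_cancel:
  assumes Q: "orthonormal_cols n m Q"
  shows "meq l l' (mmul n (mtrans (mmul m Q U)) (mmul m Q V)) (mmul m (mtrans U) V)"
proof -
  have eq: "mmul n (mtrans (mmul m Q U)) (mmul m Q V) = mmul m (mtrans U) (mmul m (mmul n (mtrans Q) Q) V)"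
    by (simp add: mtrans_mmul mmul_assoc)
  have "meq m l' (mmul m (mmul n (mtrans Q) Q) V) V"
    by (rule meq_trans[OF mmul_meq[OF Q[unfolded orthonormal_cols_iff] meq_refl] mmul_mid_left])
  then show ?thesis unfolding eq by (intro mmul_meq meq_refl)
qed

definition first_row :: "mat \<Rightarrow> nat \<Rightarrow> mat" where
  "first_row Y a = (\<lambda>i b. if i = 0 then Y a b else 0)"

text \<open>Cutting a mode-\<open>d\<close> perturbation into its \<open>d\<close>-slices turns it into tangent vectors at the
  compressed tensors, where each slice is placed into the first row of mode \<open>d\<close>.\<close>
lemma tinner_slices:
  assumes len: "length ls = length ns" "length ls' = length ns" "length ms = length ns" and d: "d < length ns"
    and pos: "0 < ms ! d"
    and V: "\<And>e. e < length ns \<Longrightarrow> meq (ls ! e) (ls' ! e)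
      (mmul (ns ! e) (mtrans (V e)) (V' e)) (mmul (ms ! e) (mtrans (U e)) (U' e))"
  shows "tinner (tmul ns ls (V(d := Y)) C) (tmul ns ls' (V'(d := Y')) E) =
    (\<Sum>a<ns ! d. tinner (tmul ms ls (U(d := first_row Y a)) C) (tmul ms ls' (U'(d := first_row Y' a)) E))"
proof -
  let ?D = "length ns"
  let ?P = "\<lambda>i i'. \<Prod>e\<in>{..<?D} - {d}. mmul (ms ! e) (mtrans (U e)) (U' e) (i ! e) (i' ! e)"
  \<comment> \<open>Matrices with a single nonzero row give the rank-one product of these rows;
    summed over \<open>a\<close> the products make up \<open>Y^T Y'\<close>. Row 0 exists because
    \<open>ms ! d\<close> is positive.\<close>
  have rows: "mmul (ms ! d) (mtrans (first_row Y a)) (first_row Y' a) p q = Y a p * Y' a q" for a p q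
  proof -
    have "mmul (ms ! d) (mtrans (first_row Y a)) (first_row Y' a) p q = (\<Sum>k<ms ! d. if k = 0 then Y a p * Y' a q else 0)"
      unfolding mmul_def mtrans_def first_row_def by (intro sum.cong) auto
    then show ?thesis using pos by simp
  qed
  have 1: "(\<Prod>e<?D. mmul (ns ! e) (mtrans ((V(d := Y)) e)) ((V'(d := Y')) e) (i ! e) (i' ! e)) =
      (\<Sum>a<ns ! d. Y a (i ! d) * Y' a (i' ! d)) * ?P i i'"
    if "i \<in> ibox ls" "i' \<in> ibox ls'" for i i'
  proof -
    have "(\<Prod>e\<in>{..<?D} - {d}. mmul (ns ! e) (mtrans ((V(d := Y)) e)) ((V'(d := Y')) e) (i ! e) (i' ! e)) = ?P i i'"
      using V that len by (intro prod.cong) (auto simp: meq_def ibox_nth)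
    then show ?thesis using d by (subst prod.remove[of _ d]) (auto simp: mmul_def mtrans_def)
  qed
  have 2: "(\<Prod>e<?D. mmul (ms ! e) (mtrans ((U(d := first_row Y a)) e)) ((U'(d := first_row Y' a)) e) (i ! e) (i' ! e)) =
      Y a (i ! d) * Y' a (i' ! d) * ?P i i'" for i i' a
  proof -
    have "(\<Prod>e\<in>{..<?D} - {d}. mmul (ms ! e) (mtrans ((U(d := first_row Y a)) e)) ((U'(d := first_row Y' a)) e) (i ! e) (i' ! e)) = ?P i i'"
      by (intro prod.cong) auto
    then show ?thesis using d rows by (subst prod.remove[of _ d]) auto
  qed
  have "tinner (tmul ns ls (V(d := Y)) C) (tmul ns ls' (V'(d := Y')) E) =
    (\<Sum>i\<in>ibox ls. \<Sum>i'\<in>ibox ls'. \<Sum>a<ns ! d. lk C i * lk E i' * (Y a (i ! d) * Y' a (i' ! d) * ?P i i'))"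
    unfolding tinner_tmul_tmul[OF len(1,2)]
    by (intro sum.cong refl) (simp only: 1 sum_distrib_left sum_distrib_right)
  also have "\<dots> = (\<Sum>i\<in>ibox ls. \<Sum>a<ns ! d. \<Sum>i'\<in>ibox ls'. lk C i * lk E i' * (Y a (i ! d) * Y' a (i' ! d) * ?P i i'))"
    by (intro sum.cong sum.swap refl)
  also have "\<dots> = (\<Sum>a<ns ! d. \<Sum>i\<in>ibox ls. \<Sum>i'\<in>ibox ls'. lk C i * lk E i' * (Y a (i ! d) * Y' a (i' ! d) * ?P i i'))"
    by (rule sum.swap)
  also have "\<dots> = (\<Sum>a<ns ! d. tinner (tmul ms ls (U(d := first_row Y a)) C) (tmul ms ls' (U'(d := first_row Y' a)) E))"
    using len by (simp only: tinner_tmul_tmul 2)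
  finally show ?thesis .
qed

text \<open>For a mode with \<open>ms ! d = 0\<close>, where no row can receive a slice; the boxes
  of the cores are then empty as well.\<close>

lemma tmul_empty_box:
  assumes "d < length ls" "ls ! d = 0"
  shows "tmul ks ls F C = 0"
proof -
  have "ibox ls = {}" using assms by (auto simp: ibox_def)
  then show ?thesis by (intro poly_mapping_eqI) (simp add: lookup_tmul)
qed

lemma tmul_upd_in_tucker_tangent:
  assumes "subspace T" "d < length ls"
  shows "tmul ks ls (U(d := X)) C \<in> tucker_tangent ks ls T U C"
proof -
  let ?X = "\<lambda>e. if e = d then X else (\<lambda>a b. 0)"
  have "tmul ks ls (U(e := ?X e)) C = (if e = d then tmul ks ls (U(d := X)) C else 0)" if "e < length ls" for e
    using tmul_upd_scale[OF that, of ks U 0 "\<lambda>a b. 0" C] by auto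
  then have "(\<Sum>e<length ls. tmul ks ls (U(e := ?X e)) C) = tmul ks ls (U(d := X)) C"
    using assms(2) by simp
  then have "tmul ks ls (U(d := X)) C = tmul ks ls U 0 + (\<Sum>e<length ls. tmul ks ls (U(e := ?X e)) C)"
    by (simp add: linear_0[OF linear_tmul])
  then show ?thesis
    unfolding tucker_tangent_def using subspace_0[OF assms(1)]
    by (intro CollectI exI[of _ 0] exI[of _ ?X] conjI)
qed

lemma tmul_mmul_upd:
  assumes "length ms = length ls"
  shows "tmul ns ms Q (tmul ms ls (U(d := X)) C) =
    tmul ns ls ((\<lambda>e. mmul (ms ! e) (Q e) (U e))(d := mmul (ms ! d) (Q d) X)) C"
  unfolding tmul_tmul[OF assms] by (rule arg_cong[where f = "\<lambda>F. tmul ns ls F C"]) auto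

lemma tmul_tucker_tangent:
  assumes "length ms = length ls"
  shows "tmul ns ms Q (tmul ms ls U c + (\<Sum>d<length ls. tmul ms ls (U(d := X d)) C)) =
    tmul ns ls (\<lambda>e. mmul (ms ! e) (Q e) (U e)) c +
    (\<Sum>d<length ls. tmul ns ls ((\<lambda>e. mmul (ms ! e) (Q e) (U e))(d := mmul (ms ! d) (Q d) (X d))) C)"
  unfolding linear_add[OF linear_tmul] linear_sum[OF linear_tmul] tmul_mmul_upd[OF assms]
  unfolding tmul_tmul[OF assms] ..

lemma block_bound_cong: "(\<And>r. r < R \<Longrightarrow> v r = w r) \<Longrightarrow> block_bound c R v \<longleftrightarrow> block_bound c R w"
  by (simp add: block_bound_def)

lemma block_bound_isometry:
  assumes "length ms = length ns" "\<And>d. d < length ns \<Longrightarrow> orthonormal_cols (ns ! d) (ms ! d) (Q d)"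
    and "\<And>r. r < R \<Longrightarrow> w r \<in> tspace ms"
  shows "block_bound c R (\<lambda>r. tmul ns ms Q (w r)) \<longleftrightarrow> block_bound c R w"
proof -
  have "(\<Sum>r<R. w r) \<in> tspace ms" using assms(3) subspace_tspace by (intro subspace_sum) auto
  then show ?thesis unfolding block_bound_def
    using tinner_tmul_isometry[OF assms(1,2)] assms(3)
    by (simp add: linear_sum[OF linear_tmul, symmetric])
qed

lemma tucker_tangent_subset: "tucker_tangent ks ls T U C \<subseteq> tspace ks"
  unfolding tucker_tangent_def using subspace_tspace[of ks]
  by (auto intro!: subspace_add subspace_sum)

text \<open>Multiplication by \<open>Q\<close> embeds the tuples at the compressed tensors
  isometrically into those at the original ones, which gives one implication. For the other, each
  factor perturbation is split by the projection \<open>Q Q^T\<close>, and the part in its kernel is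
  handled by slicing.\<close>

lemma block_bound_tucker_tangent:
  assumes len: "length ms = length ns" "\<And>r. r < R \<Longrightarrow> length (ls r) = length ns"
    and Q: "\<And>d. d < length ns \<Longrightarrow> orthonormal_cols (ns ! d) (ms ! d) (Q d)"
    and le: "\<And>r d. r < R \<Longrightarrow> d < length ns \<Longrightarrow> ls r ! d \<le> ms ! d"
    and T: "\<And>r. r < R \<Longrightarrow> subspace (T r)"
    and V_def: "\<And>r. V r = (\<lambda>e. mmul (ms ! e) (Q e) (U r e))"
  shows "(\<forall>v. (\<forall>r<R. v r \<in> tucker_tangent ns (ls r) (T r) (V r) (C r)) \<longrightarrow> block_bound c R v) \<longleftrightarrow>
    (\<forall>v. (\<forall>r<R. v r \<in> tucker_tangent ms (ls r) (T r) (U r) (C r)) \<longrightarrow> block_bound c R v)"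
proof (intro iffI allI impI)
  fix w assume A: "\<forall>v. (\<forall>r<R. v r \<in> tucker_tangent ns (ls r) (T r) (V r) (C r)) \<longrightarrow> block_bound c R v"
    and w: "\<forall>r<R. w r \<in> tucker_tangent ms (ls r) (T r) (U r) (C r)"
  have "tmul ns ms Q (w r) \<in> tucker_tangent ns (ls r) (T r) (V r) (C r)" if r: "r < R" for r
  proof -
    obtain c X where "c \<in> T r" "w r = tmul ms (ls r) (U r) c + (\<Sum>d<length (ls r). tmul ms (ls r) ((U r)(d := X d)) (C r))"
      using w r unfolding tucker_tangent_def by blast
    then show ?thesis using tmul_tucker_tangent[of ms "ls r" ns Q "U r" c X "C r"] len r
      unfolding tucker_tangent_def V_def by auto
  qed
  then have "block_bound c R (\<lambda>r. tmul ns ms Q (w r))" by (intro A[rule_format])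
  then show "block_bound c R w"
    using block_bound_isometry[OF len(1) Q, where R = R and w = w and c = c] w tucker_tangent_subset by blast
next
  let ?D = "length ns"
  fix v assume G: "\<forall>v. (\<forall>r<R. v r \<in> tucker_tangent ms (ls r) (T r) (U r) (C r)) \<longrightarrow> block_bound c R v"
    and v: "\<forall>r<R. v r \<in> tucker_tangent ns (ls r) (T r) (V r) (C r)"
  define P where "P r k X \<longleftrightarrow> k \<in> T r \<and>
    v r = tmul ns (ls r) (V r) k + (\<Sum>d<?D. tmul ns (ls r) ((V r)(d := X d)) (C r))" for r k X
  have "\<exists>k X. P r k X" if r: "r < R" for r
  proof -
    obtain k X where "k \<in> T r"
      "v r = tmul ns (ls r) (V r) k + (\<Sum>d<length (ls r). tmul ns (ls r) ((V r)(d := X d)) (C r))"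
      using v r unfolding tucker_tangent_def by blast
    then show ?thesis unfolding P_def len(2)[OF r] by (intro exI conjI)
  qed
  then obtain k X where kX: "\<And>r. r < R \<Longrightarrow> P r (k r) (X r)" by metis
  have k: "k r \<in> T r" if "r < R" for r using kX[OF that] unfolding P_def by blast
  have vX: "v r = tmul ns (ls r) (V r) (k r) + (\<Sum>d<?D. tmul ns (ls r) ((V r)(d := X r d)) (C r))"
    if "r < R" for r using kX[OF that] unfolding P_def by blast
  \<comment> \<open>\<open>X = Q Z + Y\<close> with \<open>Q^T Y = 0\<close>: \<open>Z\<close>
    perturbs the compressed factor, and \<open>Y\<close> is orthogonal to the range of
    \<open>Q\<close>.\<close>
  define Z where "Z r d = mmul (ns ! d) (mtrans (Q d)) (X r d)" for r d
  define Y where "Y r d = (\<lambda>a b. X r d a b + - 1 * mmul (ms ! d) (Q d) (Z r d) a b)" for r d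
  define w where "w r = tmul ms (ls r) (U r) (k r) + (\<Sum>d<?D. tmul ms (ls r) ((U r)(d := Z r d)) (C r))" for r
  define y where "y r d = tmul ns (ls r) ((V r)(d := Y r d)) (C r)" for r d
  \<comment> \<open>The index \<open>?D\<close>, one past the last mode, carries the part in the
    image of \<open>Q\<close>, so that the whole splitting is a single orthogonal sum.\<close>
  define z where "z r d = (if d = ?D then tmul ns ms Q (w r) else y r d)" for r d
  have w: "w r \<in> tucker_tangent ms (ls r) (T r) (U r) (C r)" if "r < R" for r
    unfolding w_def tucker_tangent_def using k[OF that] len(2)[OF that] by auto
  have vz: "v r = (\<Sum>d\<le>?D. z r d)" if r: "r < R" for r
  proof -
    have "tmul ns ms Q (w r) = tmul ns (ls r) (V r) (k r) +
        (\<Sum>d<?D. tmul ns (ls r) ((V r)(d := mmul (ms ! d) (Q d) (Z r d))) (C r))"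
      using tmul_tucker_tangent[of ms "ls r" ns Q "U r" "k r" "Z r" "C r"] len r by (simp add: w_def V_def)
    moreover have "y r d = tmul ns (ls r) ((V r)(d := X r d)) (C r) -
        tmul ns (ls r) ((V r)(d := mmul (ms ! d) (Q d) (Z r d))) (C r)" if "d < ?D" for d
    proof -
      have d: "d < length (ls r)" using that len r by simp
      show ?thesis
        unfolding y_def Y_def tmul_upd_add[OF d] tmul_upd_scale[OF d] by simp
    qed
    ultimately have "v r = (\<Sum>d<?D. y r d) + tmul ns ms Q (w r)"
      by (simp add: vX[OF r] sum_subtractf)
    moreover have "{..?D} = insert ?D {..<?D}" by auto
    ultimately show ?thesis by (simp add: z_def add.commute)
  qed
  have QY: "meq (ls r ! d) (ms ! d) (mmul (ns ! d) (mtrans (Y r d)) (Q d)) (\<lambda>_ _. 0)" if d: "d < ?D" for r d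
  proof -
    have QQ: "meq (ms ! d) (ms ! d) (mmul (ns ! d) (mtrans (Q d)) (Q d)) mid"
      using Q[OF d] orthonormal_cols_iff by blast
    have "mmul (ns ! d) (mtrans (Q d)) (Y r d) i j = 0" if i: "i < ms ! d" for i j
    proof -
      \<comment> \<open>The width \<open>Suc j\<close> serves to admit column \<open>j\<close>; the
        identity holds in every column.\<close>
      have m: "meq (ms ! d) (Suc j) (mmul (ms ! d) (mmul (ns ! d) (mtrans (Q d)) (Q d)) (Z r d)) (Z r d)"
        by (rule meq_trans[OF mmul_meq[OF QQ meq_refl] mmul_mid_left])
      have "mmul (ns ! d) (mtrans (Q d)) (Y r d) i j =
          Z r d i j - mmul (ns ! d) (mtrans (Q d)) (mmul (ms ! d) (Q d) (Z r d)) i j"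
        unfolding Z_def Y_def by (simp add: mmul_def right_diff_distrib sum_subtractf)
      also have "mmul (ns ! d) (mtrans (Q d)) (mmul (ms ! d) (Q d) (Z r d)) i j = Z r d i j"
        using meqD[OF m i lessI] by (simp add: mmul_assoc)
      finally show ?thesis by simp
    qed
    then show ?thesis by (simp add: meq_def mmul_def mtrans_def mult.commute)
  qed
  have QUY: "meq (ls r ! d) (ls s ! d) (mmul (ns ! d) (mtrans (Y r d)) (V s d)) (\<lambda>_ _. 0)" if d: "d < ?D" for r s d
  proof -
    have "meq (ls r ! d) (ls s ! d) (mmul (ms ! d) (mmul (ns ! d) (mtrans (Y r d)) (Q d)) (U s d))
        (mmul (ms ! d) (\<lambda>_ _. 0) (U s d))"
      by (rule mmul_meq[OF QY[OF d] meq_refl])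
    then show ?thesis by (simp add: V_def mmul_assoc) (simp add: mmul_def)
  qed
  have yw: "tinner (y r d) (tmul ns ms Q x) = 0" if "r < R" "d < ?D" for r d x
    unfolding y_def using that len QY by (intro tinner_tmul_orthogonal[of _ _ _ d]) auto
  \<comment> \<open>Mode \<open>d\<close> decides: there \<open>y r d\<close> has the factor
    \<open>Y r d\<close>, while \<open>y s e\<close> has \<open>V s d\<close>, whose columns lie in
    the range of \<open>Q d\<close>.\<close>
  have yy: "tinner (y r d) (y s e) = 0" if "r < R" "s < R" "d < ?D" "d \<noteq> e" for r s d e
    unfolding y_def using that len QUY by (intro tinner_tmul_orthogonal[of _ _ _ d]) auto
  have "block_bound c R (\<lambda>r. \<Sum>d\<le>?D. z r d)"
  proof (rule block_bound_orthogonal_sum)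
    fix r s d e assume *: "r < R" "s < R" "d \<in> {..?D}" "e \<in> {..?D}" "d \<noteq> e"
    show "tinner (z r d) (z s e) = 0"
      using * yw yy tinner_commute[of "tmul ns ms Q (w r)"] by (auto simp: z_def le_less)
  next
    fix d assume "d \<in> {..?D}"
    then consider "d = ?D" | "d < ?D" by fastforce
    then show "block_bound c R (\<lambda>r. z r d)"
    proof cases
      case 1
      have "block_bound c R w" using w by (intro G[rule_format])
      then have "block_bound c R (\<lambda>r. tmul ns ms Q (w r))"
        using block_bound_isometry[OF len(1) Q, where R = R and w = w and c = c] w tucker_tangent_subset by blast
      then show ?thesis using 1 by (simp add: z_def)
    next
      case 2
      have "block_bound c R (\<lambda>r. y r d)"
      proof (cases "ms ! d = 0")
        case True
        then have "y r d = 0" if "r < R" for r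
          unfolding y_def using le[OF that 2] len(2)[OF that] 2 by (intro tmul_empty_box[of d]) auto
        then have "block_bound c R (\<lambda>r. y r d) \<longleftrightarrow> block_bound c R (\<lambda>r. 0)" by (rule block_bound_cong)
        then show ?thesis by (simp add: block_bound_def tinner_def)
      next
        case False
        show ?thesis
        proof (rule block_bound_isometric_sum)
          fix r s assume "r < R" "s < R"
          then show "tinner (y r d) (y s d) = (\<Sum>a\<in>{..<ns ! d}.
              tinner (tmul ms (ls r) ((U r)(d := first_row (Y r d) a)) (C r))
                (tmul ms (ls s) ((U s)(d := first_row (Y s d) a)) (C s)))"
            unfolding y_def V_def using len Q 2 False by (intro tinner_slices meq_isometry_cancel) auto
        next
          \<comment> \<open>A slice is a mode-\<open>d\<close> perturbation with zero core velocity,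
            and perturbations are arbitrary, so it is tangent at the compressed tensor.\<close>
          fix a
          show "block_bound c R (\<lambda>r. tmul ms (ls r) ((U r)(d := first_row (Y r d) a)) (C r))"
            using 2 len T by (intro G[rule_format] tmul_upd_in_tucker_tangent) auto
        qed simp
      qed
      then show ?thesis using 2 by (simp add: z_def)
    qed
  qed simp
  then show "block_bound c R v" using block_bound_cong[where v = v and R = R, OF vz] by blast
qed

theorem theorem5p1:
  fixes Ms :: "tensor set list" and ls :: "nat list list"
    and ns ms :: "nat list" and Qs :: "mat list"
    and A G :: tensor and As Gs :: "tensor list"
  assumes "length ls = length Ms" and "length As = length Ms" and "length Gs = length Ms"
    and "length ms = length ns"
    and "\<forall>r<length Ms. length (ls ! r) = length ns"
    and "\<forall>r<length Ms. tucker_core_structure (ls ! r) (Ms ! r)"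
    and "\<forall>r<length Ms. \<forall>d<length ns. ls ! r ! d \<le> ns ! d \<and> ls ! r ! d \<le> ms ! d"
    and "length Qs = length ns"
    and "\<forall>d<length ns. orthonormal_cols (ns ! d) (ms ! d) (Qs ! d)"
    and "G \<in> tspace ms"
    and "A = mlmult ns ms Qs G"
    and "\<forall>r<length Ms. As ! r \<in> structured_tucker ns (ls ! r) (Ms ! r)"
    and "\<forall>r<length Ms. Gs ! r \<in> structured_tucker ms (ls ! r) (Ms ! r)"
    and "A = sum_list As"
    and "G = sum_list Gs"
    and "\<forall>r<length Ms. As ! r = mlmult ns ms Qs (Gs ! r)"
  shows "kappa_sbtd ns (map (\<lambda>r. structured_tucker ns (ls ! r) (Ms ! r)) [0..<length Ms]) As =
         kappa_sbtd ms (map (\<lambda>r. structured_tucker ms (ls ! r) (Ms ! r)) [0..<length Ms]) Gs"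
proof -
  let ?R = "length Ms"
  have "\<exists>C U. C \<in> Ms ! r \<and> (\<forall>d<length (ls ! r). full_col_rank (ms ! d) (ls ! r ! d) (U d)) \<and>
      Gs ! r = tmul ms (ls ! r) U C" if "r < ?R" for r
    using assms(13) that unfolding structured_tucker_iff by blast
  then obtain C U where C: "\<And>r. r < ?R \<Longrightarrow> C r \<in> Ms ! r"
    and U: "\<And>r d. r < ?R \<Longrightarrow> d < length (ls ! r) \<Longrightarrow> full_col_rank (ms ! d) (ls ! r ! d) (U r d)"
    and G: "\<And>r. r < ?R \<Longrightarrow> Gs ! r = tmul ms (ls ! r) (U r) (C r)"
    by metis
  \<comment> \<open>The core of \<open>Gs ! r\<close> also serves for \<open>As ! r\<close>, with
    factors \<open>Q U\<close>, so both tangent spaces are built on the same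
    \<open>T r\<close>.\<close>
  define V where "V r = (\<lambda>e. mmul (ms ! e) (Qs ! e) (U r e))" for r
  define T where "T r = tangent_space (Ms ! r) (C r)" for r
  have len: "length (ls ! r) = length ns" if "r < ?R" for r using assms(5) that by blast
  have core: "tucker_core_structure (ls ! r) (Ms ! r)" if "r < ?R" for r using assms(6) that by blast
  have A: "As ! r = tmul ns (ls ! r) (V r) (C r)" if "r < ?R" for r
  proof -
    have "As ! r = tmul ns ms (\<lambda>d. Qs ! d) (tmul ms (ls ! r) (U r) (C r))"
      using assms(16) G that by (simp add: mlmult_eq_tmul)
    then show ?thesis using tmul_tmul[of ms "ls ! r"] len[OF that] assms(4) by (simp add: V_def)
  qed
  have VU: "full_col_rank (ns ! d) (ls ! r ! d) (V r d)" if r: "r < ?R" and d: "d < length (ls ! r)" for r d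
  proof -
    have "full_col_rank (ns ! d) (ms ! d) (Qs ! d)"
      using assms(9) d len[OF r] orthonormal_cols_iff left_inverse_imp_full_col_rank by metis
    then show ?thesis unfolding V_def by (rule full_col_rank_mmul[OF _ U[OF r d]])
  qed
  have T: "subspace (T r)" if "r < ?R" for r
    unfolding T_def using core[OF that] C[OF that] subspace_tangent_space
    unfolding tucker_core_structure_def by blast
  have tA: "tangent_space (map (\<lambda>r. structured_tucker ns (ls ! r) (Ms ! r)) [0..<?R] ! r) (As ! r) =
      tucker_tangent ns (ls ! r) (T r) (V r) (C r)" if r: "r < ?R" for r
    using tangent_space_structured_tucker[OF _ core[OF r] VU[OF r] C[OF r]] r len[OF r]
    by (simp add: A T_def)
  have tG: "tangent_space (map (\<lambda>r. structured_tucker ms (ls ! r) (Ms ! r)) [0..<?R] ! r) (Gs ! r) =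
      tucker_tangent ms (ls ! r) (T r) (U r) (C r)" if r: "r < ?R" for r
    using tangent_space_structured_tucker[OF _ core[OF r] U[OF r] C[OF r]] r len[OF r] assms(4)
    by (simp add: G T_def)
  have main: "(\<forall>v. (\<forall>r<?R. v r \<in> tucker_tangent ns (ls ! r) (T r) (V r) (C r)) \<longrightarrow> block_bound c ?R v) \<longleftrightarrow>
    (\<forall>v. (\<forall>r<?R. v r \<in> tucker_tangent ms (ls ! r) (T r) (U r) (C r)) \<longrightarrow> block_bound c ?R v)" for c
    by (rule block_bound_tucker_tangent[where Q = "\<lambda>d. Qs ! d" and ls = "\<lambda>r. ls ! r"])
      (use assms len T V_def in auto)
  show ?thesis
  proof (rule kappa_sbtd_eqI[where R = ?R])
    show "(\<forall>v. (\<forall>r<?R. v r \<in> tangent_space (map (\<lambda>r. structured_tucker ns (ls ! r) (Ms ! r)) [0..<?R] ! r) (As ! r)) \<longrightarrow>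
        block_bound c ?R v) \<longleftrightarrow>
      (\<forall>v. (\<forall>r<?R. v r \<in> tangent_space (map (\<lambda>r. structured_tucker ms (ls ! r) (Ms ! r)) [0..<?R] ! r) (Gs ! r)) \<longrightarrow>
        block_bound c ?R v)" for c
      using main[of c] by (simp only: tA tG cong: imp_cong)
  qed (use assms(2,3) tA tG T subspace_tucker_tangent tucker_tangent_subset in auto)
qed

end
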